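(* Let $\Omega := (-1,1)^2\setminus([0,1]\times[-1,0])\subset\mathbb{R}^2$ be the L-shaped domain and let $u\in C(\overline{\Omega})\cap H^2_{\mathrm{loc}}(\Omega)$ be the strong solution to $-\Delta u = 1$ in $\Omega$ with $u=0$ on $\partial\Omega$. Let $V:=\{v\in C(\overline{\Omega})\cap H^2_{\mathrm{loc}}(\Omega):\Delta v\in L^2(\Omega)\}$ be endowed with the norm $\|v\|_V := \|v\|_{L^\infty(\partial\Omega)} + C_{\mathrm{ABP}}\|\Delta v\|_{L^2(\Omega)}$. Then $u$ is not the uniform limit on $\Omega$ of any sequence $(u_j)_j\subset V$ that is bounded with respect to $\|\cdot\|_V$ and consists of functions $u_j\in H^2(\Omega)$ with $u_j=0$ on $\partial\Omega$.
   Context: $C_{\mathrm{ABP}}>0$ denotes a fixed constant for which the Alexandrov-Bakelman-Pucci maximum principle $\|v\|_{L^\infty(\Omega)}\le\|v\|_{L^\infty(\partial\Omega)}+C_{\mathrm{ABP}}\|\Delta v\|_{L^2(\Omega)}$ holds for all $v\in V$. A strong solution is a function in $C(\overline\Omega)\cap H^2_{\mathrm{loc}}(\Omega)$ satisfying the equation a.e. in $\Omega$ and the boundary condition pointwise; it exists and is unique here. *)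

theory Defs
  imports "HOL-Analysis.Analysis"
begin

text \<open>
  Functions on \<open>\<Omega>\<close> (or on its closure) are represented by total functions on the ambient space
  whose values outside that set are never used.
\<close>

definition L_domain :: "(real \<times> real) set" where
  "L_domain = {-1<..<1} \<times> {-1<..<1} - {0..1} \<times> {-1..0}"


subsection \<open>Test functions and weak derivatives\<close>

text \<open>A list \<open>bs\<close> of basis vectors plays the role of a multi-index of order \<open>length bs\<close>.\<close>

definition partial_deriv :: "'a::euclidean_space \<Rightarrow> ('a \<Rightarrow> real) \<Rightarrow> 'a \<Rightarrow> real" where
  "partial_deriv b f = (\<lambda>x. frechet_derivative f (at x) b)"

definition partial_derivs :: "'a::euclidean_space list \<Rightarrow> ('a \<Rightarrow> real) \<Rightarrow> 'a \<Rightarrow> real" where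
  "partial_derivs bs f = foldr partial_deriv bs f"

definition C_infinity :: "('a::euclidean_space \<Rightarrow> real) \<Rightarrow> bool" where
  "C_infinity f \<longleftrightarrow> (\<forall>bs\<in>lists Basis. \<forall>x. partial_derivs bs f differentiable (at x))"

definition test_functions :: "'a::euclidean_space set \<Rightarrow> ('a \<Rightarrow> real) set" where
  "test_functions \<Omega> =
     {\<phi>. C_infinity \<phi> \<and> compact (closure {x. \<phi> x \<noteq> 0}) \<and> closure {x. \<phi> x \<noteq> 0} \<subseteq> \<Omega>}"

definition locally_integrable :: "'a::euclidean_space set \<Rightarrow> ('a \<Rightarrow> real) \<Rightarrow> bool" where
  "locally_integrable \<Omega> f \<longleftrightarrow> (\<forall>K. compact K \<and> K \<subseteq> \<Omega> \<longrightarrow> integrable (lebesgue_on K) f)"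

definition has_weak_deriv ::
    "'a::euclidean_space set \<Rightarrow> 'a list \<Rightarrow> ('a \<Rightarrow> real) \<Rightarrow> ('a \<Rightarrow> real) \<Rightarrow> bool" where
  "has_weak_deriv \<Omega> bs f g \<longleftrightarrow>
     locally_integrable \<Omega> f \<and> locally_integrable \<Omega> g \<and>
     (\<forall>\<phi>\<in>test_functions \<Omega>.
        (LINT x|lebesgue_on \<Omega>. f x * partial_derivs bs \<phi> x) =
        (-1) ^ length bs * (LINT x|lebesgue_on \<Omega>. g x * \<phi> x))"

text \<open>
  Weak derivatives are unique up to null sets, so for open \<open>\<Omega>\<close> every notion below is
  independent of the representative chosen here.
\<close>

definition weak_deriv ::
    "'a::euclidean_space set \<Rightarrow> 'a list \<Rightarrow> ('a \<Rightarrow> real) \<Rightarrow> 'a \<Rightarrow> real" where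
  "weak_deriv \<Omega> bs f = (SOME g. has_weak_deriv \<Omega> bs f g)"

definition weak_laplacian :: "'a::euclidean_space set \<Rightarrow> ('a \<Rightarrow> real) \<Rightarrow> 'a \<Rightarrow> real" where
  "weak_laplacian \<Omega> f = (\<lambda>x. \<Sum>b\<in>Basis. weak_deriv \<Omega> [b, b] f x)"


subsection \<open>Function spaces and norms\<close>

definition L2 :: "'a::euclidean_space set \<Rightarrow> ('a \<Rightarrow> real) set" where
  "L2 \<Omega> = {f. f \<in> borel_measurable (lebesgue_on \<Omega>) \<and> integrable (lebesgue_on \<Omega>) (\<lambda>x. (f x)\<^sup>2)}"

definition L2_norm :: "'a::euclidean_space set \<Rightarrow> ('a \<Rightarrow> real) \<Rightarrow> real" where
  "L2_norm \<Omega> f = sqrt (LINT x|lebesgue_on \<Omega>. (f x)\<^sup>2)"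

definition L2_loc :: "'a::euclidean_space set \<Rightarrow> ('a \<Rightarrow> real) set" where
  "L2_loc \<Omega> = {f. \<forall>K. compact K \<and> K \<subseteq> \<Omega> \<longrightarrow> f \<in> L2 K}"

text \<open>The Sobolev spaces \<open>H\<^sup>k(\<Omega>)\<close> and \<open>H\<^sup>k\<^sub>l\<^sub>o\<^sub>c(\<Omega>)\<close>.\<close>

definition sobolev_H :: "nat \<Rightarrow> 'a::euclidean_space set \<Rightarrow> ('a \<Rightarrow> real) set" where
  "sobolev_H k \<Omega> = {f. f \<in> L2 \<Omega> \<and>
     (\<forall>bs\<in>lists Basis. length bs \<le> k \<longrightarrow> (\<exists>g\<in>L2 \<Omega>. has_weak_deriv \<Omega> bs f g))}"

definition sobolev_H_loc :: "nat \<Rightarrow> 'a::euclidean_space set \<Rightarrow> ('a \<Rightarrow> real) set" where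
  "sobolev_H_loc k \<Omega> = {f. f \<in> L2_loc \<Omega> \<and>
     (\<forall>bs\<in>lists Basis. length bs \<le> k \<longrightarrow> (\<exists>g\<in>L2_loc \<Omega>. has_weak_deriv \<Omega> bs f g))}"

text \<open>
  The \<open>L\<^sup>\<infinity>\<close> norm on \<open>\<Omega>\<close> and on its boundary; it is only applied to functions that are continuous on
  the compact closure of \<open>\<Omega>\<close>, for which the essential supremum is the supremum.
\<close>

definition sup_norm_on :: "'a set \<Rightarrow> ('a \<Rightarrow> real) \<Rightarrow> real" where
  "sup_norm_on S v = (SUP x\<in>S. \<bar>v x\<bar>)"

definition V_space :: "'a::euclidean_space set \<Rightarrow> ('a \<Rightarrow> real) set" where
  "V_space \<Omega> = {v. continuous_on (closure \<Omega>) v \<and> v \<in> sobolev_H_loc 2 \<Omega> \<and> weak_laplacian \<Omega> v \<in> L2 \<Omega>}"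

definition V_norm :: "real \<Rightarrow> 'a::euclidean_space set \<Rightarrow> ('a \<Rightarrow> real) \<Rightarrow> real" where
  "V_norm C \<Omega> v = sup_norm_on (frontier \<Omega>) v + C * L2_norm \<Omega> (weak_laplacian \<Omega> v)"

definition ABP_constant :: "'a::euclidean_space set \<Rightarrow> real \<Rightarrow> bool" where
  "ABP_constant \<Omega> C \<longleftrightarrow> C > 0 \<and>
     (\<forall>v\<in>V_space \<Omega>. sup_norm_on \<Omega> v
        \<le> sup_norm_on (frontier \<Omega>) v + C * L2_norm \<Omega> (weak_laplacian \<Omega> v))"

text \<open>Strong solutions of \<open>-\<Delta>u = f\<close> in \<open>\<Omega>\<close>, \<open>u = g\<close> on the boundary.\<close>

definition poisson_strong_solution ::
    "'a::euclidean_space set \<Rightarrow> ('a \<Rightarrow> real) \<Rightarrow> ('a \<Rightarrow> real) \<Rightarrow> ('a \<Rightarrow> real) \<Rightarrow> bool" where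
  "poisson_strong_solution \<Omega> f g u \<longleftrightarrow>
     continuous_on (closure \<Omega>) u \<and> u \<in> sobolev_H_loc 2 \<Omega> \<and>
     (AE x in lebesgue_on \<Omega>. - weak_laplacian \<Omega> u x = f x) \<and>
     (\<forall>x\<in>frontier \<Omega>. u x = g x)"

end

theory Submission
  imports Defs "HOL-Complex_Analysis.Complex_Analysis" "HOL-Real_Asymp.Real_Asymp"
begin

text \<open>
  In polar coordinates at the re-entrant corner let \<open>S\<close> be the singular harmonic function
  \<open>r\<^bsup>-2/3\<^esup> sin (2\<theta>/3)\<close>, which vanishes on both edges, and let \<open>\<phi>\<close> be \<open>S\<close> times a radial factor chosen such
  that \<open>\<phi>\<close> is nonnegative, subharmonic, equal to \<open>S\<close> up to a less singular term near the corner, and zero for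
  large \<open>r\<close>.  A function \<open>v\<close> in \<open>H\<^sup>2\<close> that vanishes on the boundary is \<open>O(r)\<close> at the corner, so Green's
  identity between \<open>v\<close> and \<open>\<phi>\<close> has no contribution from the corner.  Since \<open>S\<close> is square integrable, the
  identity survives uniform limits of such functions with Laplacians bounded in \<open>L\<^sup>2\<close>.  For the strong
  solution \<open>u\<close> it would equate the integral of \<open>u \<Delta>\<phi> \<ge> 0\<close> with that of \<open>- \<phi>\<close>, which is negative.
\<close>

subsection \<open>Smooth functions\<close>

text \<open>The radial factor has the form \<open>J (rad z)\<close>, where \<open>rad\<close> is
  r^(-4/3). Both \<open>pot\<close>, which is r^(2/3) sin (2 theta / 3), and
  \<open>pot * rad\<close>, which is the singular function, are harmonic. Hence the terms with the
  first derivative of \<open>J\<close> cancel in the Laplacian of \<open>pot * J (rad)\<close>, only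
  the second derivative survives, and subharmonicity becomes convexity of \<open>J\<close>.
  Truncating \<open>J\<close> at distance r from the corner costs at most a constant times r^(-2/3)
  times the supremum of |v| near the corner. Decay of order r^(2/3), that of \<open>pot\<close>
  itself, is therefore the borderline, and O(r) is more than enough. The constant in O(r) depends on
  the second derivatives of v, on which the sequence has no assumed common bound; so the truncation
  has to be removed for each approximating function separately, before the sequence passes to its
  limit. Derivatives being weak, everything is read off from test functions: point values are
  recovered from averages against mollifiers, and the edges are approached by cutting off on level
  sets of \<open>pot\<close>.\<close>

lemma partial_derivs_Nil [simp]: "partial_derivs [] f = f"
  by (simp add: partial_derivs_def)

lemma partial_derivs_Cons [simp]: "partial_derivs (b # bs) f = partial_deriv b (partial_derivs bs f)"
  by (simp add: partial_derivs_def)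

lemma partial_derivs_snoc: "partial_derivs (bs @ [b]) f = partial_derivs bs (partial_deriv b f)"
  by (simp add: partial_derivs_def)

lemma partial_deriv_eqI:
  "(f has_derivative f') (at x) \<Longrightarrow> partial_deriv b f x = f' b"
  unfolding partial_deriv_def using frechet_derivative_at by metis

lemma partial_deriv_cong_open:
  assumes "open U" "x \<in> U" "\<And>y. y \<in> U \<Longrightarrow> f y = g y"
  shows "partial_deriv b f x = partial_deriv b g x"
proof -
  have "(f has_derivative D) (at x) \<longleftrightarrow> (g has_derivative D) (at x)" for D
    using assms by (metis has_derivative_transform_within_open)
  then show ?thesis by (simp add: partial_deriv_def frechet_derivative_def)
qed

lemma differentiable_cong_open:
  assumes "open U" "x \<in> U" "\<And>y. y \<in> U \<Longrightarrow> f y = g y" "f differentiable at x"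
  shows "g differentiable at x"
  using assms by (metis differentiable_def has_derivative_transform_within_open)

text \<open>A local form of \<open>C_infinity\<close>: the harmonic function and its radial factor
  are smooth only on an open sector, and become smooth on the plane after cutting off.\<close>

definition smooth_on :: "'a::euclidean_space set \<Rightarrow> ('a \<Rightarrow> real) \<Rightarrow> bool" where
  "smooth_on U f \<longleftrightarrow> (\<forall>bs\<in>lists Basis. \<forall>x\<in>U. partial_derivs bs f differentiable at x)"

lemma C_infinity_iff_smooth_on: "C_infinity f \<longleftrightarrow> smooth_on UNIV f"
  by (simp add: C_infinity_def smooth_on_def)

lemma smooth_on_differentiable: "smooth_on U f \<Longrightarrow> x \<in> U \<Longrightarrow> f differentiable at x"
  unfolding smooth_on_def by (metis lists.Nil partial_derivs_Nil)

lemma smooth_on_continuous_on: "smooth_on U f \<Longrightarrow> continuous_on U f"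
  by (meson continuous_at_imp_continuous_on differentiable_imp_continuous_within smooth_on_differentiable)

lemma smooth_on_partial_deriv:
  assumes "smooth_on U f" "b \<in> Basis" shows "smooth_on U (partial_deriv b f)"
  unfolding smooth_on_def
proof (intro ballI)
  fix bs x assume "bs \<in> lists (Basis :: 'a set)" "x \<in> U"
  then have "bs @ [b] \<in> lists Basis" using assms by auto
  then show "partial_derivs bs (partial_deriv b f) differentiable at x"
    using assms \<open>x \<in> U\<close> unfolding smooth_on_def by (metis partial_derivs_snoc)
qed

lemma smooth_on_subset: "smooth_on U f \<Longrightarrow> V \<subseteq> U \<Longrightarrow> smooth_on V f"
  by (auto simp: smooth_on_def)

text \<open>Smoothness speaks of all iterated derivatives at once; it follows for every member of a
  family that is closed under partial derivatives. Equality on \<open>U\<close> suffices for the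
  closure because \<open>U\<close> is open, so derivatives there depend only on the values on
  \<open>U\<close>.\<close>

lemma smooth_on_coinduct:
  assumes "open U" "f \<in> F"
    and diff: "\<And>g x. g \<in> F \<Longrightarrow> x \<in> U \<Longrightarrow> g differentiable at x"
    and step: "\<And>g b. g \<in> F \<Longrightarrow> b \<in> Basis \<Longrightarrow> \<exists>h\<in>F. \<forall>x\<in>U. partial_deriv b g x = h x"
  shows "smooth_on U f"
  unfolding smooth_on_def
proof (intro ballI)
  fix bs x assume bs: "bs \<in> lists (Basis :: 'a set)" and "x \<in> U"
  have "\<exists>h\<in>F. \<forall>x\<in>U. partial_derivs bs f x = h x"
    using bs
  proof (induction bs)
    case Nil then show ?case using \<open>f \<in> F\<close> by auto
  next
    case (Cons b bs)
    then obtain h where "h \<in> F" "\<forall>x\<in>U. partial_derivs bs f x = h x" by auto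
    moreover obtain h' where "h' \<in> F" "\<forall>x\<in>U. partial_deriv b h x = h' x"
      using step[OF \<open>h \<in> F\<close>, of b] Cons by auto
    ultimately show ?case
      using partial_deriv_cong_open[OF \<open>open U\<close>, of _ "partial_derivs bs f" h] by (intro bexI[of _ h']) auto
  qed
  then show "partial_derivs bs f differentiable at x"
    using differentiable_cong_open[OF \<open>open U\<close> \<open>x \<in> U\<close>] diff \<open>x \<in> U\<close> by metis
qed

lemma smooth_on_cong:
  assumes "open U" "smooth_on U f" "\<And>x. x \<in> U \<Longrightarrow> f x = g x"
  shows "smooth_on U g"
proof (rule smooth_on_coinduct[where F = "{g. \<exists>f. smooth_on U f \<and> (\<forall>x\<in>U. f x = g x)}"])
  fix g x assume "g \<in> {g. \<exists>f. smooth_on U f \<and> (\<forall>x\<in>U. f x = g x)}" "x \<in> U"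
  then show "g differentiable at x"
    using differentiable_cong_open[OF \<open>open U\<close> \<open>x \<in> U\<close>] smooth_on_differentiable by blast
next
  fix g and b :: 'a assume "g \<in> {g. \<exists>f. smooth_on U f \<and> (\<forall>x\<in>U. f x = g x)}" and b: "b \<in> Basis"
  then obtain f where f: "smooth_on U f" "\<forall>x\<in>U. f x = g x" by auto
  then show "\<exists>h\<in>{g. \<exists>f. smooth_on U f \<and> (\<forall>x\<in>U. f x = g x)}. \<forall>x\<in>U. partial_deriv b g x = h x"
    using smooth_on_partial_deriv[OF f(1) b] partial_deriv_cong_open[OF \<open>open U\<close>, of _ f g b]
    by (intro bexI[of _ "partial_deriv b f"]) auto
qed (use assms in auto)

text \<open>Product and chain rules lead out of a family of generators but stay in the algebra that
  they generate, so only the derivatives of the generators have to be examined.\<close>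

inductive_set function_algebra :: "('a \<Rightarrow> real) set \<Rightarrow> ('a \<Rightarrow> real) set" for X where
  base: "f \<in> X \<Longrightarrow> f \<in> function_algebra X"
| const: "(\<lambda>_. c) \<in> function_algebra X"
| add: "f \<in> function_algebra X \<Longrightarrow> g \<in> function_algebra X \<Longrightarrow> (\<lambda>x. f x + g x) \<in> function_algebra X"
| mult: "f \<in> function_algebra X \<Longrightarrow> g \<in> function_algebra X \<Longrightarrow> (\<lambda>x. f x * g x) \<in> function_algebra X"

lemma smooth_on_function_algebra:
  assumes "open U" and f: "f \<in> function_algebra X"
    and diff: "\<And>g x. g \<in> X \<Longrightarrow> x \<in> U \<Longrightarrow> g differentiable at x"
    and step: "\<And>g b. g \<in> X \<Longrightarrow> b \<in> Basis \<Longrightarrow> \<exists>h\<in>function_algebra X. \<forall>x\<in>U. partial_deriv b g x = h x"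
  shows "smooth_on U f"
proof (rule smooth_on_coinduct[OF \<open>open U\<close> f])
  show D: "g differentiable at x" if "g \<in> function_algebra X" "x \<in> U" for g x
    using that by induction (auto intro: diff)
  fix g and b :: 'a assume g: "g \<in> function_algebra X" and b: "b \<in> Basis"
  have fr: "(h has_derivative (\<lambda>b. partial_deriv b h x)) (at x)" if "h \<in> function_algebra X" "x \<in> U" for h x
    using D[OF that] by (simp add: partial_deriv_def frechet_derivative_works)
  from g show "\<exists>h\<in>function_algebra X. \<forall>x\<in>U. partial_deriv b g x = h x"
  proof induction
    case (base f) then show ?case using step b by auto
  next
    case (const c)
    have "partial_deriv b (\<lambda>_. c) x = 0" for x :: 'a
      by (rule partial_deriv_eqI) auto
    then show ?case by (intro bexI[OF _ function_algebra.const[of 0]]) auto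
  next
    case (add f g)
    then obtain f' g' where fg: "f' \<in> function_algebra X" "g' \<in> function_algebra X"
      and "\<forall>x\<in>U. partial_deriv b f x = f' x" "\<forall>x\<in>U. partial_deriv b g x = g' x" by auto
    moreover have "partial_deriv b (\<lambda>x. f x + g x) x = partial_deriv b f x + partial_deriv b g x" if "x \<in> U" for x
      by (rule partial_deriv_eqI[OF has_derivative_add[OF fr[OF add.hyps(1) that] fr[OF add.hyps(2) that]]])
    ultimately show ?case by (intro bexI[OF _ function_algebra.add[OF fg]]) auto
  next
    case (mult f g)
    then obtain f' g' where fg: "f' \<in> function_algebra X" "g' \<in> function_algebra X"
      and "\<forall>x\<in>U. partial_deriv b f x = f' x" "\<forall>x\<in>U. partial_deriv b g x = g' x" by auto
    moreover have "partial_deriv b (\<lambda>x. f x * g x) x = f x * partial_deriv b g x + partial_deriv b f x * g x" if "x \<in> U" for x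
      by (rule partial_deriv_eqI[OF has_derivative_mult[OF fr[OF mult.hyps(1) that] fr[OF mult.hyps(2) that]]])
    ultimately show ?case
      by (intro bexI[OF _ function_algebra.add[OF function_algebra.mult[OF mult.hyps(1) fg(2)]
          function_algebra.mult[OF fg(1) mult.hyps(2)]]]) auto
  qed
qed

lemma smooth_on_algebraI:
  assumes "open U" "f \<in> function_algebra {g. smooth_on U g}"
  shows "smooth_on U f"
  by (rule smooth_on_function_algebra[OF assms])
    (auto dest: smooth_on_differentiable intro: function_algebra.base smooth_on_partial_deriv)

lemma smooth_on_const: "open U \<Longrightarrow> smooth_on U (\<lambda>_. c)"
  by (rule smooth_on_algebraI) (auto intro: function_algebra.intros)

lemma smooth_on_add: "open U \<Longrightarrow> smooth_on U f \<Longrightarrow> smooth_on U g \<Longrightarrow> smooth_on U (\<lambda>x. f x + g x)"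
  by (rule smooth_on_algebraI) (auto intro: function_algebra.intros)

lemma smooth_on_mult: "open U \<Longrightarrow> smooth_on U f \<Longrightarrow> smooth_on U g \<Longrightarrow> smooth_on U (\<lambda>x. f x * g x)"
  by (rule smooth_on_algebraI) (auto intro: function_algebra.intros)

lemma smooth_on_diff:
  assumes "open U" "smooth_on U f" "smooth_on U g" shows "smooth_on U (\<lambda>x. f x - g x)"
  using smooth_on_add[OF assms(1,2) smooth_on_mult[OF assms(1) smooth_on_const[OF assms(1), of "-1"] assms(3)]]
  by simp

lemma smooth_on_bounded_linear:
  assumes "open U" "bounded_linear f" shows "smooth_on U f"
proof (rule smooth_on_function_algebra[where X = "{f}"])
  fix g and b :: 'a assume "g \<in> {f}"
  have "partial_deriv b f x = f b" for x
    by (rule partial_deriv_eqI) (rule bounded_linear_imp_has_derivative[OF assms(2)])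
  then show "\<exists>h\<in>function_algebra {f}. \<forall>x\<in>U. partial_deriv b g x = h x"
    using \<open>g \<in> {f}\<close> by (intro bexI[OF _ function_algebra.const[of "f b"]]) auto
qed (use assms in \<open>auto intro: function_algebra.intros bounded_linear_imp_differentiable\<close>)

lemma has_real_derivative_partial_deriv:
  fixes h :: "real \<Rightarrow> real"
  assumes "h differentiable at t" shows "(h has_real_derivative partial_deriv 1 h t) (at t)"
proof -
  obtain D where D: "(h has_real_derivative D) (at t)"
    using assms real_differentiable_def by blast
  then have "partial_deriv 1 h t = D"
    using partial_deriv_eqI[of h "(*) D" t 1] by (simp add: has_field_derivative_def)
  with D show ?thesis by simp
qed

text \<open>The derivative of \<open>h (f x)\<close> is a product of another composition with
  \<open>f\<close> and a partial derivative of \<open>f\<close>. The generators are therefore all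
  compositions of this kind together with all functions smooth on \<open>U\<close>.\<close>

lemma smooth_on_compose:
  fixes h :: "real \<Rightarrow> real"
  assumes "open U" "smooth_on V h" "smooth_on U f" "f ` U \<subseteq> V"
  shows "smooth_on U (\<lambda>x. h (f x))"
proof (rule smooth_on_function_algebra[OF \<open>open U\<close>])
  let ?X = "{\<lambda>x. h (f x) |h. smooth_on V h} \<union> {g. smooth_on U g}"
  show "(\<lambda>x. h (f x)) \<in> function_algebra ?X"
    using assms by (auto intro!: function_algebra.base)
  have D: "((\<lambda>x. h (f x)) has_derivative (\<lambda>b. partial_deriv 1 h (f x) * partial_deriv b f x)) (at x)"
    if "smooth_on V h" "x \<in> U" for h x
  proof -
    have 1: "(f has_derivative (\<lambda>b. partial_deriv b f x)) (at x)"
      using smooth_on_differentiable[OF assms(3) that(2)]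
      by (simp add: partial_deriv_def frechet_derivative_works)
    have "(h has_real_derivative partial_deriv 1 h (f x)) (at (f x))"
      using that assms by (intro has_real_derivative_partial_deriv smooth_on_differentiable[of V]) auto
    from diff_chain_at[OF 1 this[unfolded has_field_derivative_def]] show ?thesis
      by (simp add: o_def)
  qed
  show "g differentiable at x" if "g \<in> ?X" "x \<in> U" for g x
    using that D smooth_on_differentiable unfolding differentiable_def by blast
  show "\<exists>h\<in>function_algebra ?X. \<forall>x\<in>U. partial_deriv b g x = h x" if g: "g \<in> ?X" and b: "b \<in> Basis" for g b
  proof (cases "smooth_on U g")
    case True
    then show ?thesis using smooth_on_partial_deriv[OF True b] by (auto intro: function_algebra.base)
  next
    case False
    then obtain h where h: "smooth_on V h" "g = (\<lambda>x. h (f x))" using g by auto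
    have "(\<lambda>x. partial_deriv 1 h (f x)) \<in> function_algebra ?X"
      using h smooth_on_partial_deriv[of V h 1] by (intro function_algebra.base) auto
    moreover have "partial_deriv b f \<in> function_algebra ?X"
      using smooth_on_partial_deriv[OF assms(3) b] by (intro function_algebra.base) auto
    ultimately have "(\<lambda>x. partial_deriv 1 h (f x) * partial_deriv b f x) \<in> function_algebra ?X"
      by (rule function_algebra.mult)
    then show ?thesis
      by (rule rev_bexI) (use h D partial_deriv_eqI in blast)
  qed
qed

lemma smooth_on_realI:
  fixes f f' :: "real \<Rightarrow> real"
  assumes "open U" "\<And>x. x \<in> U \<Longrightarrow> (f has_real_derivative f' x) (at x)" "smooth_on U f'"
  shows "smooth_on U f"
proof (rule smooth_on_coinduct[where F = "insert f {g. smooth_on U g}"])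
  have D: "partial_deriv 1 f x = f' x" if "x \<in> U" for x
    using partial_deriv_eqI[of f "(*) (f' x)" x 1] assms(2)[OF that] by (simp add: has_field_derivative_def)
  show "\<exists>h\<in>insert f {g. smooth_on U g}. \<forall>x\<in>U. partial_deriv b g x = h x"
    if "g \<in> insert f {g. smooth_on U g}" "b \<in> Basis" for g :: "real \<Rightarrow> real" and b :: real
    using that D assms(3) smooth_on_partial_deriv[of U g 1] by auto
  show "g differentiable at x" if "g \<in> insert f {g. smooth_on U g}" "x \<in> U" for g x
    using that assms(2) smooth_on_differentiable real_differentiable_def by blast
qed (use assms in auto)

lemma smooth_on_powr: "smooth_on {0<..} (\<lambda>x::real. x powr a)"
proof (rule smooth_on_function_algebra[where X = "range (\<lambda>a x. x powr a)"])
  fix g :: "real \<Rightarrow> real" and b :: real assume "g \<in> range (\<lambda>a x. x powr a)" "b \<in> Basis"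
  then obtain a where a: "g = (\<lambda>x. x powr a)" "b = 1" by auto
  have "partial_deriv b g x = a * x powr (a - 1)" if "x > 0" for x
    using partial_deriv_eqI[of g "(*) (a * x powr (a - 1))" x 1]
      has_real_derivative_powr[OF that, of a] a by (simp add: has_field_derivative_def)
  moreover have "(\<lambda>x. a * x powr (a - 1)) \<in> function_algebra (range (\<lambda>a x. x powr a))"
    by (intro function_algebra.intros) auto
  ultimately show "\<exists>h\<in>function_algebra (range (\<lambda>a x. x powr a)). \<forall>x\<in>{0<..}. partial_deriv b g x = h x"
    by (intro bexI[of _ "\<lambda>x. a * x powr (a - 1)"]) auto
next
  fix g :: "real \<Rightarrow> real" and x :: real assume "g \<in> range (\<lambda>a x. x powr a)" "x \<in> {0<..}"
  then obtain a where "g = (\<lambda>x. x powr a)" by auto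
  then show "g differentiable at x"
    using has_real_derivative_powr[of x a] \<open>x \<in> {0<..}\<close> real_differentiable_def by auto
qed (auto intro: function_algebra.base)

text \<open>Real parts of holomorphic functions are closed under differentiation: the x derivative
  of Re F is Re F', the y derivative is Re (i F').\<close>

lemma smooth_on_Re_holomorphic:
  fixes F :: "complex \<Rightarrow> complex"
  assumes "open U" "open W" "F holomorphic_on W" "\<And>z. z \<in> U \<Longrightarrow> Complex (fst z) (snd z) \<in> W"
  shows "smooth_on U (\<lambda>z. Re (F (Complex (fst z) (snd z))))"
    and "\<And>z. z \<in> U \<Longrightarrow> ((\<lambda>z. Re (F (Complex (fst z) (snd z)))) has_derivative
        (\<lambda>h. fst h * Re (deriv F (Complex (fst z) (snd z))) - snd h * Im (deriv F (Complex (fst z) (snd z))))) (at z)"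
proof -
  let ?f = "\<lambda>F z. Re (F (Complex (fst z) (snd z)))"
  have lin: "((\<lambda>z. Complex (fst z) (snd z)) has_derivative (\<lambda>h. Complex (fst h) (snd h))) (at z)" for z
  proof (rule bounded_linear_imp_has_derivative)
    show "bounded_linear (\<lambda>h::real\<times>real. Complex (fst h) (snd h))"
      unfolding Complex_eq
      by (intro bounded_linear_add bounded_linear_mult_right bounded_linear_compose[OF bounded_linear_of_real]
          bounded_linear_compose[OF bounded_linear_mult_right] bounded_linear_fst bounded_linear_snd)
  qed
  have D: "(?f F has_derivative
        (\<lambda>h. fst h * Re (deriv F (Complex (fst z) (snd z))) - snd h * Im (deriv F (Complex (fst z) (snd z))))) (at z)"
    if "z \<in> U" "F holomorphic_on W" for z F
  proof -
    have "(F has_derivative (\<lambda>h. deriv F (Complex (fst z) (snd z)) * h)) (at (Complex (fst z) (snd z)))"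
      using holomorphic_derivI[OF that(2) \<open>open W\<close> assms(4)[OF that(1)]]
      by (simp add: has_field_derivative_def)
    from has_derivative_Re[OF diff_chain_at[OF lin this]] show ?thesis
      by (simp add: o_def algebra_simps)
  qed
  then show "(?f F has_derivative
        (\<lambda>h. fst h * Re (deriv F (Complex (fst z) (snd z))) - snd h * Im (deriv F (Complex (fst z) (snd z))))) (at z)"
    if "z \<in> U" for z
    using that assms(3) .
  show "smooth_on U (?f F)"
  proof (rule smooth_on_coinduct[OF \<open>open U\<close>, where F = "{?f F |F. F holomorphic_on W}"])
    show "\<exists>h\<in>{?f F |F. F holomorphic_on W}. \<forall>x\<in>U. partial_deriv b g x = h x"
      if g: "g \<in> {?f F |F. F holomorphic_on W}" and "b \<in> Basis" for g and b :: "real \<times> real"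
    proof -
      obtain F where F: "g = ?f F" "F holomorphic_on W" using g by auto
      have h: "deriv F holomorphic_on W" using F(2) assms(2) by (rule holomorphic_deriv)
      have h': "(\<lambda>z. \<i> * deriv F z) holomorphic_on W" by (rule holomorphic_on_mult[OF holomorphic_on_const h])
      have "b = (1,0) \<or> b = (0,1)" using that by (auto simp: Basis_prod_def)
      then show ?thesis
      proof
        assume b: "b = (1,0)"
        show ?thesis using h partial_deriv_eqI[OF D[OF _ F(2)], of _ b] F(1) b
          by (intro bexI[of _ "?f (deriv F)"]) auto
      next
        assume b: "b = (0,1)"
        have "?f (\<lambda>z. \<i> * deriv F z) \<in> {?f F |F. F holomorphic_on W}"
          by (intro CollectI exI[of _ "\<lambda>z. \<i> * deriv F z"] conjI refl h')
        then show ?thesis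
          by (rule rev_bexI) (use partial_deriv_eqI[OF D[OF _ F(2)], of _ b] F(1) b in auto)
      qed
    qed
    show "g differentiable at x" if "g \<in> {?f F |F. F holomorphic_on W}" "x \<in> U" for g x
      using that D unfolding differentiable_def by blast
  qed (use assms in auto)
qed

text \<open>The open sets \<open>U\<close> and \<open>- K\<close> cover the space, and the extended
  function is smooth on each: it is \<open>f\<close> on the first and zero on the second.\<close>

lemma C_infinity_extend_zero:
  assumes "open U" "smooth_on U f" "closed K" "K \<subseteq> U" "\<And>x. x \<in> U \<Longrightarrow> x \<notin> K \<Longrightarrow> f x = 0"
  shows "C_infinity (\<lambda>x. if x \<in> U then f x else 0)"
  unfolding C_infinity_def
proof (intro ballI allI)
  let ?g = "\<lambda>x. if x \<in> U then f x else 0"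
  fix bs and x :: 'a assume bs: "bs \<in> lists (Basis :: 'a set)"
  have "smooth_on U ?g" using assms by (intro smooth_on_cong[OF assms(1,2)]) auto
  moreover have "smooth_on (- K) ?g"
    using assms by (intro smooth_on_cong[OF _ smooth_on_const[of "- K" 0]]) auto
  moreover have "x \<in> U \<or> x \<in> - K" using assms(4) by auto
  ultimately show "partial_derivs bs ?g differentiable at x"
    using bs unfolding smooth_on_def by blast
qed


subsection \<open>A smooth bump and its primitives\<close>

text \<open>The classical flat function exp (-1/x). The polynomial in 1/x is carried along because
  differentiation then stays in the family, turning p into X^2 (p - p').\<close>

definition flat :: "real poly \<Rightarrow> real \<Rightarrow> real" where
  "flat p x = (if x > 0 then poly p (1 / x) * exp (- 1 / x) else 0)"

lemma tendsto_poly_div_exp: "((\<lambda>t::real. poly p t / exp t) \<longlongrightarrow> 0) at_top"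
proof -
  have "((\<lambda>t. \<Sum>i\<le>degree p. coeff p i * (t ^ i / exp t)) \<longlongrightarrow> (\<Sum>i\<le>degree p. coeff p i * 0)) at_top"
    by (intro tendsto_sum tendsto_mult tendsto_const tendsto_power_div_exp_0)
  then show ?thesis by (simp add: poly_altdef sum_divide_distrib)
qed

lemma flat_has_real_derivative:
  "(flat p has_real_derivative flat ([:0, 0, 1:] * (p - pderiv p)) x) (at x)"
proof -
  consider "x > 0" | "x < 0" | "x = 0" by linarith
  then show ?thesis
  proof cases
    case 1
    have "((\<lambda>x. poly p (1 / x) * exp (- 1 / x)) has_real_derivative
        flat ([:0, 0, 1:] * (p - pderiv p)) x) (at x)"
    proof -
      have "((\<lambda>x. poly p (1 / x)) has_real_derivative poly (pderiv p) (1 / x) * (- 1 / x\<^sup>2)) (at x)"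
        using 1 by (intro DERIV_chain2[OF poly_DERIV]) (auto intro!: derivative_eq_intros simp: power2_eq_square)
      moreover have "((\<lambda>x. exp (- 1 / x)) has_real_derivative exp (- 1 / x) * (1 / x\<^sup>2)) (at x)"
        using 1 by (intro DERIV_chain2[OF DERIV_exp]) (auto intro!: derivative_eq_intros simp: power2_eq_square)
      ultimately show ?thesis
        by (rule DERIV_cong[OF DERIV_mult]) (use 1 in \<open>simp add: flat_def power2_eq_square algebra_simps\<close>)
    qed
    then show ?thesis
      by (rule has_field_derivative_transform_within_open[of _ _ _ "{0<..}"]) (use 1 in \<open>auto simp: flat_def\<close>)
  next
    case 2
    have "((\<lambda>x. 0) has_real_derivative flat ([:0, 0, 1:] * (p - pderiv p)) x) (at x)"
      using 2 by (simp add: flat_def)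
    then show ?thesis
      by (rule has_field_derivative_transform_within_open[of _ _ _ "{..<0}"]) (use 2 in \<open>auto simp: flat_def\<close>)
  next
    case 3
    \<comment> \<open>At 0 the right difference quotient is again a polynomial in 1/h times exp
      (-1/h); the extra factor X is the division by h.\<close>
    have "((\<lambda>h. poly ([:0, 1:] * p) (inverse h) / exp (inverse h)) \<longlongrightarrow> 0) (at_right 0)"
      by (rule filterlim_compose[OF tendsto_poly_div_exp filterlim_inverse_at_top_right])
    then have "((\<lambda>h. (flat p (0 + h) - flat p 0) / h) \<longlongrightarrow> 0) (at_right 0)"
      by (rule Lim_transform_eventually)
        (auto simp: eventually_at_filter flat_def field_simps exp_minus)
    moreover have "((\<lambda>h. (flat p (0 + h) - flat p 0) / h) \<longlongrightarrow> 0) (at_left 0)"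
      by (rule Lim_transform_eventually[OF tendsto_const]) (auto simp: eventually_at_filter flat_def)
    ultimately show ?thesis
      unfolding 3 DERIV_def by (simp add: filterlim_split_at flat_def)
  qed
qed

lemma smooth_on_flat: "smooth_on UNIV (flat p)"
proof (rule smooth_on_coinduct[where F = "range flat"])
  fix g :: "real \<Rightarrow> real" and b :: real assume "g \<in> range flat" "b \<in> Basis"
  then obtain p where p: "g = flat p" "b = 1" by auto
  have "partial_deriv b g x = flat ([:0, 0, 1:] * (p - pderiv p)) x" for x
    using partial_deriv_eqI[OF flat_has_real_derivative[of p x, unfolded has_field_derivative_def], of b]
    by (simp add: p)
  then show "\<exists>h\<in>range flat. \<forall>x\<in>UNIV. partial_deriv b g x = h x" by blast
next
  fix g :: "real \<Rightarrow> real" and x assume "g \<in> range flat"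
  then show "g differentiable at x"
    using flat_has_real_derivative real_differentiable_def by blast
qed auto

lemma smooth_on_affine: "smooth_on UNIV (\<lambda>x::real. a * x + b)"
  by (intro smooth_on_add smooth_on_mult smooth_on_const smooth_on_bounded_linear) auto

lemma smooth_on_affine_compose:
  fixes h :: "real \<Rightarrow> real"
  shows "smooth_on UNIV h \<Longrightarrow> smooth_on UNIV (\<lambda>x. h (a * x + b))"
  by (rule smooth_on_compose[OF _ _ smooth_on_affine]) auto

text \<open>\<open>bump\<close> has mass 1 and lives on [-1, 1], so its successive primitives
  \<open>step\<close> and \<open>ramp\<close> are a smoothed Heaviside function and a smoothed
  positive part. The lower limit -2 lies strictly left of the support, so that the primitive is
  constantly zero around every point where the integration interval degenerates.\<close>

definition bump0 :: "real \<Rightarrow> real" where "bump0 x = flat 1 (1 + x) * flat 1 (1 - x)"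
definition bump :: "real \<Rightarrow> real" where "bump x = bump0 x / integral {-1..1} bump0"
definition step :: "real \<Rightarrow> real" where "step x = integral {-2..x} bump"
definition ramp :: "real \<Rightarrow> real" where "ramp x = integral {-2..x} step"

lemma bump0_nonneg: "bump0 x \<ge> 0" and bump0_zero: "1 \<le> \<bar>x\<bar> \<Longrightarrow> bump0 x = 0" and bump0_pos: "\<bar>x\<bar> < 1 \<Longrightarrow> bump0 x > 0"
  by (auto simp: bump0_def flat_def abs_if split: if_splits)

lemma smooth_on_bump0: "smooth_on UNIV bump0"
  using smooth_on_mult[OF _ smooth_on_affine_compose[OF smooth_on_flat[of 1], of 1 1]
    smooth_on_affine_compose[OF smooth_on_flat[of 1], of "-1" 1]]
  by (simp add: bump0_def[abs_def] algebra_simps)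

lemma continuous_on_bump0: "continuous_on S bump0"
  using smooth_on_continuous_on[OF smooth_on_bump0] continuous_on_subset by blast

lemma integral_bump0_pos: "integral {-1..1} bump0 > 0"
proof -
  have "integral {-1..1} bump0 \<noteq> 0"
  proof
    assume "integral {-1..1} bump0 = 0"
    then have "bump0 0 = 0"
      using integral_eq_0_iff[of "-1" 1 bump0] continuous_on_bump0 bump0_nonneg by auto
    then show False using bump0_pos[of 0] by auto
  qed
  moreover have "integral {-1..1} bump0 \<ge> 0"
    by (rule integral_nonneg) (auto intro: integrable_continuous_interval continuous_on_bump0 bump0_nonneg)
  ultimately show ?thesis by simp
qed

lemma bump_nonneg: "bump x \<ge> 0" and bump_zero: "1 \<le> \<bar>x\<bar> \<Longrightarrow> bump x = 0"
  using integral_bump0_pos by (auto simp: bump_def bump0_nonneg bump0_zero)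

lemma smooth_on_bump: "smooth_on UNIV bump"
  using smooth_on_mult[OF _ smooth_on_const smooth_on_bump0, of "1 / integral {-1..1} bump0"]
  by (simp add: bump_def[abs_def])

lemma continuous_on_bump: "continuous_on S bump"
  using smooth_on_continuous_on[OF smooth_on_bump] continuous_on_subset by blast

lemma has_real_derivative_integral_from:
  fixes f :: "real \<Rightarrow> real"
  assumes "\<And>S. continuous_on S f" "\<And>x. x \<le> -1 \<Longrightarrow> f x = 0"
  shows "((\<lambda>x. integral {-2..x} f) has_real_derivative f x) (at x)"
proof (cases "x > -2")
  case True
  have "((\<lambda>x. integral {-2..x} f) has_real_derivative f x) (at x within {-2..x+1})"
    using True by (intro integral_has_real_derivative assms) auto
  then show ?thesis using True by (simp add: at_within_Icc_at)
next
  case False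
  have z: "integral {-2..y} f = 0" if "y < -1" for y
    using that assms(2) by (intro integral_unique has_integral_is_0) auto
  have "((\<lambda>x. 0) has_real_derivative f x) (at x)" using False assms(2) by simp
  then show ?thesis
    by (rule has_field_derivative_transform_within_open[of _ _ _ "{..<-1}"]) (use False z in auto)
qed

lemma step_has_real_derivative: "(step has_real_derivative bump x) (at x)"
  unfolding step_def by (rule has_real_derivative_integral_from) (auto intro: continuous_on_bump bump_zero)

lemma step_eq_0: "x \<le> -1 \<Longrightarrow> step x = 0"
  unfolding step_def by (intro integral_unique has_integral_is_0) (auto intro: bump_zero)

lemma smooth_on_step: "smooth_on UNIV step"
  by (rule smooth_on_realI[OF _ step_has_real_derivative smooth_on_bump]) auto

lemma continuous_on_step: "continuous_on S step"
  using smooth_on_continuous_on[OF smooth_on_step] continuous_on_subset by blast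

lemma step_mono: "x \<le> y \<Longrightarrow> step x \<le> step y"
  by (erule DERIV_nonneg_imp_nondecreasing) (blast intro: step_has_real_derivative bump_nonneg)

lemma integral_bump: "integral {-1..1} bump = 1"
  using integral_bump0_pos by (simp add: bump_def[abs_def])

lemma step_eq_1: assumes "x \<ge> 1" shows "step x = 1"
proof -
  have "step x = step 1"
    by (rule DERIV_isconst2[of 1 "x + 1"]) (use assms in \<open>auto intro!: continuous_on_step DERIV_cong[OF step_has_real_derivative] simp: bump_zero\<close>)
  also have "step 1 = integral {-2..-1} bump + integral {-1..1} bump"
    unfolding step_def by (rule Henstock_Kurzweil_Integration.integral_combine[symmetric])
      (auto intro: integrable_continuous_interval continuous_on_bump)
  also have "integral {-2..-1} bump = 0" by (intro integral_unique has_integral_is_0) (auto intro: bump_zero)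
  finally show ?thesis by (simp add: integral_bump)
qed

lemma step_bounds: "0 \<le> step x" "step x \<le> 1"
  using step_mono[of "-1" "max x (-1)"] step_mono[of "min x (-1)" x] step_mono[of x "max x 1"]
    step_eq_0[of "min x (-1)"] step_eq_1[of "max x 1"] by auto

lemma ramp_has_real_derivative: "(ramp has_real_derivative step x) (at x)"
  unfolding ramp_def by (rule has_real_derivative_integral_from) (auto intro: continuous_on_step step_eq_0)

lemma ramp_eq_0: "x \<le> -1 \<Longrightarrow> ramp x = 0"
  unfolding ramp_def by (intro integral_unique has_integral_is_0) (auto intro: step_eq_0)

lemma smooth_on_ramp: "smooth_on UNIV ramp"
  by (rule smooth_on_realI[OF _ ramp_has_real_derivative smooth_on_step]) auto

lemma continuous_on_ramp: "continuous_on S ramp"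
  using smooth_on_continuous_on[OF smooth_on_ramp] continuous_on_subset by blast

text \<open>The value \<open>ramp 1\<close> stays uncomputed: it cancels from second differences, is
  scaled away in \<open>ramp_scaled\<close>, and near the corner only contributes a multiple of the
  less singular function \<open>pot\<close>.\<close>

lemma ramp_eq: assumes "x \<ge> 1" shows "ramp x = ramp 1 + (x - 1)"
proof -
  have "ramp x - x = ramp 1 - 1"
    by (rule DERIV_isconst2[of 1 "x + 1" "\<lambda>x. ramp x - x"])
      (use assms in \<open>auto intro!: continuous_on_diff continuous_on_ramp continuous_on_id
          DERIV_cong[OF DERIV_diff[OF ramp_has_real_derivative DERIV_ident]] simp: step_eq_1\<close>)
  then show ?thesis by simp
qed

lemma ramp_mono: "x \<le> y \<Longrightarrow> ramp x \<le> ramp y"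
  by (erule DERIV_nonneg_imp_nondecreasing) (blast intro: ramp_has_real_derivative step_bounds)

lemma ramp_nonneg: "0 \<le> ramp x"
  using ramp_mono[of "min x (-1)" x] ramp_eq_0[of "min x (-1)"] by auto

lemma ramp_le: assumes "x \<ge> -1" shows "ramp x \<le> x + 1"
proof -
  have "ramp x - x \<le> ramp (-1) - (-1)"
    by (rule DERIV_nonpos_imp_nonincreasing[OF assms, of "\<lambda>x. ramp x - x"])
      (use step_bounds(2) DERIV_diff[OF ramp_has_real_derivative DERIV_ident] in \<open>metis diff_le_0_iff_le\<close>)
  then show ?thesis by (simp add: ramp_eq_0)
qed


subsection \<open>Integration by parts against test functions\<close>

lemma C_infinity_has_derivative:
  "C_infinity f \<Longrightarrow> (f has_derivative (\<lambda>b. partial_deriv b f x)) (at x)"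
  using smooth_on_differentiable[of UNIV f x]
  by (simp add: C_infinity_iff_smooth_on partial_deriv_def frechet_derivative_works)

lemma C_infinity_partial_deriv: "C_infinity f \<Longrightarrow> b \<in> Basis \<Longrightarrow> C_infinity (partial_deriv b f)"
  by (simp add: C_infinity_iff_smooth_on smooth_on_partial_deriv)

lemma C_infinity_partial_derivs: "C_infinity f \<Longrightarrow> bs \<in> lists Basis \<Longrightarrow> C_infinity (partial_derivs bs f)"
  by (induction bs) (auto intro: C_infinity_partial_deriv)

lemma C_infinity_continuous_on: "C_infinity f \<Longrightarrow> continuous_on S f"
  using smooth_on_continuous_on[of UNIV f] continuous_on_subset[of UNIV f S]
  by (auto simp: C_infinity_iff_smooth_on)

lemma C_infinity_mult: "C_infinity f \<Longrightarrow> C_infinity g \<Longrightarrow> C_infinity (\<lambda>x. f x * g x)"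
  by (simp add: C_infinity_iff_smooth_on smooth_on_mult)

lemma partial_deriv_mult:
  assumes "C_infinity f" "C_infinity g"
  shows "partial_deriv b (\<lambda>x. f x * g x) x = f x * partial_deriv b g x + partial_deriv b f x * g x"
  by (rule partial_deriv_eqI[OF has_derivative_mult[OF assms[THEN C_infinity_has_derivative]]])

lemma partial_deriv_zero_outside:
  assumes "closed K" "\<And>x. x \<notin> K \<Longrightarrow> f x = 0" "x \<notin> K"
  shows "partial_deriv b f x = 0"
proof -
  have "partial_deriv b f x = partial_deriv b (\<lambda>_. 0) x"
    by (rule partial_deriv_cong_open[of "- K"]) (use assms in auto)
  also have "\<dots> = 0" by (rule partial_deriv_eqI) auto
  finally show ?thesis .
qed

lemma test_functionsI:
  assumes "C_infinity \<phi>" "compact K" "K \<subseteq> \<Omega>" "\<And>x. x \<notin> K \<Longrightarrow> \<phi> x = 0"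
  shows "\<phi> \<in> test_functions \<Omega>"
proof -
  have "closure {x. \<phi> x \<noteq> 0} \<subseteq> K"
    by (rule closure_minimal) (use assms compact_imp_closed in auto)
  moreover from this have "compact (closure {x. \<phi> x \<noteq> 0})"
    by (metis assms(2) closed_closure compact_Int_closed inf.absorb2)
  ultimately show ?thesis using assms by (auto simp: test_functions_def)
qed

lemma test_functionsE:
  assumes "\<phi> \<in> test_functions \<Omega>"
  obtains K where "C_infinity \<phi>" "compact K" "K \<subseteq> \<Omega>" "\<And>x. x \<notin> K \<Longrightarrow> \<phi> x = 0"
proof (rule that[of "closure {x. \<phi> x \<noteq> 0}"])
  show "\<phi> x = 0" if "x \<notin> closure {x. \<phi> x \<noteq> 0}" for x
    using that closure_subset[of "{x. \<phi> x \<noteq> 0}"] by blast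
qed (use assms in \<open>auto simp: test_functions_def\<close>)

lemma test_functions_C_infinity: "\<phi> \<in> test_functions \<Omega> \<Longrightarrow> C_infinity \<phi>"
  by (simp add: test_functions_def)

lemma test_functions_partial_deriv:
  assumes "\<phi> \<in> test_functions \<Omega>" "b \<in> Basis" shows "partial_deriv b \<phi> \<in> test_functions \<Omega>"
proof -
  obtain K where K: "C_infinity \<phi>" "compact K" "K \<subseteq> \<Omega>" "\<And>x. x \<notin> K \<Longrightarrow> \<phi> x = 0"
    using test_functionsE[OF assms(1)] by blast
  show ?thesis
  proof (rule test_functionsI[OF C_infinity_partial_deriv[OF K(1) assms(2)] K(2,3)])
    show "partial_deriv b \<phi> x = 0" if "x \<notin> K" for x
      by (rule partial_deriv_zero_outside[OF compact_imp_closed[OF K(2)] K(4) that])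
  qed
qed

lemma test_functions_partial_derivs:
  "\<phi> \<in> test_functions \<Omega> \<Longrightarrow> bs \<in> lists Basis \<Longrightarrow> partial_derivs bs \<phi> \<in> test_functions \<Omega>"
  by (induction bs) (auto intro: test_functions_partial_deriv)

lemma test_functions_mult_C_infinity:
  assumes "C_infinity f" "\<phi> \<in> test_functions \<Omega>"
  shows "(\<lambda>x. f x * \<phi> x) \<in> test_functions \<Omega>"
proof -
  obtain K where K: "C_infinity \<phi>" "compact K" "K \<subseteq> \<Omega>" "\<And>x. x \<notin> K \<Longrightarrow> \<phi> x = 0"
    using test_functionsE[OF assms(2)] by blast
  show ?thesis
    by (rule test_functionsI[OF C_infinity_mult[OF assms(1) K(1)] K(2,3)]) (use K(4) in auto)
qed

lemma continuous_compact_support_bounded: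
  fixes f :: "'a::topological_space \<Rightarrow> real"
  assumes "compact K" "continuous_on K f" "\<And>x. x \<notin> K \<Longrightarrow> f x = 0"
  obtains B where "B \<ge> 0" "\<And>x. \<bar>f x\<bar> \<le> B"
proof -
  have "bounded (f ` K)" using assms compact_continuous_image compact_imp_bounded by blast
  then obtain B where "\<And>x. x \<in> K \<Longrightarrow> \<bar>f x\<bar> \<le> B" by (auto simp: bounded_iff)
  then have "\<bar>f x\<bar> \<le> max B 0" for x using assms(3)[of x] by (cases "x \<in> K") (auto simp: le_max_iff_disj)
  then show ?thesis using that[of "max B 0"] by auto
qed

lemma test_functions_bounded:
  assumes "\<phi> \<in> test_functions \<Omega>" obtains B where "B \<ge> 0" "\<And>x. \<bar>\<phi> x\<bar> \<le> B"
proof -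
  obtain K where K: "C_infinity \<phi>" "compact K" "K \<subseteq> \<Omega>" "\<And>x. x \<notin> K \<Longrightarrow> \<phi> x = 0"
    using test_functionsE[OF assms] by blast
  show ?thesis
    using continuous_compact_support_bounded[OF K(2) C_infinity_continuous_on[OF K(1)] K(4)] that by blast
qed

lemma test_functions_integrable_lborel:
  assumes "\<phi> \<in> test_functions \<Omega>" shows "integrable lborel \<phi>"
proof -
  obtain K where K: "C_infinity \<phi>" "compact K" "K \<subseteq> \<Omega>" "\<And>x. x \<notin> K \<Longrightarrow> \<phi> x = 0"
    using test_functionsE[OF assms] by blast
  have "(\<lambda>x. indicator K x *\<^sub>R \<phi> x) = \<phi>" using K(4) by (intro ext) (auto simp: indicator_def)
  then show ?thesis
    using borel_integrable_compact[OF K(2) C_infinity_continuous_on[OF K(1)]] by simp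
qed

lemma integral_lborel_translate:
  fixes f :: "'a::euclidean_space \<Rightarrow> real"
  assumes "f \<in> borel_measurable borel"
  shows "(LINT x|lborel. f (c + x)) = (LINT x|lborel. f x)"
  using integral_distr[of "(+) c" lborel borel f] assms lborel_distr_plus[of c] by simp

text \<open>By translation invariance every difference quotient has integral zero. The mean value
  theorem bounds the quotients by the supremum of the derivative, and dominated convergence passes
  to the limit.\<close>

lemma integral_partial_deriv_test:
  assumes "\<phi> \<in> test_functions \<Omega>" "b \<in> Basis"
  shows "(LINT x|lborel. partial_deriv b \<phi> x) = 0"
proof -
  obtain K where K: "C_infinity \<phi>" "compact K" "K \<subseteq> \<Omega>" "\<And>x. x \<notin> K \<Longrightarrow> \<phi> x = 0"
    using test_functionsE[OF assms(1)] by blast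
  let ?G = "partial_deriv b \<phi>"
  define D where "D n x = (\<phi> ((1 / Suc n) *\<^sub>R b + x) - \<phi> x) * Suc n" for n :: nat and x
  have cont: "continuous_on UNIV \<phi>" "continuous_on UNIV ?G"
    using C_infinity_continuous_on[OF K(1)]
      C_infinity_continuous_on[OF C_infinity_partial_deriv[OF K(1) assms(2)]] by blast+
  then have meas: "\<phi> \<in> borel_measurable borel" "?G \<in> borel_measurable borel"
    by (auto intro: borel_measurable_continuous_onI)
  obtain B where B: "B \<ge> 0" "\<And>x. \<bar>?G x\<bar> \<le> B"
    using test_functions_bounded[OF test_functions_partial_deriv[OF assms]] by blast
  obtain R where R: "\<And>x. x \<in> K \<Longrightarrow> norm x \<le> R" using K(2) compact_imp_bounded bounded_iff by metis
  have line: "((\<lambda>t. \<phi> (x + t *\<^sub>R b)) has_real_derivative ?G (x + t *\<^sub>R b)) (at t within S)" for x t S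
  proof -
    have 1: "((\<lambda>t. x + t *\<^sub>R b) has_derivative (\<lambda>h. h *\<^sub>R b)) (at t within S)"
      by (auto intro!: derivative_eq_intros)
    have "linear (\<lambda>b. partial_deriv b \<phi> y)" for y
      using C_infinity_has_derivative[OF K(1)] has_derivative_linear by blast
    from has_derivative_compose[OF 1 C_infinity_has_derivative[OF K(1), of "x + t *\<^sub>R b"]] linear_scale[OF this]
    show ?thesis by (simp add: has_field_derivative_def mult.commute[of _ "?G _"])
  qed
  have "(\<lambda>n. LINT x|lborel. D n x) \<longlonglongrightarrow> (LINT x|lborel. ?G x)"
  proof (rule integral_dominated_convergence)
    \<comment> \<open>The shifts have length at most 1, so all difference quotients vanish outside
      the ball of radius \<open>R + 1\<close>.\<close>
    show "integrable lborel (\<lambda>x. indicator (cball 0 (R + 1)) x *\<^sub>R B)"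
      by (rule borel_integrable_compact) auto
    show "AE x in lborel. (\<lambda>n. D n x) \<longlonglongrightarrow> ?G x"
    proof (rule AE_I2)
      fix x
      have "((\<lambda>h. (\<phi> (x + h *\<^sub>R b) - \<phi> x) / h) \<longlongrightarrow> ?G x) (at 0)"
        using line[of x 0 UNIV] by (simp add: has_field_derivative_iff)
      moreover have "filterlim (\<lambda>n. 1 / real (Suc n)) (at 0) sequentially"
        unfolding filterlim_at using LIMSEQ_inverse_real_of_nat by (auto simp: inverse_eq_divide)
      ultimately have "(\<lambda>n. (\<phi> (x + (1 / Suc n) *\<^sub>R b) - \<phi> x) / (1 / Suc n)) \<longlonglongrightarrow> ?G x"
        by (rule filterlim_compose)
      then show "(\<lambda>n. D n x) \<longlonglongrightarrow> ?G x" by (simp add: D_def add.commute)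
    qed
    show "AE x in lborel. norm (D n x) \<le> indicator (cball 0 (R + 1)) x *\<^sub>R B" for n
    proof (rule AE_I2)
      fix x
      show "norm (D n x) \<le> indicator (cball 0 (R + 1)) x *\<^sub>R B"
      proof (cases "norm x \<le> R + 1")
        case True
        have "\<exists>z>0. z < 1 / real (Suc n) \<and> \<phi> (x + (1 / Suc n) *\<^sub>R b) - \<phi> (x + 0 *\<^sub>R b) = (1 / Suc n - 0) * ?G (x + z *\<^sub>R b)"
          by (rule MVT2) (auto intro: line)
        then obtain z where "\<phi> (x + (1 / Suc n) *\<^sub>R b) - \<phi> x = (1 / Suc n) * ?G (x + z *\<^sub>R b)" by auto
        then have "D n x = ?G (x + z *\<^sub>R b)" by (simp add: D_def add.commute)
        then show ?thesis using True B by simp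
      next
        case False
        have "norm x \<le> norm ((1 / Suc n) *\<^sub>R b + x) + norm ((1 / Suc n) *\<^sub>R b)"
          by (metis add_diff_cancel_left' norm_triangle_ineq4 add.commute)
        also have "norm ((1 / Suc n) *\<^sub>R b) \<le> 1" using assms(2) by simp
        finally have "norm ((1 / Suc n) *\<^sub>R b + x) > R" using False by simp
        then have "\<phi> ((1 / Suc n) *\<^sub>R b + x) = 0" "\<phi> x = 0" using R K(4) False by force+
        then show ?thesis using B(1) by (simp add: D_def)
      qed
    qed
  qed (use meas in \<open>auto simp: D_def\<close>)
  moreover have "(LINT x|lborel. D n x) = 0" for n
  proof -
    have i: "integrable lborel \<phi>" by (rule test_functions_integrable_lborel[OF assms(1)])
    have "integrable lborel (\<lambda>x. \<phi> (c + x))" for c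
      using integrable_distr_eq[of "(+) c" lborel borel \<phi>] meas(1) lborel_distr_plus[of c] i by simp
    then show ?thesis
      unfolding D_def using i integral_lborel_translate[OF meas(1)] by simp
  qed
  ultimately show ?thesis by (simp add: LIMSEQ_const_iff)
qed

lemma integral_by_parts_test:
  assumes "C_infinity f" "\<phi> \<in> test_functions \<Omega>" "b \<in> Basis"
  shows "(LINT x|lborel. f x * partial_deriv b \<phi> x) = - (LINT x|lborel. partial_deriv b f x * \<phi> x)"
proof -
  have "integrable lborel (\<lambda>x. f x * partial_deriv b \<phi> x)" "integrable lborel (\<lambda>x. partial_deriv b f x * \<phi> x)"
    by (rule test_functions_integrable_lborel[OF test_functions_mult_C_infinity
          [OF assms(1) test_functions_partial_deriv[OF assms(2,3)]]])
      (rule test_functions_integrable_lborel[OF test_functions_mult_C_infinity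
          [OF C_infinity_partial_deriv[OF assms(1,3)] assms(2)]])
  moreover have "(LINT x|lborel. partial_deriv b (\<lambda>x. f x * \<phi> x) x) = 0"
    by (rule integral_partial_deriv_test[OF test_functions_mult_C_infinity[OF assms(1,2)] assms(3)])
  ultimately show ?thesis
    using partial_deriv_mult[OF assms(1) test_functions_C_infinity[OF assms(2)]] by simp
qed

lemma test_functions_zero_outside: "\<phi> \<in> test_functions \<Omega> \<Longrightarrow> x \<notin> \<Omega> \<Longrightarrow> \<phi> x = 0"
  by (metis test_functionsE subsetD)

lemma integral_lebesgue_on_eq_lborel:
  fixes f :: "'a::euclidean_space \<Rightarrow> real"
  assumes "open \<Omega>" "f \<in> borel_measurable borel" "\<And>x. x \<notin> \<Omega> \<Longrightarrow> f x = 0"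
  shows "(LINT x|lebesgue_on \<Omega>. f x) = (LINT x|lborel. f x)"
proof -
  have "(LINT x|lebesgue_on \<Omega>. f x) = (LINT x|lebesgue. indicator \<Omega> x *\<^sub>R f x)"
    by (rule integral_restrict_space) (use assms in auto)
  also have "(\<lambda>x. indicator \<Omega> x *\<^sub>R f x) = f" using assms by (intro ext) (auto simp: indicator_def)
  also have "(LINT x|lebesgue. f x) = (LINT x|lborel. f x)"
    by (rule integral_completion) (use assms in auto)
  finally show ?thesis .
qed

lemma integral_lebesgue_on_test:
  assumes "open \<Omega>" "\<phi> \<in> test_functions \<Omega>"
  shows "(LINT x|lebesgue_on \<Omega>. \<phi> x) = (LINT x|lborel. \<phi> x)"
  by (rule integral_lebesgue_on_eq_lborel[OF assms(1) borel_measurable_continuous_onI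
        [OF C_infinity_continuous_on[OF test_functions_C_infinity[OF assms(2)]]]
        test_functions_zero_outside[OF assms(2)]])

lemma locally_integrable_continuous:
  assumes "continuous_on \<Omega> f" shows "locally_integrable \<Omega> f"
  unfolding locally_integrable_def
proof (intro allI impI)
  fix K assume K: "compact K \<and> K \<subseteq> \<Omega>"
  then have "integrable lborel (\<lambda>x. indicator K x *\<^sub>R f x)"
    using assms continuous_on_subset by (intro borel_integrable_compact) blast+
  then have "integrable lebesgue (\<lambda>x. indicator K x *\<^sub>R f x)"
    by (subst integrable_completion) (auto dest: borel_measurable_integrable)
  then show "integrable (lebesgue_on K) f"
    using K by (subst integrable_restrict_space) (auto simp: compact_imp_closed)
qed

text \<open>Each integration by parts strips the outermost derivative from the test function and
  makes it the innermost one on \<open>f\<close>; this is the reason for \<open>rev\<close>.\<close>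

lemma has_weak_deriv_C_infinity:
  assumes "open \<Omega>" "C_infinity f" "bs \<in> lists Basis"
  shows "has_weak_deriv \<Omega> bs f (partial_derivs (rev bs) f)"
  unfolding has_weak_deriv_def
proof (intro conjI ballI)
  have "bs \<in> lists Basis \<Longrightarrow> C_infinity f \<Longrightarrow> \<phi> \<in> test_functions \<Omega> \<Longrightarrow>
    (LINT x|lborel. f x * partial_derivs bs \<phi> x) =
      (- 1) ^ length bs * (LINT x|lborel. partial_derivs (rev bs) f x * \<phi> x)" for f \<phi>
  proof (induction bs arbitrary: f)
    case (Cons b bs)
    then have "(LINT x|lborel. f x * partial_derivs (b # bs) \<phi> x)
        = - (LINT x|lborel. partial_deriv b f x * partial_derivs bs \<phi> x)"
      using integral_by_parts_test[OF Cons.prems(2) test_functions_partial_derivs[OF Cons.prems(3)], of bs b] by simp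
    also have "(LINT x|lborel. partial_deriv b f x * partial_derivs bs \<phi> x)
        = (- 1) ^ length bs * (LINT x|lborel. partial_derivs (rev bs) (partial_deriv b f) x * \<phi> x)"
      using Cons C_infinity_partial_deriv by (intro Cons.IH) auto
    finally show ?case by (simp add: partial_derivs_snoc)
  qed simp
  moreover fix \<phi> assume t: "\<phi> \<in> test_functions \<Omega>"
  moreover have "rev bs \<in> lists Basis" using assms(3) by auto
  then have "(LINT x|lebesgue_on \<Omega>. f x * partial_derivs bs \<phi> x) = (LINT x|lborel. f x * partial_derivs bs \<phi> x)"
    "(LINT x|lebesgue_on \<Omega>. partial_derivs (rev bs) f x * \<phi> x) = (LINT x|lborel. partial_derivs (rev bs) f x * \<phi> x)"
    by (intro integral_lebesgue_on_test[OF assms(1)] test_functions_mult_C_infinity test_functions_partial_derivs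
        C_infinity_partial_derivs assms t; assumption)+
  ultimately show "(LINT x|lebesgue_on \<Omega>. f x * partial_derivs bs \<phi> x) =
      (- 1) ^ length bs * (LINT x|lebesgue_on \<Omega>. partial_derivs (rev bs) f x * \<phi> x)"
    using assms by auto
qed (use assms in \<open>auto intro!: locally_integrable_continuous C_infinity_continuous_on C_infinity_partial_derivs\<close>)

lemma integrable_locally_integrable_times_test:
  assumes "open \<Omega>" "locally_integrable \<Omega> g" "\<phi> \<in> test_functions \<Omega>"
  shows "integrable (lebesgue_on \<Omega>) (\<lambda>x. g x * \<phi> x)"
proof -
  obtain K where K: "C_infinity \<phi>" "compact K" "K \<subseteq> \<Omega>" "\<And>x. x \<notin> K \<Longrightarrow> \<phi> x = 0"
    using test_functionsE[OF assms(3)] by blast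
  obtain B where B: "B \<ge> 0" "\<And>x. \<bar>\<phi> x\<bar> \<le> B" using test_functions_bounded[OF assms(3)] by blast
  have Ks: "K \<in> sets lebesgue" using K(2) by (simp add: compact_imp_closed)
  have g: "integrable (lebesgue_on K) g" using assms(2) K by (auto simp: locally_integrable_def)
  moreover have "\<phi> \<in> borel_measurable (lebesgue_on K)"
    using continuous_imp_measurable_on_sets_lebesgue[OF C_infinity_continuous_on[OF K(1)] Ks] .
  ultimately have "(\<lambda>x. g x * \<phi> x) \<in> borel_measurable (lebesgue_on K)"
    by (intro borel_measurable_times) auto
  moreover have "AE x in lebesgue_on K. norm (g x * \<phi> x) \<le> norm (B * g x)"
    using B by (intro AE_I2) (simp add: abs_mult mult.commute mult_right_mono)
  moreover have "integrable (lebesgue_on K) (\<lambda>x. B * g x)" using g by simp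
  ultimately have "integrable (lebesgue_on K) (\<lambda>x. g x * \<phi> x)"
    by (rule Bochner_Integration.integrable_bound[rotated])
  then have "integrable lebesgue (\<lambda>x. indicator K x *\<^sub>R (g x * \<phi> x))"
    using Ks by (subst (asm) integrable_restrict_space) auto
  also have "(\<lambda>x. indicator K x *\<^sub>R (g x * \<phi> x)) = (\<lambda>x. indicator \<Omega> x *\<^sub>R (g x * \<phi> x))"
    using K(3,4) by (intro ext) (auto simp: indicator_def)
  finally show ?thesis using assms(1) by (subst integrable_restrict_space) auto
qed

lemma has_weak_deriv_add:
  assumes "open \<Omega>" "bs \<in> lists Basis" "has_weak_deriv \<Omega> bs f f'" "has_weak_deriv \<Omega> bs g g'"
  shows "has_weak_deriv \<Omega> bs (\<lambda>x. f x + g x) (\<lambda>x. f' x + g' x)"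
proof -
  have li: "locally_integrable \<Omega> f" "locally_integrable \<Omega> g" "locally_integrable \<Omega> f'" "locally_integrable \<Omega> g'"
    using assms unfolding has_weak_deriv_def by auto
  have "(LINT x|lebesgue_on \<Omega>. (f x + g x) * partial_derivs bs \<phi> x) =
        (- 1) ^ length bs * (LINT x|lebesgue_on \<Omega>. (f' x + g' x) * \<phi> x)" if "\<phi> \<in> test_functions \<Omega>" for \<phi>
    using assms that li
    by (simp add: distrib_right has_weak_deriv_def integrable_locally_integrable_times_test
        test_functions_partial_derivs distrib_left)
  then show ?thesis using li unfolding has_weak_deriv_def locally_integrable_def by auto
qed


subsection \<open>The fundamental lemma of the calculus of variations\<close>

definition tensor :: "(real \<Rightarrow> real) \<Rightarrow> (real \<Rightarrow> real) \<Rightarrow> real \<times> real \<Rightarrow> real" where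
  "tensor a b z = a (fst z) * b (snd z)"

lemma C_infinity_tensor:
  assumes "smooth_on UNIV a" "smooth_on UNIV b" shows "C_infinity (tensor a b)"
  unfolding C_infinity_iff_smooth_on tensor_def[abs_def]
  by (intro smooth_on_mult smooth_on_compose[OF _ assms(1)] smooth_on_compose[OF _ assms(2)]
      smooth_on_bounded_linear bounded_linear_fst bounded_linear_snd) auto

lemma tensor_has_derivative:
  assumes "(a has_real_derivative a') (at (fst z))" "(b has_real_derivative b') (at (snd z))"
  shows "(tensor a b has_derivative (\<lambda>h. a' * fst h * b (snd z) + a (fst z) * b' * snd h)) (at z)"
proof -
  have "((\<lambda>z. a (fst z)) has_derivative (\<lambda>h. a' * fst h)) (at z)"
    "((\<lambda>z. b (snd z)) has_derivative (\<lambda>h. b' * snd h)) (at z)"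
    using assms by (auto intro!: has_derivative_compose[of fst fst z UNIV a "(*) a'"]
        has_derivative_compose[of snd snd z UNIV b "(*) b'"] derivative_intros simp: has_field_derivative_def)
  from has_derivative_mult[OF this] show ?thesis
    unfolding tensor_def[abs_def] by (simp add: algebra_simps)
qed

lemma partial_deriv_tensor:
  assumes "\<And>x. (a has_real_derivative a' x) (at x)" "\<And>x. (b has_real_derivative b' x) (at x)"
  shows "partial_deriv (1, 0) (tensor a b) = tensor a' b" "partial_deriv (0, 1) (tensor a b) = tensor a b'"
  using partial_deriv_eqI[OF tensor_has_derivative[OF assms(1) assms(2)]] by (auto simp: tensor_def)

lemma test_functions_tensor:
  assumes "smooth_on UNIV a" "smooth_on UNIV b" "\<And>x. x \<notin> {a1..a2} \<Longrightarrow> a x = 0" "\<And>y. y \<notin> {b1..b2} \<Longrightarrow> b y = 0"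
    and "{a1..a2} \<times> {b1..b2} \<subseteq> \<Omega>"
  shows "tensor a b \<in> test_functions \<Omega>"
proof (rule test_functionsI[OF C_infinity_tensor[OF assms(1,2)] _ assms(5)])
  show "compact ({a1..a2} \<times> {b1..b2})" by (intro compact_Times compact_Icc)
  show "tensor a b z = 0" if "z \<notin> {a1..a2} \<times> {b1..b2}" for z
    using that assms(3,4) by (cases z) (auto simp: tensor_def)
qed

text \<open>A smooth indicator of the interval. The offsets -1 and +1 push both transition layers,
  of width \<open>2 * e\<close> each, inside it, so that the function vanishes at and beyond the
  endpoints.\<close>

definition window :: "real \<Rightarrow> real \<Rightarrow> real \<Rightarrow> real \<Rightarrow> real" where
  "window e x1 x2 x = step ((x - x1) / e - 1) - step ((x - x2) / e + 1)"

lemma smooth_on_window: "smooth_on UNIV (window e x1 x2)"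
  using smooth_on_diff[OF _ smooth_on_affine_compose[OF smooth_on_step, of "1/e" "- x1 / e - 1"]
      smooth_on_affine_compose[OF smooth_on_step, of "1/e" "- x2 / e + 1"]]
  by (simp add: window_def[abs_def] diff_divide_distrib algebra_simps)

lemma window_has_real_derivative:
  "e > 0 \<Longrightarrow> (window e x1 x2 has_real_derivative
     (bump ((x - x1) / e - 1) / e - bump ((x - x2) / e + 1) / e)) (at x)"
  unfolding window_def[abs_def]
  by (auto intro!: derivative_eq_intros DERIV_chain2[OF step_has_real_derivative])

lemma window_abs_le: "\<bar>window e x1 x2 x\<bar> \<le> 1"
  using step_bounds[of "(x - x1) / e - 1"] step_bounds[of "(x - x2) / e + 1"] by (simp add: window_def)

lemma window_eq_0:
  assumes "e > 0" "2 * e \<le> x2 - x1" "x \<le> x1 \<or> x2 \<le> x"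
  shows "window e x1 x2 x = 0"
proof (cases "x \<le> x1")
  case True
  then have "(x - x1) / e \<le> 0" "(x - x2) / e \<le> -2" using assms by (auto simp: divide_simps)
  then show ?thesis by (simp add: window_def step_eq_0)
next
  case False
  then have "(x - x1) / e \<ge> 2" "(x - x2) / e \<ge> 0" using assms by (auto simp: divide_simps)
  then show ?thesis by (simp add: window_def step_eq_1)
qed

lemma window_eq_1: "e > 0 \<Longrightarrow> x1 + 2 * e \<le> x \<Longrightarrow> x \<le> x2 - 2 * e \<Longrightarrow> window e x1 x2 x = 1"
  by (simp add: window_def step_eq_0 step_eq_1 field_simps)

lemma window_width:
  assumes "(x1::real) < x2"
  shows "0 < (x2 - x1) / (2 * Suc n)" "2 * ((x2 - x1) / (2 * Suc n)) \<le> x2 - x1"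
proof -
  have "(x2 - x1) / Suc n \<le> (x2 - x1) / 1" using assms by (intro divide_left_mono) auto
  moreover have "2 * ((x2 - x1) / (2 * Suc n)) = (x2 - x1) / Suc n" by (simp add: field_simps)
  ultimately show "2 * ((x2 - x1) / (2 * Suc n)) \<le> x2 - x1" by simp
qed (use assms in simp)

lemma window_tendsto_indicator:
  assumes "x1 < x2"
  shows "(\<lambda>n. window ((x2 - x1) / (2 * Suc n)) x1 x2 x) \<longlonglongrightarrow> indicator {x1<..<x2} x"
proof (cases "x \<in> {x1<..<x2}")
  case False
  have "window ((x2 - x1) / (2 * Suc n)) x1 x2 x = 0" for n
    using assms False by (intro window_eq_0 window_width) auto
  then show ?thesis using False by simp
next
  case True
  have "(\<lambda>n. (x2 - x1) * inverse (real (Suc n))) \<longlonglongrightarrow> (x2 - x1) * 0"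
    by (intro tendsto_mult tendsto_const LIMSEQ_inverse_real_of_nat)
  then have "\<forall>\<^sub>F n in sequentially. (x2 - x1) * inverse (real (Suc n)) < min (x - x1) (x2 - x)"
    by (rule order_tendstoD) (use True in auto)
  then have "\<forall>\<^sub>F n in sequentially. window ((x2 - x1) / (2 * Suc n)) x1 x2 x = 1"
  proof eventually_elim
    case (elim n)
    have "2 * ((x2 - x1) / (2 * Suc n)) = (x2 - x1) * inverse (real (Suc n))" by (simp add: field_simps)
    with elim assms show ?case by (intro window_eq_1) auto
  qed
  then show ?thesis using True by (simp add: tendsto_eventually)
qed

text \<open>Products of windows are test functions bounded by 1 that converge to the indicator of
  the open box, so \<open>h\<close> on the closed box dominates.\<close>

lemma integral_box_eq_0_of_weakly_zero:
  fixes \<Omega> :: "(real \<times> real) set"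
  assumes "open \<Omega>" "locally_integrable \<Omega> h"
    and zero: "\<And>\<phi>. \<phi> \<in> test_functions \<Omega> \<Longrightarrow> (LINT z|lebesgue_on \<Omega>. h z * \<phi> z) = 0"
    and sub: "{x1..x2} \<times> {y1..y2} \<subseteq> \<Omega>"
  shows "(LINT z|lebesgue. indicator ({x1<..<x2} \<times> {y1<..<y2}) z * h z) = 0"
proof (cases "x1 < x2 \<and> y1 < y2")
  case False
  then have "{x1<..<x2} \<times> {y1<..<y2} = {}" by auto
  then show ?thesis by (simp only: indicator_simps empty_iff not_False_eq_True mult_zero_left integral_zero)
next
  case True
  let ?Q = "{x1..x2} \<times> {y1..y2}"
  define w where "w n = tensor (window ((x2 - x1) / (2 * Suc n)) x1 x2) (window ((y2 - y1) / (2 * Suc n)) y1 y2)"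
    for n :: nat
  have "compact ?Q" by (intro compact_Times compact_Icc)
  then have Qs: "?Q \<in> sets lebesgue" by (simp add: compact_imp_closed)
  have "integrable (lebesgue_on ?Q) h"
    using assms(2) sub \<open>compact ?Q\<close> unfolding locally_integrable_def by blast
  then have hi: "integrable lebesgue (\<lambda>z. indicator ?Q z *\<^sub>R h z)"
    using Qs by (subst (asm) integrable_restrict_space) auto
  have w0: "w n z = 0" if "z \<notin> ?Q" for n z
  proof -
    have "fst z \<le> x1 \<or> x2 \<le> fst z \<or> snd z \<le> y1 \<or> y2 \<le> snd z" using that by (cases z) auto
    then have "window ((x2 - x1) / (2 * Suc n)) x1 x2 (fst z) = 0 \<or> window ((y2 - y1) / (2 * Suc n)) y1 y2 (snd z) = 0"
      using True window_width window_eq_0 by metis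
    then show ?thesis unfolding w_def tensor_def by auto
  qed
  have wt: "w n \<in> test_functions \<Omega>" for n
    unfolding w_def using True
    by (intro test_functions_tensor[OF _ _ _ _ sub] smooth_on_window window_eq_0 window_width) auto
  have wm: "w n \<in> borel_measurable lebesgue" for n
    using continuous_imp_measurable_on_sets_lebesgue[OF C_infinity_continuous_on[OF test_functions_C_infinity[OF wt]], of UNIV n]
    by (simp add: lebesgue_on_UNIV_eq)
  have "(\<lambda>n. LINT z|lebesgue. (indicator ?Q z *\<^sub>R h z) * w n z)
      \<longlonglongrightarrow> (LINT z|lebesgue. indicator ({x1<..<x2} \<times> {y1<..<y2}) z * h z)"
  proof (rule integral_dominated_convergence)
    show "integrable lebesgue (\<lambda>z. norm (indicator ?Q z *\<^sub>R h z))" using hi by (rule integrable_norm)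
    have lim: "(\<lambda>n. w n z) \<longlonglongrightarrow> indicator {x1<..<x2} (fst z) * indicator {y1<..<y2} (snd z)" for z
      unfolding w_def tensor_def using True by (intro tendsto_mult window_tendsto_indicator) auto
    have "(\<lambda>n. (indicator ?Q z *\<^sub>R h z) * w n z) \<longlonglongrightarrow> indicator ({x1<..<x2} \<times> {y1<..<y2}) z * h z" for z
      using tendsto_mult[OF tendsto_const[of "indicator ?Q z *\<^sub>R h z"] lim[of z]]
      by (cases z) (auto simp: indicator_def split: if_splits)
    then show "AE z in lebesgue. (\<lambda>n. (indicator ?Q z *\<^sub>R h z) * w n z) \<longlonglongrightarrow> indicator ({x1<..<x2} \<times> {y1<..<y2}) z * h z"
      by blast
    have "\<bar>w n z\<bar> \<le> 1" for n z
      unfolding w_def tensor_def abs_mult using mult_mono[OF window_abs_le window_abs_le] by fastforce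
    then have "norm ((indicator ?Q z *\<^sub>R h z) * w n z) \<le> norm (indicator ?Q z *\<^sub>R h z)" for n z
      by (simp add: abs_mult mult_left_le)
    then show "AE z in lebesgue. norm ((indicator ?Q z *\<^sub>R h z) * w n z) \<le> norm (indicator ?Q z *\<^sub>R h z)" for n
      by blast
    show "(\<lambda>z. (indicator ?Q z *\<^sub>R h z) * w n z) \<in> borel_measurable lebesgue" for n
      using borel_measurable_integrable[OF hi] wm by (rule borel_measurable_times)
    have "(\<lambda>z. indicator ({x1<..<x2} \<times> {y1<..<y2}) z *\<^sub>R (indicator ?Q z *\<^sub>R h z)) \<in> borel_measurable lebesgue"
      by (intro borel_measurable_scaleR[OF _ borel_measurable_integrable[OF hi]] borel_measurable_indicator
          lmeasurable_open[THEN fmeasurableD] bounded_Times open_Times bounded_Ioo) auto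
    also have "(\<lambda>z. indicator ({x1<..<x2} \<times> {y1<..<y2}) z *\<^sub>R (indicator ?Q z *\<^sub>R h z))
      = (\<lambda>z. indicator ({x1<..<x2} \<times> {y1<..<y2}) z * h z)"
      by (intro ext) (auto simp: indicator_def)
    finally show "(\<lambda>z. indicator ({x1<..<x2} \<times> {y1<..<y2}) z * h z) \<in> borel_measurable lebesgue" .
  qed
  moreover have "(LINT z|lebesgue. (indicator ?Q z *\<^sub>R h z) * w n z) = 0" for n
  proof -
    have "(LINT z|lebesgue. (indicator ?Q z *\<^sub>R h z) * w n z) = (LINT z|lebesgue. indicator \<Omega> z *\<^sub>R (h z * w n z))"
      using w0 sub by (intro arg_cong[where f = "integral\<^sup>L lebesgue"] ext) (auto simp: indicator_def)
    also have "\<dots> = (LINT z|lebesgue_on \<Omega>. h z * w n z)"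
      using \<open>open \<Omega>\<close> by (subst integral_restrict_space) auto
    finally show ?thesis using zero[OF wt] by simp
  qed
  ultimately show ?thesis by (simp add: LIMSEQ_const_iff)
qed

lemma Pair_box_eq: "box a b = {fst a<..<fst b} \<times> {snd a<..<snd b}" for a b :: "real \<times> real"
  by (cases a; cases b) (auto simp: mem_box Basis_prod_def)

lemma Pair_cbox_eq: "cbox a b = {fst a..fst b} \<times> {snd a..snd b}" for a b :: "real \<times> real"
  by (cases a; cases b) (auto simp: mem_box Basis_prod_def)

text \<open>Boxes form an intersection-stable generator of the Borel sets, so vanishing of the
  integral spreads from boxes to Borel sets and forces the function to be zero almost everywhere.
  This is done on one closed box inside the domain at a time; countably many of them cover the
  domain.\<close>

lemma fundamental_lemma_calculus_of_variations:
  fixes \<Omega> :: "(real \<times> real) set"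
  assumes "open \<Omega>" "locally_integrable \<Omega> h"
    and zero: "\<And>\<phi>. \<phi> \<in> test_functions \<Omega> \<Longrightarrow> (LINT z|lebesgue_on \<Omega>. h z * \<phi> z) = 0"
  shows "AE z in lebesgue_on \<Omega>. h z = 0"
proof -
  have cbox_zero: "AE z in lebesgue. z \<in> cbox a b \<longrightarrow> h z = 0" if sub: "cbox a b \<subseteq> \<Omega>" for a b
  proof -
    have "integrable (lebesgue_on (cbox a b)) h"
      using assms(2) sub compact_cbox unfolding locally_integrable_def by blast
    then have hi: "integrable lebesgue (\<lambda>z. indicator (cbox a b) z *\<^sub>R h z)"
      by (subst (asm) integrable_restrict_space) auto
    \<comment> \<open>\<open>h\<close> is only Lebesgue measurable, whereas the induction runs over
      Borel sets; hence a Borel representative, zero almost everywhere off the box.\<close>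
    then obtain H where H: "H \<in> borel_measurable lborel" "AE z in lborel. indicator (cbox a b) z *\<^sub>R h z = H z"
      using completion_ex_borel_measurable_real[OF borel_measurable_integrable[OF hi]] by auto
    have AE: "AE z in lebesgue. indicator (cbox a b) z *\<^sub>R h z = H z"
      using H(2) by (rule AE_completion)
    have "H \<in> borel_measurable lebesgue" using H(1) by (rule measurable_completion)
    then have "integrable lebesgue H"
      by (rule integrable_cong_AE_imp[OF hi _ AE])
    then have Hi: "integrable lborel H" using H(1) by (subst (asm) integrable_completion) auto
    have box_integral: "(LINT z:box c d|lborel. H z) = 0" for c d
    proof -
      \<comment> \<open>An arbitrary box may leave the domain; its intersection with
        \<open>box a b\<close> is again a box, and one inside it.\<close>
      obtain c' d' where cd: "box c d \<inter> box a b = box c' d'" using box_Int_box by blast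
      have sub': "box c' d' \<subseteq> cbox a b" using cd box_subset_cbox by blast
      have "(LINT z:box c d|lborel. H z) = (LINT z|lebesgue. indicator (box c d) z *\<^sub>R H z)"
        unfolding set_lebesgue_integral_def using H(1) by (intro integral_completion[symmetric]) auto
      also have "\<dots> = (LINT z|lebesgue. indicator (box c' d') z * h z)"
      proof (rule integral_cong_AE)
        have "cbox a b - box a b \<in> null_sets lebesgue"
          using negligible_frontier_interval negligible_iff_null_sets by blast
        from AE_not_in[OF this] AE
        show "AE z in lebesgue. indicator (box c d) z *\<^sub>R H z = indicator (box c' d') z * h z"
        proof eventually_elim
          case (elim z)
          have "z \<in> box c' d' \<longleftrightarrow> z \<in> box c d \<and> z \<in> box a b" using cd by blast
          then show ?case using elim sub' by (cases "z \<in> cbox a b") (auto simp: indicator_def)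
        qed
        show "(\<lambda>z. indicator (box c d) z *\<^sub>R H z) \<in> borel_measurable lebesgue"
          using \<open>H \<in> borel_measurable lebesgue\<close> by (intro borel_measurable_scaleR borel_measurable_indicator) auto
        have "(\<lambda>z. indicator (box c' d') z *\<^sub>R (indicator (cbox a b) z *\<^sub>R h z)) \<in> borel_measurable lebesgue"
          by (intro borel_measurable_scaleR[OF borel_measurable_indicator borel_measurable_integrable[OF hi]]) auto
        also have "(\<lambda>z. indicator (box c' d') z *\<^sub>R (indicator (cbox a b) z *\<^sub>R h z)) = (\<lambda>z. indicator (box c' d') z * h z)"
          using sub' by (intro ext) (auto simp: indicator_def)
        finally show "(\<lambda>z. indicator (box c' d') z * h z) \<in> borel_measurable lebesgue" .
      qed
      also have "\<dots> = 0"
      proof (cases "box c' d' = {}")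
        case True
        then show ?thesis by (simp only: indicator_simps empty_iff not_False_eq_True mult_zero_left integral_zero)
      next
        case False
        then have "closure (box c' d') = cbox c' d'" by (rule closure_box)
        then have "cbox c' d' \<subseteq> \<Omega>" using sub closure_minimal[OF sub' closed_cbox] by simp
        then show ?thesis
          unfolding Pair_box_eq Pair_cbox_eq by (intro integral_box_eq_0_of_weakly_zero[OF assms]) auto
      qed
      finally show ?thesis .
    qed
    have Hs: "set_integrable lborel A H" if "A \<in> sets borel" for A
      unfolding set_integrable_def using that Hi by (intro integrable_mult_indicator) auto
    have borel_integral: "(LINT z:A|lborel. H z) = 0" if "A \<in> sets borel" for A
    proof -
      let ?G = "range (\<lambda>(a, b). box a b :: (real \<times> real) set)"
      have gen: "sets borel = sigma_sets UNIV ?G" unfolding borel_eq_box by (rule sets_measure_of) auto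
      have "Int_stable ?G"
        unfolding Int_stable_def
      proof clarify
        fix a b c d :: "real \<times> real"
        show "box a b \<inter> box c d \<in> ?G" unfolding box_Int_box by (rule rev_image_eqI[of "(_, _)"]) auto
      qed
      moreover have "?G \<subseteq> Pow UNIV" by simp
      moreover have "A \<in> sigma_sets UNIV ?G" using that gen by simp
      ultimately show ?thesis
      proof (induction rule: sigma_sets_induct_disjoint)
        case (basic A) then show ?case using box_integral by auto
      next
        case empty show ?case by (simp add: set_lebesgue_integral_def)
      next
        case (compl A)
        have A: "A \<in> sets borel" using compl(1) by (simp only: gen)
        then have A': "- A \<in> sets borel" by simp
        \<comment> \<open>Complements require the integral over the whole plane. It reduces to
          \<open>box a b\<close>, as \<open>H\<close> vanishes almost everywhere off the closed box
          and the boundary of the box is a null set.\<close>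
        have "(LINT z:UNIV|lborel. H z) = (LINT z:cbox a b|lborel. H z)"
          unfolding set_lebesgue_integral_def
        proof (rule integral_cong_AE)
          show "AE z in lborel. indicator UNIV z *\<^sub>R H z = indicator (cbox a b) z *\<^sub>R H z"
            using H(2) by eventually_elim (auto simp: indicator_def split: if_splits)
        qed (use H(1) in measurable)
        also have "\<dots> = (LINT z:box a b|lborel. H z)"
          unfolding set_lebesgue_integral_def
        proof (rule integral_cong_AE)
          have "cbox a b - box a b \<in> null_sets lebesgue"
            using negligible_frontier_interval negligible_iff_null_sets by blast
          then have "cbox a b - box a b \<in> null_sets lborel"
            by (subst (asm) null_sets_completion_iff) auto
          from AE_not_in[OF this]
          show "AE z in lborel. indicator (cbox a b) z *\<^sub>R H z = indicator (box a b) z *\<^sub>R H z"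
            by eventually_elim (use box_subset_cbox[of a b] in \<open>auto simp: indicator_def split: if_splits\<close>)
        qed (use H(1) in measurable)
        also have "\<dots> = 0" by (rule box_integral)
        finally have "(LINT z:UNIV|lborel. H z) = 0" .
        moreover have "(LINT z:(A \<union> - A)|lborel. H z) = (LINT z:A|lborel. H z) + (LINT z:- A|lborel. H z)"
          using A A' by (intro set_integral_Un Hs) auto
        ultimately show ?case using compl(2) by (simp add: Compl_eq_Diff_UNIV)
      next
        case (union A)
        have A: "A i \<in> sets borel" for i using union(2) by (auto simp only: gen)
        have "(LINT z:(\<Union>i. A i)|lborel. H z) = (\<Sum>i. LINT z:A i|lborel. H z)"
          using union(1) A by (intro lebesgue_integral_countable_add Hs sets.countable_UN) (auto simp: disjoint_family_on_def)
        then show ?case using union(3) by simp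
      qed
    qed
    then have "AE z in lborel. H z = 0" by (intro sigma_finite_measure.density_zero[OF sigma_finite_lborel Hi]) auto
    from AE_completion[OF this] AE show ?thesis
      by eventually_elim (auto simp: indicator_def split: if_splits)
  qed
  obtain D where D: "countable D" "\<And>X. X \<in> D \<Longrightarrow> \<exists>a b. X = cbox a b" "\<Union>D = \<Omega>" "\<And>X. X \<in> D \<Longrightarrow> X \<subseteq> \<Omega>"
    by (rule open_countable_Union_open_cbox[OF assms(1)]) blast
  have "AE z in lebesgue. z \<in> X \<longrightarrow> h z = 0" if X: "X \<in> D" for X
  proof -
    obtain a b where "X = cbox a b" using D(2)[OF X] by blast
    then show ?thesis using cbox_zero D(4)[OF X] by simp
  qed
  then have "AE z in lebesgue. \<forall>X\<in>D. z \<in> X \<longrightarrow> h z = 0"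
    unfolding AE_ball_countable[OF D(1)] by blast
  then have "AE z in lebesgue. z \<in> \<Omega> \<longrightarrow> h z = 0"
    by eventually_elim (use D(3) in blast)
  then show ?thesis using assms(1) by (subst AE_restrict_space_iff) auto
qed


subsection \<open>Positivity of the strong solution\<close>

text \<open>By completeness of Lebesgue measure each preimage is negligible or has negligible
  complement. This supplies measurability of a \<open>weak_laplacian\<close> known to vanish almost
  everywhere, although its summands are arbitrarily chosen representatives.\<close>

lemma borel_measurable_AE_zero:
  fixes f :: "'a::euclidean_space \<Rightarrow> real"
  assumes "\<Omega> \<in> sets lebesgue" "AE x in lebesgue_on \<Omega>. f x = 0"
  shows "f \<in> borel_measurable (lebesgue_on \<Omega>)"
proof (rule measurableI)
  fix A :: "real set" assume "A \<in> sets borel"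
  define N where "N = {x\<in>\<Omega>. f x \<noteq> 0}"
  have "AE x in lebesgue. \<not> (x \<in> \<Omega> \<and> f x \<noteq> 0)"
    using assms by (subst (asm) AE_restrict_space_iff) (auto elim: eventually_mono)
  then obtain M where "M \<in> null_sets lebesgue" "N \<subseteq> M"
    unfolding eventually_ae_filter N_def by auto
  then have "negligible N" using negligible_iff_null_sets negligible_subset by blast
  then have sub: "B \<inter> N \<in> sets lebesgue" for B
    by (meson Int_lower2 negligible_imp_sets negligible_subset)
  have "f -` A \<inter> \<Omega> = (if 0 \<in> A then \<Omega> - (f -` (- A) \<inter> N) else f -` A \<inter> N)"
    by (auto simp: N_def)
  then have "f -` A \<inter> \<Omega> \<in> sets lebesgue"
    using sub assms(1) by (auto intro: sets.Diff)
  then show "f -` A \<inter> space (lebesgue_on \<Omega>) \<in> sets (lebesgue_on \<Omega>)"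
    using assms(1) by (simp add: sets_restrict_space_iff)
qed simp

lemma weak_deriv_unique:
  fixes \<Omega> :: "(real \<times> real) set"
  assumes "open \<Omega>" "has_weak_deriv \<Omega> bs f g" "has_weak_deriv \<Omega> bs f g'"
  shows "AE z in lebesgue_on \<Omega>. g z = g' z"
proof -
  have li: "locally_integrable \<Omega> g" "locally_integrable \<Omega> g'" using assms unfolding has_weak_deriv_def by auto
  have "(LINT z|lebesgue_on \<Omega>. (g z - g' z) * \<phi> z) = 0" if t: "\<phi> \<in> test_functions \<Omega>" for \<phi>
  proof -
    have "(LINT z|lebesgue_on \<Omega>. f z * partial_derivs bs \<phi> z) = (- 1) ^ length bs * (LINT z|lebesgue_on \<Omega>. g z * \<phi> z)"
      using assms(2) t unfolding has_weak_deriv_def by blast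
    moreover have "(LINT z|lebesgue_on \<Omega>. f z * partial_derivs bs \<phi> z) = (- 1) ^ length bs * (LINT z|lebesgue_on \<Omega>. g' z * \<phi> z)"
      using assms(3) t unfolding has_weak_deriv_def by blast
    ultimately have "(LINT z|lebesgue_on \<Omega>. g z * \<phi> z) = (LINT z|lebesgue_on \<Omega>. g' z * \<phi> z)" by simp
    then show ?thesis
      using li t assms(1) by (simp add: left_diff_distrib integrable_locally_integrable_times_test)
  qed
  moreover have "locally_integrable \<Omega> (\<lambda>z. g z - g' z)" using li unfolding locally_integrable_def by auto
  ultimately have "AE z in lebesgue_on \<Omega>. g z - g' z = 0"
    by (intro fundamental_lemma_calculus_of_variations[OF assms(1)])
  then show ?thesis by simp
qed

section \<open>Adding smooth functions to locally Sobolev functions\<close>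

lemma L2_continuous:
  assumes "compact K" "continuous_on K f" shows "f \<in> L2 K"
proof -
  have Ks: "K \<in> sets lebesgue" using assms by (simp add: compact_imp_closed)
  have "locally_integrable K (\<lambda>x. (f x)\<^sup>2)"
    using assms by (intro locally_integrable_continuous continuous_intros)
  then have "integrable (lebesgue_on K) (\<lambda>x. (f x)\<^sup>2)" using assms unfolding locally_integrable_def by blast
  then show ?thesis using continuous_imp_measurable_on_sets_lebesgue[OF assms(2) Ks] by (simp add: L2_def)
qed

lemma L2_add:
  assumes "f \<in> L2 S" "g \<in> L2 S" shows "(\<lambda>x. f x + g x) \<in> L2 S"
proof -
  have m: "(\<lambda>x. f x + g x) \<in> borel_measurable (lebesgue_on S)"
    using assms by (auto simp: L2_def)
  have "integrable (lebesgue_on S) (\<lambda>x. 2 * (f x)\<^sup>2 + 2 * (g x)\<^sup>2)"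
    using assms by (auto simp: L2_def)
  moreover have "norm ((a + b)\<^sup>2) \<le> norm (2 * a\<^sup>2 + 2 * b\<^sup>2)" for a b :: real
    using sum_squares_bound[of a b] zero_le_power2[of "a + b"] unfolding power2_sum by simp
  ultimately have "integrable (lebesgue_on S) (\<lambda>x. (f x + g x)\<^sup>2)"
    using m by (intro Bochner_Integration.integrable_bound[where g = "\<lambda>x. (f x + g x)\<^sup>2"]) auto
  with m show ?thesis by (simp add: L2_def)
qed

lemma L2_loc_add: "f \<in> L2_loc S \<Longrightarrow> g \<in> L2_loc S \<Longrightarrow> (\<lambda>x. f x + g x) \<in> L2_loc S"
  by (simp add: L2_loc_def L2_add)

lemma L2_loc_continuous: "continuous_on S f \<Longrightarrow> f \<in> L2_loc S"
  unfolding L2_loc_def by (intro CollectI allI impI L2_continuous) (auto intro: continuous_on_subset)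

lemma sobolev_H_loc_add_C_infinity:
  assumes "open \<Omega>" "f \<in> sobolev_H_loc k \<Omega>" "C_infinity g"
  shows "(\<lambda>x. f x + g x) \<in> sobolev_H_loc k \<Omega>"
  unfolding sobolev_H_loc_def
proof (intro CollectI conjI ballI impI)
  have "f \<in> L2_loc \<Omega>" using assms(2) by (simp add: sobolev_H_loc_def)
  then show "(\<lambda>x. f x + g x) \<in> L2_loc \<Omega>"
    by (rule L2_loc_add[OF _ L2_loc_continuous[OF C_infinity_continuous_on[OF assms(3)]]])
  fix bs :: "'a list" assume bs: "bs \<in> lists Basis" "length bs \<le> k"
  then obtain h where h: "h \<in> L2_loc \<Omega>" "has_weak_deriv \<Omega> bs f h"
    using assms(2) unfolding sobolev_H_loc_def by blast
  have "rev bs \<in> lists Basis" using bs by auto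
  then show "\<exists>h\<in>L2_loc \<Omega>. has_weak_deriv \<Omega> bs (\<lambda>x. f x + g x) h"
    by (intro bexI[where x = "\<lambda>x. h x + partial_derivs (rev bs) g x"]
        has_weak_deriv_add[OF assms(1) bs(1) h(2) has_weak_deriv_C_infinity[OF assms(1,3) bs(1)]]
        L2_loc_add[OF h(1) L2_loc_continuous[OF C_infinity_continuous_on[OF C_infinity_partial_derivs[OF assms(3)]]]])
qed

lemma has_weak_deriv_weak_deriv:
  assumes "f \<in> sobolev_H_loc k \<Omega>" "bs \<in> lists Basis" "length bs \<le> k"
  shows "has_weak_deriv \<Omega> bs f (weak_deriv \<Omega> bs f)"
  unfolding weak_deriv_def using assms by (intro someI_ex[of "has_weak_deriv \<Omega> bs f"]) (auto simp: sobolev_H_loc_def)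

lemma weak_laplacian_real_prod:
  "weak_laplacian \<Omega> f z = weak_deriv \<Omega> [(1, 0), (1, 0)] f z + weak_deriv \<Omega> [(0, 1), (0, 1)] f z"
  for \<Omega> :: "(real \<times> real) set"
  by (simp add: weak_laplacian_def Basis_prod_def sum.union_disjoint)

text \<open>The representatives picked by \<open>weak_deriv\<close> need not be additive; almost
  everywhere they are, by uniqueness of weak derivatives.\<close>

lemma weak_laplacian_add_C_infinity:
  fixes \<Omega> :: "(real \<times> real) set"
  assumes "open \<Omega>" "f \<in> sobolev_H_loc 2 \<Omega>" "C_infinity g"
  shows "AE z in lebesgue_on \<Omega>. weak_laplacian \<Omega> (\<lambda>x. f x + g x) z =
    weak_laplacian \<Omega> f z + (partial_derivs [(1, 0), (1, 0)] g z + partial_derivs [(0, 1), (0, 1)] g z)"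
proof -
  have "AE z in lebesgue_on \<Omega>. weak_deriv \<Omega> [b, b] (\<lambda>x. f x + g x) z = weak_deriv \<Omega> [b, b] f z + partial_derivs [b, b] g z"
    if "b \<in> Basis" for b
    using weak_deriv_unique[OF assms(1)
        has_weak_deriv_weak_deriv[OF sobolev_H_loc_add_C_infinity[OF assms]]
        has_weak_deriv_add[OF assms(1) _ has_weak_deriv_weak_deriv[OF assms(2)]
          has_weak_deriv_C_infinity[OF assms(1,3)]], of "[b, b]"] that by simp
  from this[of "(1, 0)"] this[of "(0, 1)"]
  have "AE z in lebesgue_on \<Omega>. weak_deriv \<Omega> [(1, 0), (1, 0)] (\<lambda>x. f x + g x) z = weak_deriv \<Omega> [(1, 0), (1, 0)] f z + partial_derivs [(1, 0), (1, 0)] g z"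
    "AE z in lebesgue_on \<Omega>. weak_deriv \<Omega> [(0, 1), (0, 1)] (\<lambda>x. f x + g x) z = weak_deriv \<Omega> [(0, 1), (0, 1)] f z + partial_derivs [(0, 1), (0, 1)] g z"
    by (auto simp: Basis_prod_def)
  then show ?thesis by eventually_elim (simp only: weak_laplacian_real_prod)
qed

section \<open>Geometry of the L-shaped domain\<close>

lemma open_L_domain: "open L_domain"
  unfolding L_domain_def by (intro open_Diff open_Times closed_Times) auto

lemma closure_L_domain_subset: "closure L_domain \<subseteq> {-1..1} \<times> {-1..1}"
  by (rule closure_minimal) (auto simp: L_domain_def intro!: closed_Times)

lemma compact_closure_L_domain: "compact (closure L_domain)"
  unfolding compact_eq_bounded_closed
  by (intro conjI closed_closure bounded_subset[OF _ closure_L_domain_subset] bounded_Times bounded_closed_interval)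

lemma lmeasurable_L_domain: "L_domain \<in> lmeasurable"
  by (rule lmeasurable_open[OF bounded_subset[OF compact_imp_bounded[OF compact_closure_L_domain] closure_subset] open_L_domain])

lemma borel_measurable_L_domain:
  "continuous_on L_domain f \<Longrightarrow> f \<in> borel_measurable (lebesgue_on L_domain)"
  using lmeasurable_L_domain by (intro continuous_imp_measurable_on_sets_lebesgue) auto

lemma L_domain_frontier_axes:
  "0 \<le> x \<Longrightarrow> x < 1 \<Longrightarrow> (x, 0) \<in> frontier L_domain"
  "0 \<le> x \<Longrightarrow> x < 1 \<Longrightarrow> (0, -x) \<in> frontier L_domain"
proof -
  \<comment> \<open>The double \<open>Suc\<close> keeps the sequence strictly below 1, so that the
    approximating points lie in the open domain from the first index on.\<close>
  have lim: "(\<lambda>n. inverse (real (Suc (Suc n)))) \<longlonglongrightarrow> 0"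
    using LIMSEQ_Suc[OF LIMSEQ_inverse_real_of_nat] by simp
  have inv: "inverse (real (Suc (Suc n))) < 1" "- 1 < inverse (real (Suc (Suc n)))" for n
    by (simp add: inverse_less_1_iff) (rule less_trans[of _ 0], auto)
  {
    assume x: "0 \<le> x" "x < 1"
    have "(\<lambda>n. (x, inverse (real (Suc (Suc n))))) \<longlonglongrightarrow> (x, 0)"
      by (intro tendsto_Pair tendsto_const lim)
    moreover have "(x, inverse (real (Suc (Suc n)))) \<in> L_domain" for n
      using x inv[of n] by (auto simp: L_domain_def simp del: of_nat_Suc)
    ultimately have "(x, 0) \<in> closure L_domain"
      unfolding closure_sequential by (intro exI[of _ "\<lambda>n. (x, inverse (real (Suc (Suc n))))"]) simp
    then show "(x, 0) \<in> frontier L_domain"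
      using x by (simp add: frontier_def interior_open[OF open_L_domain]) (simp add: L_domain_def)
    have "(\<lambda>n. (- inverse (real (Suc (Suc n))), -x)) \<longlonglongrightarrow> (- 0, -x)"
      by (intro tendsto_Pair tendsto_const tendsto_minus lim)
    moreover have "(- inverse (real (Suc (Suc n))), -x) \<in> L_domain" for n
      using x inv[of n] by (auto simp: L_domain_def simp del: of_nat_Suc)
    ultimately have "(0, -x) \<in> closure L_domain"
      unfolding closure_sequential by (intro exI[of _ "\<lambda>n. (- inverse (real (Suc (Suc n))), -x)"]) simp
    then show "(0, -x) \<in> frontier L_domain"
      using x by (simp add: frontier_def interior_open[OF open_L_domain]) (simp add: L_domain_def)
  }
qed

lemma bounded_on_L_domain:
  fixes v :: "real \<times> real \<Rightarrow> real"
  assumes "continuous_on (closure L_domain) v"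
  obtains b where "b \<ge> 0" "\<And>z. z \<in> closure L_domain \<Longrightarrow> \<bar>v z\<bar> \<le> b"
proof -
  have "bounded (v ` closure L_domain)"
    using compact_imp_bounded[OF compact_continuous_image[OF assms compact_closure_L_domain]] .
  then obtain b where b: "\<And>z. z \<in> closure L_domain \<Longrightarrow> \<bar>v z\<bar> \<le> b" by (auto simp: bounded_iff)
  have "(0, 0) \<in> closure L_domain" using L_domain_frontier_axes(1)[of 0] by (simp add: frontier_def)
  then have "b \<ge> 0" using b[of "(0, 0)"] by linarith
  with b show ?thesis using that by blast
qed

lemma smooth_on_fst: "smooth_on UNIV (fst :: real \<times> real \<Rightarrow> real)"
  and smooth_on_snd: "smooth_on UNIV (snd :: real \<times> real \<Rightarrow> real)"
  by (intro smooth_on_bounded_linear open_UNIV bounded_linear_fst bounded_linear_snd)+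

text \<open>Adding \<open>\<bar>z - z0\<bar>\<^sup>2 / 4 - 1\<close>, which has Laplacian 1 and lies between -1 and 1 on the boundary,
  makes \<open>u\<close> weakly harmonic; the estimate at \<open>z0\<close>, where the paraboloid has its minimum, gives the sign.\<close>

lemma strong_solution_nonneg:
  assumes ABP: "ABP_constant L_domain C"
    and sol: "poisson_strong_solution L_domain (\<lambda>_. 1) (\<lambda>_. 0) u"
    and z0: "z0 \<in> L_domain"
  shows "0 \<le> u z0"
proof -
  define p :: "real \<times> real \<Rightarrow> real" where
    "p z = ((fst z - fst z0)\<^sup>2 + (snd z - snd z0)\<^sup>2) / 4 - 1" for z
  define v where "v z = u z + p z" for z
  have p_smooth: "C_infinity p"
  proof -
    have "smooth_on UNIV (\<lambda>z. (1/4) * ((fst z - fst z0) * (fst z - fst z0) + (snd z - snd z0) * (snd z - snd z0)) - 1)"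
      by (intro smooth_on_diff smooth_on_mult smooth_on_add smooth_on_const smooth_on_fst smooth_on_snd) auto
    then show ?thesis by (simp add: C_infinity_iff_smooth_on p_def[abs_def] power2_eq_square)
  qed
  have dp: "(p has_derivative (\<lambda>h. (fst z - fst z0) / 2 * fst h + (snd z - snd z0) / 2 * snd h)) (at z)" for z
    unfolding p_def[abs_def] by (auto intro!: derivative_eq_intros simp: power2_eq_square field_simps)
  have d1: "partial_deriv (1, 0) p = (\<lambda>z. (fst z - fst z0) / 2)" and d2: "partial_deriv (0, 1) p = (\<lambda>z. (snd z - snd z0) / 2)"
    using partial_deriv_eqI[OF dp] by auto
  have "((\<lambda>z. (fst z - fst z0) / 2) has_derivative (\<lambda>h. fst h / 2)) (at z)"
    "((\<lambda>z. (snd z - snd z0) / 2) has_derivative (\<lambda>h. snd h / 2)) (at z)" for z :: "real \<times> real"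
    by (auto intro!: derivative_eq_intros)
  from this(1)[THEN partial_deriv_eqI, of "(1, 0)"] this(2)[THEN partial_deriv_eqI, of "(0, 1)"]
  have lap_p: "partial_derivs [(1, 0), (1, 0)] p z + partial_derivs [(0, 1), (0, 1)] p z = 1" for z
    by (simp only: d1 d2 partial_derivs_Cons partial_derivs_Nil) simp
  have u: "continuous_on (closure L_domain) u" "u \<in> sobolev_H_loc 2 L_domain"
    "AE z in lebesgue_on L_domain. - weak_laplacian L_domain u z = 1" "\<And>z. z \<in> frontier L_domain \<Longrightarrow> u z = 0"
    using sol unfolding poisson_strong_solution_def by auto
  have cont_v: "continuous_on (closure L_domain) v"
    unfolding v_def[abs_def] by (rule continuous_on_add[OF u(1) C_infinity_continuous_on[OF p_smooth]])
  have "v \<in> sobolev_H_loc 2 L_domain"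
    unfolding v_def[abs_def] by (rule sobolev_H_loc_add_C_infinity[OF open_L_domain u(2) p_smooth])
  moreover have lap_v: "AE z in lebesgue_on L_domain. weak_laplacian L_domain v z = 0"
    using weak_laplacian_add_C_infinity[OF open_L_domain u(2) p_smooth] u(3)
    unfolding v_def[abs_def]
  proof eventually_elim
    case (elim z) then show ?case using lap_p[of z] by linarith
  qed
  moreover have meas: "weak_laplacian L_domain v \<in> borel_measurable (lebesgue_on L_domain)"
    by (rule borel_measurable_AE_zero[OF _ lap_v]) (use open_L_domain in auto)
  moreover have "AE z in lebesgue_on L_domain. 0 = (weak_laplacian L_domain v z)\<^sup>2"
    using lap_v by eventually_elim simp
  then have "integrable (lebesgue_on L_domain) (\<lambda>z. (weak_laplacian L_domain v z)\<^sup>2)"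
    by (rule integrable_cong_AE_imp[OF integrable_zero borel_measurable_power[OF meas]])
  moreover have "(LINT z|lebesgue_on L_domain. (weak_laplacian L_domain v z)\<^sup>2) = 0"
  proof (rule integral_eq_zero_AE)
    show "AE z in lebesgue_on L_domain. (weak_laplacian L_domain v z)\<^sup>2 = 0"
      using lap_v by eventually_elim simp
  qed
  ultimately have "v \<in> V_space L_domain" and norm0: "L2_norm L_domain (weak_laplacian L_domain v) = 0"
    using cont_v unfolding V_space_def L2_def L2_norm_def by simp_all
  from this(1) have "sup_norm_on L_domain v \<le> sup_norm_on (frontier L_domain) v + C * L2_norm L_domain (weak_laplacian L_domain v)"
    using ABP unfolding ABP_constant_def by blast
  also have "\<dots> = sup_norm_on (frontier L_domain) v" by (simp only: norm0 mult_zero_right add_0_right)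
  also have "\<dots> \<le> 1"
    unfolding sup_norm_on_def
  proof (rule cSUP_least)
    show "frontier L_domain \<noteq> {}" using L_domain_frontier_axes(1)[of 0] by auto
    fix z assume z: "z \<in> frontier L_domain"
    then have "z \<in> {-1..1} \<times> {-1..1}" using closure_L_domain_subset by (auto simp: frontier_def)
    moreover have "z0 \<in> {-1..1} \<times> {-1..1}" using z0 by (auto simp: L_domain_def)
    ultimately have "\<bar>fst z - fst z0\<bar> \<le> 2" "\<bar>snd z - snd z0\<bar> \<le> 2" by (auto simp: mem_Times_iff)
    then have "(fst z - fst z0)\<^sup>2 \<le> 2\<^sup>2" "(snd z - snd z0)\<^sup>2 \<le> 2\<^sup>2"
      using abs_le_square_iff[of "fst z - fst z0" 2] abs_le_square_iff[of "snd z - snd z0" 2] by simp_all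
    then have "\<bar>p z\<bar> \<le> 1"
      using zero_le_power2[of "fst z - fst z0"] zero_le_power2[of "snd z - snd z0"]
      unfolding abs_le_iff p_def by simp
    then show "\<bar>v z\<bar> \<le> 1" unfolding v_def u(4)[OF z] by simp
  qed
  finally have sup1: "sup_norm_on L_domain v \<le> 1" .
  have "\<bar>v z0\<bar> \<le> sup_norm_on L_domain v"
    unfolding sup_norm_on_def
  proof (rule cSUP_upper[OF z0])
    obtain b where "\<And>z. z \<in> closure L_domain \<Longrightarrow> \<bar>v z\<bar> \<le> b"
      using bounded_on_L_domain[OF cont_v] by blast
    then show "bdd_above ((\<lambda>z. \<bar>v z\<bar>) ` L_domain)"
      using closure_subset by (intro bdd_aboveI2[of _ _ b]) blast
  qed
  then have "\<bar>v z0\<bar> \<le> 1" using sup1 by linarith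
  then show ?thesis by (simp add: v_def p_def)
qed


subsection \<open>Differences of functions with square integrable second derivatives\<close>

definition mollifier :: "real \<Rightarrow> real \<Rightarrow> real \<Rightarrow> real" where
  "mollifier e c x = bump ((x - c) / e) / e"

lemma smooth_on_mollifier: "smooth_on UNIV (mollifier e c)"
  using smooth_on_mult[OF _ smooth_on_const[of UNIV "1/e"] smooth_on_affine_compose[OF smooth_on_bump, of "1/e" "- c / e"]]
  by (simp add: mollifier_def[abs_def] diff_divide_distrib)

lemma mollifier_nonneg: "e > 0 \<Longrightarrow> mollifier e c x \<ge> 0"
  by (simp add: mollifier_def bump_nonneg)

lemma mollifier_eq_0: "e > 0 \<Longrightarrow> e \<le> \<bar>x - c\<bar> \<Longrightarrow> mollifier e c x = 0"
  by (simp add: mollifier_def bump_zero)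

lemma window_has_real_derivative_mollifier:
  "e > 0 \<Longrightarrow> (window e x1 x2 has_real_derivative (mollifier e (x1 + e) x - mollifier e (x2 - e) x)) (at x)"
  by (rule DERIV_cong[OF window_has_real_derivative]) (auto simp: mollifier_def diff_divide_distrib add_divide_distrib diff_diff_eq algebra_simps)

lemma integrable_bump: "integrable lborel bump"
  and lborel_integral_bump: "(LINT x|lborel. bump x) = 1"
proof -
  have b: "bump = (\<lambda>x. indicator {-1..1} x *\<^sub>R bump x)"
  proof
    show "bump x = indicator {-1..1} x *\<^sub>R bump x" for x using bump_zero[of x] by (cases "\<bar>x\<bar> \<le> 1") (auto simp: indicator_def abs_le_iff)
  qed
  have i: "set_integrable lborel {-1..1} bump"
    unfolding set_integrable_def by (rule borel_integrable_compact) (auto intro: continuous_on_bump)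
  show "integrable lborel bump" using i b unfolding set_integrable_def by simp
  have "(LINT x:{-1..1}|lborel. bump x) = 1"
    using set_borel_integral_eq_integral(2)[OF i] integral_bump by simp
  then show "(LINT x|lborel. bump x) = 1" using b unfolding set_lebesgue_integral_def by simp
qed

lemma mollifier_integral:
  assumes "e > 0" shows "integrable lborel (mollifier e c)" "(LINT x|lborel. mollifier e c x) = 1"
proof -
  have eq: "mollifier e c (c + e * x) = bump x / e" for x using assms by (simp add: mollifier_def)
  have "integrable lborel (\<lambda>x. mollifier e c (c + e * x))" using integrable_bump by (simp add: eq)
  then show "integrable lborel (mollifier e c)" using assms by (simp add: lborel_integrable_real_affine_iff)
  have "(LINT x|lborel. mollifier e c x) = \<bar>e\<bar> *\<^sub>R (LINT x|lborel. mollifier e c (c + e * x))"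
    using assms by (intro lborel_integral_real_affine) auto
  then show "(LINT x|lborel. mollifier e c x) = 1" using assms by (simp add: eq lborel_integral_bump)
qed

lemma lborel_integral_tensor:
  assumes "integrable lborel a" "integrable lborel b"
  shows "integrable lborel (tensor a b)"
    and "(LINT z|lborel. tensor a b z) = (LINT x|lborel. a x) * (LINT y|lborel. b y)"
proof -
  have m: "tensor a b \<in> borel_measurable (lborel \<Otimes>\<^sub>M lborel)"
    unfolding tensor_def[abs_def] using assms[THEN borel_measurable_integrable] by measurable
  have i: "integrable (lborel \<Otimes>\<^sub>M lborel) (tensor a b)"
    using assms by (intro lborel_pair.Fubini_integrable m) (auto simp: tensor_def abs_mult)
  then show "integrable lborel (tensor a b)" by (simp add: lborel_prod)
  show "(LINT z|lborel. tensor a b z) = (LINT x|lborel. a x) * (LINT y|lborel. b y)"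
  proof -
    have "(LINT x|lborel. LINT y|lborel. tensor a b (x, y)) = (LINT x|lborel. a x) * (LINT y|lborel. b y)"
      by (simp add: tensor_def)
    then show ?thesis using lborel_pair.integral_fst'[OF i] by (simp add: lborel_prod)
  qed
qed

text \<open>\<open>\<psi>\<close> is a probability density, so the averages of two functions differ
  by no more than the functions do on its support. Point values of a continuous \<open>v\<close> are
  thus compared with its pairings.\<close>

lemma integral_test_close:
  assumes "open \<Omega>" "\<psi> \<in> test_functions \<Omega>" "\<And>z. \<psi> z \<ge> 0" "(LINT z|lborel. \<psi> z) = 1"
    and "locally_integrable \<Omega> v" "locally_integrable \<Omega> w"
    and "\<And>z. z \<in> \<Omega> \<Longrightarrow> \<psi> z \<noteq> 0 \<Longrightarrow> \<bar>v z - w z\<bar> \<le> \<eta>"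
  shows "\<bar>(LINT z|lebesgue_on \<Omega>. v z * \<psi> z) - (LINT z|lebesgue_on \<Omega>. w z * \<psi> z)\<bar> \<le> \<eta>"
proof -
  have iv: "integrable (lebesgue_on \<Omega>) (\<lambda>z. v z * \<psi> z)" "integrable (lebesgue_on \<Omega>) (\<lambda>z. w z * \<psi> z)"
    using assms by (auto intro: integrable_locally_integrable_times_test)
  have ip: "integrable (lebesgue_on \<Omega>) (\<lambda>z. \<eta> * \<psi> z)"
    using assms(1,2) by (intro integrable_locally_integrable_times_test locally_integrable_continuous) auto
  have "\<bar>(LINT z|lebesgue_on \<Omega>. v z * \<psi> z) - (LINT z|lebesgue_on \<Omega>. w z * \<psi> z)\<bar>
      = \<bar>LINT z|lebesgue_on \<Omega>. v z * \<psi> z - w z * \<psi> z\<bar>" using iv by simp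
  also have "\<dots> \<le> (LINT z|lebesgue_on \<Omega>. \<bar>v z * \<psi> z - w z * \<psi> z\<bar>)" by (rule integral_abs_bound)
  also have "\<dots> \<le> (LINT z|lebesgue_on \<Omega>. \<eta> * \<psi> z)"
  proof (rule integral_mono)
    fix z assume "z \<in> space (lebesgue_on \<Omega>)"
    then have "z \<in> \<Omega>" by simp
    have "\<bar>v z * \<psi> z - w z * \<psi> z\<bar> = \<bar>v z - w z\<bar> * \<psi> z"
      using assms(3)[of z] by (simp add: abs_mult flip: left_diff_distrib)
    also have "\<dots> \<le> \<eta> * \<psi> z"
      using assms(3)[of z] assms(7)[OF \<open>z \<in> \<Omega>\<close>] by (cases "\<psi> z = 0") (auto intro: mult_right_mono)
    finally show "\<bar>v z * \<psi> z - w z * \<psi> z\<bar> \<le> \<eta> * \<psi> z" .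
  qed (use iv ip in auto)
  also have "\<dots> = \<eta> * (LINT z|lebesgue_on \<Omega>. \<psi> z)" by simp
  also have "(LINT z|lebesgue_on \<Omega>. \<psi> z) = 1" using integral_lebesgue_on_test[OF assms(1,2)] assms(4) by simp
  finally show ?thesis by simp
qed

lemma integral_indicator_lebesgue_on:
  assumes "open \<Omega>" "S \<in> lmeasurable"
  shows "integrable (lebesgue_on \<Omega>) (indicat_real S)" "(LINT z|lebesgue_on \<Omega>. indicat_real S z) \<le> measure lebesgue S"
proof -
  have sector_map: "\<Omega> \<inter> space lebesgue \<in> sets lebesgue" using assms(1) by simp
  have SO: "S \<inter> \<Omega> \<in> lmeasurable" using assms by (intro fmeasurable_Int_fmeasurable) auto
  have indS: "(\<lambda>z. indicator \<Omega> z *\<^sub>R indicat_real S z) = indicator (S \<inter> \<Omega>)" by (auto simp: indicator_def)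
  show "integrable (lebesgue_on \<Omega>) (indicat_real S)"
    unfolding integrable_restrict_space[OF sector_map] indS using SO by (auto simp: fmeasurable_def)
  have "(LINT z|lebesgue_on \<Omega>. indicat_real S z) = measure lebesgue (S \<inter> \<Omega>)"
    unfolding integral_restrict_space[OF sector_map] indS using SO by simp
  also have "\<dots> \<le> measure lebesgue S" using SO assms(2) by (intro measure_mono_fmeasurable) auto
  finally show "(LINT z|lebesgue_on \<Omega>. indicat_real S z) \<le> measure lebesgue S" .
qed

text \<open>Cauchy-Schwarz in the form 2 |g h| <= t g^2 + h^2 / t. The weight stays free: it is a
  length scale in the corner estimates and balances two errors at the end.\<close>

lemma L2_pairing_le:
  assumes "g \<in> L2 S" "h \<in> L2 S" "t > 0"
  shows "integrable (lebesgue_on S) (\<lambda>z. g z * h z)"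
    "\<bar>LINT z|lebesgue_on S. g z * h z\<bar> \<le> (t * (LINT z|lebesgue_on S. (g z)\<^sup>2) + (LINT z|lebesgue_on S. (h z)\<^sup>2) / t) / 2"
proof -
  have i: "integrable (lebesgue_on S) (\<lambda>z. (g z)\<^sup>2)" "integrable (lebesgue_on S) (\<lambda>z. (h z)\<^sup>2)"
    and m: "g \<in> borel_measurable (lebesgue_on S)" "h \<in> borel_measurable (lebesgue_on S)"
    using assms by (auto simp: L2_def)
  have i': "integrable (lebesgue_on S) (\<lambda>z. t / 2 * (g z)\<^sup>2 + (h z)\<^sup>2 / (2 * t))" using i by simp
  have p: "\<bar>g z * h z\<bar> \<le> t / 2 * (g z)\<^sup>2 + (h z)\<^sup>2 / (2 * t)" for z
  proof -
    have "0 \<le> (t * \<bar>g z\<bar> - \<bar>h z\<bar>)\<^sup>2" by simp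
    also have "\<dots> = t\<^sup>2 * (g z)\<^sup>2 - 2 * t * \<bar>g z * h z\<bar> + (h z)\<^sup>2"
      by (simp add: power2_diff power_mult_distrib abs_mult)
    finally have "\<bar>g z * h z\<bar> \<le> (t\<^sup>2 * (g z)\<^sup>2 + (h z)\<^sup>2) / (2 * t)" using assms(3) by (simp add: field_simps)
    then show ?thesis using assms(3) by (simp add: add_divide_distrib power2_eq_square)
  qed
  show gh: "integrable (lebesgue_on S) (\<lambda>z. g z * h z)"
    by (rule Bochner_Integration.integrable_bound[OF i']) (use m p assms(3) in \<open>auto intro!: AE_I2 order_trans[OF p]\<close>)
  have "\<bar>LINT z|lebesgue_on S. g z * h z\<bar> \<le> (LINT z|lebesgue_on S. \<bar>g z * h z\<bar>)" by (rule integral_abs_bound)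
  also have "\<dots> \<le> (LINT z|lebesgue_on S. t / 2 * (g z)\<^sup>2 + (h z)\<^sup>2 / (2 * t))"
    using gh i' p by (intro integral_mono) auto
  also have "\<dots> = t / 2 * (LINT z|lebesgue_on S. (g z)\<^sup>2) + (LINT z|lebesgue_on S. (h z)\<^sup>2) / (2 * t)" using i by simp
  finally show "\<bar>LINT z|lebesgue_on S. g z * h z\<bar> \<le> (t * (LINT z|lebesgue_on S. (g z)\<^sup>2) + (LINT z|lebesgue_on S. (h z)\<^sup>2) / t) / 2"
    by (simp add: add_divide_distrib)
qed

lemma L2_pairing_bound:
  assumes "open \<Omega>" "g \<in> L2 \<Omega>" "\<phi> \<in> test_functions \<Omega>" "t > 0"
    and "\<And>z. \<bar>\<phi> z\<bar> \<le> c" "\<And>z. z \<notin> S \<Longrightarrow> \<phi> z = 0" "S \<in> lmeasurable" "measure lebesgue S \<le> A"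
  shows "\<bar>LINT z|lebesgue_on \<Omega>. g z * \<phi> z\<bar> \<le> (t * (LINT z|lebesgue_on \<Omega>. (g z)\<^sup>2) + c\<^sup>2 * A / t) / 2"
proof -
  let ?M = "lebesgue_on \<Omega>"
  have C: "continuous_on \<Omega> \<phi>" by (rule C_infinity_continuous_on[OF test_functions_C_infinity[OF assms(3)]])
  have i: "integrable ?M (\<lambda>z. (\<phi> z)\<^sup>2)"
    using integrable_locally_integrable_times_test[OF assms(1) locally_integrable_continuous[OF C] assms(3)]
    by (simp add: power2_eq_square)
  then have \<phi>: "\<phi> \<in> L2 \<Omega>"
    using continuous_imp_measurable_on_sets_lebesgue[OF C] assms(1) by (simp add: L2_def)
  note ind = integral_indicator_lebesgue_on[OF assms(1,7)]
  have "(LINT z|?M. (\<phi> z)\<^sup>2) \<le> (LINT z|?M. c\<^sup>2 * indicat_real S z)"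
  proof (rule integral_mono[OF i])
    show "(\<phi> z)\<^sup>2 \<le> c\<^sup>2 * indicat_real S z" for z
      using assms(5,6)[of z] abs_le_square_iff[of "\<phi> z" c] by (cases "z \<in> S") auto
  qed (use ind in simp)
  also have "\<dots> = c\<^sup>2 * (LINT z|?M. indicat_real S z)" by simp
  also have "\<dots> \<le> c\<^sup>2 * A" using ind(2) assms(8) by (intro mult_left_mono) auto
  finally have "(LINT z|?M. (\<phi> z)\<^sup>2) / t \<le> c\<^sup>2 * A / t" using assms(4) by (intro divide_right_mono) auto
  then show ?thesis using L2_pairing_le(2)[OF assms(2) \<phi> assms(4)] by argo
qed

lemma measure_lebesgue_rectangle:
  "x1 \<le> x2 \<Longrightarrow> y1 \<le> y2 \<Longrightarrow> measure lebesgue ({x1..x2} \<times> {y1..y2}) = (x2 - x1) * (y2 - y1)"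
  "{x1..x2::real} \<times> {y1..y2::real} \<in> lmeasurable"
proof -
  have c: "{x1..x2} \<times> {y1..y2} = cbox (x1, y1) (x2, y2)" by (simp add: Pair_cbox_eq)
  show "{x1..x2} \<times> {y1..y2} \<in> lmeasurable" unfolding c by (rule lmeasurable_cbox)
  show "measure lebesgue ({x1..x2} \<times> {y1..y2}) = (x2 - x1) * (y2 - y1)" if "x1 \<le> x2" "y1 \<le> y2"
    unfolding c using that by (simp add: content_Pair)
qed

text \<open>The mixed derivative of a product of two windows consists of four mollifiers with
  alternating signs, one near each corner of the rectangle. Testing \<open>v\<close> with it gives
  the mixed difference up to a small error, while the weak derivative turns the same number into a
  pairing of \<open>g\<close> with a function bounded by 1 on the rectangle. Only the open rectangle
  lies in the domain, so the mollifiers sit slightly inside and uniform continuity carries the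
  values to the corners.\<close>

lemma mixed_difference_bound:
  assumes "open \<Omega>" "has_weak_deriv \<Omega> [(1, 0), (0, 1)] v g" "g \<in> L2 \<Omega>" "x1 < x2" "y1 < y2" "t > 0"
    and sub: "{x1<..<x2} \<times> {y1<..<y2} \<subseteq> \<Omega>"
    and cont: "continuous_on ({x1..x2} \<times> {y1..y2}) v"
  shows "\<bar>v (x2, y2) - v (x1, y2) - v (x2, y1) + v (x1, y1)\<bar>
    \<le> (t * (LINT z|lebesgue_on \<Omega>. (g z)\<^sup>2) + (x2 - x1) * (y2 - y1) / t) / 2" (is "?D \<le> ?B")
proof (rule field_le_epsilon)
  fix r :: real assume "r > 0"
  \<comment> \<open>One quarter of the error for each of the four corners.\<close>
  define \<eta> where "\<eta> = r / 4"
  have "\<eta> > 0" using \<open>r > 0\<close> by (simp add: \<eta>_def)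
  have li: "locally_integrable \<Omega> v" "locally_integrable \<Omega> g" using assms(2) by (auto simp: has_weak_deriv_def)
  have "uniformly_continuous_on ({x1..x2} \<times> {y1..y2}) v"
    by (intro compact_uniformly_continuous cont compact_Times compact_Icc)
  then obtain r' where d: "r' > 0" "\<And>z w. z \<in> {x1..x2} \<times> {y1..y2} \<Longrightarrow> w \<in> {x1..x2} \<times> {y1..y2} \<Longrightarrow> dist w z < r' \<Longrightarrow> dist (v w) (v z) < \<eta>"
    using \<open>\<eta> > 0\<close> unfolding uniformly_continuous_on_def by metis
  \<comment> \<open>On the support of a mollifier each coordinate is within \<open>3 * e\<close> of
    the corner, so the distance is below \<open>6 * e\<close>, hence below
    \<open>r'\<close>.\<close>
  define e where "e = Min {r' / 8, (x2 - x1) / 8, (y2 - y1) / 8}"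
  have e: "e > 0" "8 * e \<le> r'" "8 * e \<le> x2 - x1" "8 * e \<le> y2 - y1"
    using d(1) assms(4,5) by (auto simp: e_def min_def)
  \<comment> \<open>Starting the windows at distance \<open>e\<close> from the sides makes their
    closed supports fit into the open rectangle and centres the mollifiers at distance
    \<open>2 * e\<close>.\<close>
  define a where "a = window e (x1 + e) (x2 - e)"
  define b where "b = window e (y1 + e) (y2 - e)"
  define m where "m c d = tensor (mollifier e c) (mollifier e d)" for c d
  have m_test: "m c d \<in> test_functions \<Omega>" and m_close: "\<bar>(LINT z|lebesgue_on \<Omega>. v z * m c d z) - v (p, q)\<bar> \<le> \<eta>"
    if "c \<in> {x1 + 2 * e, x2 - 2 * e}" "d \<in> {y1 + 2 * e, y2 - 2 * e}" "p = x1 \<or> p = x2" "q = y1 \<or> q = y2"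
      "\<bar>c - p\<bar> = 2 * e" "\<bar>d - q\<bar> = 2 * e" for c d p q
  proof -
    have s: "{c - e..c + e} \<times> {d - e..d + e} \<subseteq> {x1<..<x2} \<times> {y1<..<y2}" using that e by auto
    show t: "m c d \<in> test_functions \<Omega>" unfolding m_def
      by (rule test_functions_tensor[OF smooth_on_mollifier smooth_on_mollifier _ _ order_trans[OF s sub]])
        (use e in \<open>auto intro!: mollifier_eq_0\<close>)
    have "\<bar>(LINT z|lebesgue_on \<Omega>. v z * m c d z) - (LINT z|lebesgue_on \<Omega>. v (p, q) * m c d z)\<bar> \<le> \<eta>"
    proof (rule integral_test_close[OF \<open>open \<Omega>\<close> t])
      show "m c d z \<ge> 0" for z unfolding m_def tensor_def using e by (simp add: mollifier_nonneg)
      show "(LINT z|lborel. m c d z) = 1"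
        unfolding m_def using lborel_integral_tensor(2)[OF mollifier_integral(1) mollifier_integral(1)] mollifier_integral(2) e(1) by simp
      show "locally_integrable \<Omega> (\<lambda>_. v (p, q))" by (intro locally_integrable_continuous continuous_on_const)
      fix z assume "m c d z \<noteq> 0"
      then have z: "\<bar>fst z - c\<bar> < e" "\<bar>snd z - d\<bar> < e"
        using mollifier_eq_0[OF e(1)] by (auto simp: m_def tensor_def not_le[symmetric])
      have "dist z (p, q) \<le> \<bar>fst z - p\<bar> + \<bar>snd z - q\<bar>"
        unfolding dist_prod_def dist_real_def using sqrt_sum_squares_le_sum_abs by auto
      also have "\<dots> < r'" using z that(5,6) e(1,2) by linarith
      finally have dist_lt: "dist z (p, q) < r'" .
      have "z \<in> {c - e..c + e} \<times> {d - e..d + e}" using z by (cases z) auto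
      then have "z \<in> {x1<..<x2} \<times> {y1<..<y2}" using s by blast
      then have "z \<in> {x1..x2} \<times> {y1..y2}" by auto
      moreover have "(p, q) \<in> {x1..x2} \<times> {y1..y2}" using that(3,4) assms(4,5) by auto
      ultimately show "\<bar>v z - v (p, q)\<bar> \<le> \<eta>"
        using d(2)[of "(p, q)" z] dist_lt by (simp add: dist_real_def)
    qed (use li in auto)
    moreover have "(LINT z|lebesgue_on \<Omega>. v (p, q) * m c d z) = v (p, q)"
      using integral_lebesgue_on_test[OF \<open>open \<Omega>\<close> t] e(1)
        lborel_integral_tensor(2)[OF mollifier_integral(1) mollifier_integral(1)] mollifier_integral(2)
      by (simp add: m_def)
    ultimately show "\<bar>(LINT z|lebesgue_on \<Omega>. v z * m c d z) - v (p, q)\<bar> \<le> \<eta>" by (simp only:)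
  qed
  have ab_test: "tensor a b \<in> test_functions \<Omega>"
  proof (rule test_functions_tensor)
    show "{x1 + e..x2 - e} \<times> {y1 + e..y2 - e} \<subseteq> \<Omega>" using e by (intro order_trans[OF _ sub]) auto
  qed (use e in \<open>auto simp: a_def b_def intro!: smooth_on_window window_eq_0\<close>)
  have dab: "partial_derivs [(1, 0), (0, 1)] (tensor a b) z
      = m (x1 + 2 * e) (y1 + 2 * e) z - m (x2 - 2 * e) (y1 + 2 * e) z - m (x1 + 2 * e) (y2 - 2 * e) z + m (x2 - 2 * e) (y2 - 2 * e) z" for z
  proof -
    have "(a has_real_derivative (mollifier e (x1 + 2 * e) x - mollifier e (x2 - 2 * e) x)) (at x)"
      "(b has_real_derivative (mollifier e (y1 + 2 * e) x - mollifier e (y2 - 2 * e) x)) (at x)" for x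
      using window_has_real_derivative_mollifier[OF e(1), of "x1 + e" "x2 - e" x]
        window_has_real_derivative_mollifier[OF e(1), of "y1 + e" "y2 - e" x]
      by (simp_all add: a_def b_def algebra_simps)
    note d = this
    from d(2) have d2: "\<And>x. (b has_real_derivative (\<lambda>x. mollifier e (y1 + 2 * e) x - mollifier e (y2 - 2 * e) x) x) (at x)" by simp
    have "smooth_on UNIV (\<lambda>x. mollifier e (y1 + 2 * e) x - mollifier e (y2 - 2 * e) x)"
      by (intro smooth_on_diff smooth_on_mollifier) auto
    then have d3: "((\<lambda>x. mollifier e (y1 + 2 * e) x - mollifier e (y2 - 2 * e) x) has_real_derivative
      partial_deriv 1 (\<lambda>x. mollifier e (y1 + 2 * e) x - mollifier e (y2 - 2 * e) x) x) (at x)" for x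
      by (intro has_real_derivative_partial_deriv smooth_on_differentiable[of UNIV]) auto
    show ?thesis
      unfolding partial_derivs_Cons partial_derivs_Nil partial_deriv_tensor(2)[OF d(1) d2] partial_deriv_tensor(1)[OF d(1) d3]
      by (simp add: m_def tensor_def algebra_simps)
  qed
  have i: "integrable (lebesgue_on \<Omega>) (\<lambda>z. v z * m c d z)"
    if "c \<in> {x1 + 2 * e, x2 - 2 * e}" "d \<in> {y1 + 2 * e, y2 - 2 * e}" for c d
    using integrable_locally_integrable_times_test[OF \<open>open \<Omega>\<close> li(1)
        m_test[OF that, of "if c = x1 + 2 * e then x1 else x2" "if d = y1 + 2 * e then y1 else y2"]] that e(1) by auto
  have "(LINT z|lebesgue_on \<Omega>. g z * tensor a b z) = (LINT z|lebesgue_on \<Omega>. v z * partial_derivs [(1, 0), (0, 1)] (tensor a b) z)"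
    using assms(2) ab_test unfolding has_weak_deriv_def by simp
  also have "\<dots> = (LINT z|lebesgue_on \<Omega>. v z * m (x1 + 2 * e) (y1 + 2 * e) z - v z * m (x2 - 2 * e) (y1 + 2 * e) z
      - v z * m (x1 + 2 * e) (y2 - 2 * e) z + v z * m (x2 - 2 * e) (y2 - 2 * e) z)"
    unfolding dab by (simp add: algebra_simps)
  also have "\<dots> = (LINT z|lebesgue_on \<Omega>. v z * m (x1 + 2 * e) (y1 + 2 * e) z) - (LINT z|lebesgue_on \<Omega>. v z * m (x2 - 2 * e) (y1 + 2 * e) z)
      - (LINT z|lebesgue_on \<Omega>. v z * m (x1 + 2 * e) (y2 - 2 * e) z) + (LINT z|lebesgue_on \<Omega>. v z * m (x2 - 2 * e) (y2 - 2 * e) z)"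
    using i by simp
  finally have eq: "(LINT z|lebesgue_on \<Omega>. g z * tensor a b z) = \<dots>" .
  have "\<bar>LINT z|lebesgue_on \<Omega>. g z * tensor a b z\<bar> \<le> (t * (LINT z|lebesgue_on \<Omega>. (g z)\<^sup>2) + 1\<^sup>2 * ((x2 - x1) * (y2 - y1)) / t) / 2"
  proof (rule L2_pairing_bound[OF \<open>open \<Omega>\<close> assms(3) ab_test \<open>t > 0\<close>])
    show "\<bar>tensor a b z\<bar> \<le> 1" for z
      unfolding tensor_def a_def b_def abs_mult using mult_mono[OF window_abs_le window_abs_le] by fastforce
    show "tensor a b z = 0" if "z \<notin> {x1..x2} \<times> {y1..y2}" for z
    proof -
      have "fst z \<le> x1 + e \<or> x2 - e \<le> fst z \<or> snd z \<le> y1 + e \<or> y2 - e \<le> snd z"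
        using that e by (cases z) auto
      then show ?thesis unfolding tensor_def a_def b_def using e by (auto simp: window_eq_0)
    qed
  qed (use assms measure_lebesgue_rectangle in auto)
  then have B: "\<bar>LINT z|lebesgue_on \<Omega>. g z * tensor a b z\<bar> \<le> ?B" by simp
  have "\<bar>(LINT z|lebesgue_on \<Omega>. v z * m (x1 + 2 * e) (y1 + 2 * e) z) - v (x1, y1)\<bar> \<le> \<eta>"
    "\<bar>(LINT z|lebesgue_on \<Omega>. v z * m (x2 - 2 * e) (y1 + 2 * e) z) - v (x2, y1)\<bar> \<le> \<eta>"
    "\<bar>(LINT z|lebesgue_on \<Omega>. v z * m (x1 + 2 * e) (y2 - 2 * e) z) - v (x1, y2)\<bar> \<le> \<eta>"
    "\<bar>(LINT z|lebesgue_on \<Omega>. v z * m (x2 - 2 * e) (y2 - 2 * e) z) - v (x2, y2)\<bar> \<le> \<eta>"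
    by (rule m_close; use e in simp)+
  then show "?D \<le> ?B + r" using B unfolding eq \<eta>_def by linarith
qed

text \<open>The flag of \<open>dtensor\<close> selects which coordinate carries the second difference, so that both
  coordinate directions are covered by one argument.\<close>

definition coord1 :: "bool \<Rightarrow> real \<times> real \<Rightarrow> real" where "coord1 s z = (if s then snd z else fst z)"
definition coord2 :: "bool \<Rightarrow> real \<times> real \<Rightarrow> real" where "coord2 s z = (if s then fst z else snd z)"
definition dirvec :: "bool \<Rightarrow> real \<times> real" where "dirvec s = (if s then (0, 1) else (1, 0))"
definition dtensor :: "bool \<Rightarrow> (real \<Rightarrow> real) \<Rightarrow> (real \<Rightarrow> real) \<Rightarrow> real \<times> real \<Rightarrow> real" where
  "dtensor s a b = (if s then tensor b a else tensor a b)"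

lemma dtensor_apply: "dtensor s a b z = a (coord1 s z) * b (coord2 s z)"
  by (simp add: dtensor_def tensor_def coord1_def coord2_def)

lemma test_functions_dtensor:
  assumes "smooth_on UNIV a" "smooth_on UNIV b" "\<And>x. x \<notin> {a1..a2} \<Longrightarrow> a x = 0" "\<And>y. y \<notin> {b1..b2} \<Longrightarrow> b y = 0"
    and "\<And>z. coord1 s z \<in> {a1..a2} \<Longrightarrow> coord2 s z \<in> {b1..b2} \<Longrightarrow> z \<in> \<Omega>"
  shows "dtensor s a b \<in> test_functions \<Omega>"
proof (cases s)
  case True
  then have "{b1..b2} \<times> {a1..a2} \<subseteq> \<Omega>" using assms(5) by (auto simp: coord1_def coord2_def)
  from test_functions_tensor[OF assms(2,1,4,3) this] True show ?thesis by (simp add: dtensor_def)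
next
  case False
  then have "{a1..a2} \<times> {b1..b2} \<subseteq> \<Omega>" using assms(5) by (auto simp: coord1_def coord2_def)
  from test_functions_tensor[OF assms(1-4) this] False show ?thesis by (simp add: dtensor_def)
qed

lemma partial_deriv_dtensor:
  assumes "\<And>x. (a has_real_derivative a' x) (at x)" "smooth_on UNIV b"
  shows "partial_deriv (dirvec s) (dtensor s a b) = dtensor s a' b"
proof -
  have "(b has_real_derivative partial_deriv 1 b x) (at x)" for x
    using assms(2) by (intro has_real_derivative_partial_deriv smooth_on_differentiable[of UNIV]) auto
  then show ?thesis
    using partial_deriv_tensor(1)[OF assms(1), of b "partial_deriv 1 b"]
      partial_deriv_tensor(2)[OF _ assms(1), of b "partial_deriv 1 b"] by (auto simp: dirvec_def dtensor_def)
qed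

lemma lborel_integral_dtensor:
  assumes "integrable lborel a" "integrable lborel b"
  shows "(LINT z|lborel. dtensor s a b z) = (LINT x|lborel. a x) * (LINT y|lborel. b y)"
  using lborel_integral_tensor(2) assms by (auto simp: dtensor_def mult.commute)

lemma bump_bounded: obtains B where "B \<ge> 0" "\<And>x. bump x \<le> B"
proof -
  obtain B where "B \<ge> 0" "\<And>x. \<bar>bump x\<bar> \<le> B"
    by (rule continuous_compact_support_bounded[of "{-1..1}" bump]) (auto intro: continuous_on_bump bump_zero)
  then show ?thesis using that[of B] by (meson abs_le_D1)
qed

definition bump_max :: real where "bump_max = (SOME B. B \<ge> 0 \<and> (\<forall>x. bump x \<le> B))"

lemma bump_max: "bump_max \<ge> 0" "bump x \<le> bump_max"
proof -
  have "\<exists>B. B \<ge> 0 \<and> (\<forall>x. bump x \<le> B)" using bump_bounded by metis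
  from someI_ex[OF this] show "bump_max \<ge> 0" "bump x \<le> bump_max"
    unfolding bump_max_def by auto
qed

text \<open>A smoothed tent over [x0 - h, x0 + h]. Its second derivative is a second difference of
  mollifiers, so testing with it produces the second difference of a function.\<close>

definition second_diff_kernel :: "real \<Rightarrow> real \<Rightarrow> real \<Rightarrow> real \<Rightarrow> real" where
  "second_diff_kernel e x0 h x =
     e * (ramp ((x - (x0 - h)) / e) - 2 * ramp ((x - x0) / e) + ramp ((x - (x0 + h)) / e))"

lemma smooth_on_second_diff_kernel: "smooth_on UNIV (second_diff_kernel e x0 h)"
proof -
  have r: "smooth_on UNIV (\<lambda>x. ramp ((x - c) / e))" for c
    using smooth_on_affine_compose[OF smooth_on_ramp, of "1/e" "- c / e"] by (simp add: diff_divide_distrib)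
  show ?thesis unfolding second_diff_kernel_def[abs_def]
    by (intro smooth_on_mult smooth_on_add smooth_on_diff smooth_on_const r open_UNIV)
qed

lemma second_diff_kernel_has_real_derivative:
  assumes "e > 0"
  shows "(second_diff_kernel e x0 h has_real_derivative
    (step ((x - (x0 - h)) / e) - 2 * step ((x - x0) / e) + step ((x - (x0 + h)) / e))) (at x)"
    and "((\<lambda>x. step ((x - (x0 - h)) / e) - 2 * step ((x - x0) / e) + step ((x - (x0 + h)) / e)) has_real_derivative
    (mollifier e (x0 - h) x - 2 * mollifier e x0 x + mollifier e (x0 + h) x)) (at x)"
  unfolding second_diff_kernel_def[abs_def] mollifier_def using assms
  by (auto intro!: derivative_eq_intros DERIV_chain2[OF ramp_has_real_derivative] DERIV_chain2[OF step_has_real_derivative]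
      simp: field_simps)

text \<open>To the left all three ramps vanish; to the right all three are affine with the same
  slope, and the second difference of an affine function is zero.\<close>

lemma second_diff_kernel_eq_0:
  assumes "e > 0" "e \<le> h" "h + e \<le> \<bar>x - x0\<bar>"
  shows "second_diff_kernel e x0 h x = 0"
proof (cases "x \<le> x0")
  case True
  then have "(x - (x0 - h)) / e \<le> -1" "(x - x0) / e \<le> -1" "(x - (x0 + h)) / e \<le> -1"
    using assms by (auto simp: divide_simps)
  then show ?thesis by (simp add: second_diff_kernel_def ramp_eq_0)
next
  case False
  then have "(x - (x0 - h)) / e \<ge> 1" "(x - x0) / e \<ge> 1" "(x - (x0 + h)) / e \<ge> 1"
    using assms by (auto simp: divide_simps)
  then show ?thesis using assms(1)
    by (subst second_diff_kernel_def, subst (1 2 3) ramp_eq) (auto simp: field_simps)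
qed

lemma second_diff_kernel_bound:
  assumes "e > 0" "e \<le> h"
  shows "\<bar>second_diff_kernel e x0 h x\<bar> \<le> 6 * h"
proof (cases "\<bar>x - x0\<bar> \<le> h + e")
  case False
  then show ?thesis using second_diff_kernel_eq_0[OF assms, of x x0] assms by simp
next
  case True
  have r: "0 \<le> e * ramp (y / e)" "e * ramp (y / e) \<le> max 0 (y + e)" for y
  proof -
    show "0 \<le> e * ramp (y / e)" using assms ramp_nonneg by simp
    show "e * ramp (y / e) \<le> max 0 (y + e)"
    proof (cases "y / e \<ge> -1")
      case True
      then have "e * ramp (y / e) \<le> e * (y / e + 1)" using assms by (intro mult_left_mono ramp_le) auto
      also have "\<dots> = y + e" using assms by (simp add: distrib_left)
      finally show ?thesis by simp
    next
      case False then show ?thesis using ramp_eq_0[of "y / e"] by simp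
    qed
  qed
  \<comment> \<open>With |x - x0| <= h + e and e <= h the three ramps are at most 4 h, 3 h and 2 h;
    with coefficients 1, -2, 1 both signs give 6 h.\<close>
  have "e * ramp ((x - (x0 - h)) / e) \<le> 4 * h" "e * ramp ((x - x0) / e) \<le> 3 * h" "e * ramp ((x - (x0 + h)) / e) \<le> 2 * h"
    using r(2)[of "x - (x0 - h)"] r(2)[of "x - x0"] r(2)[of "x - (x0 + h)"] True assms by auto
  moreover have "second_diff_kernel e x0 h x = e * ramp ((x - (x0 - h)) / e) - 2 * (e * ramp ((x - x0) / e)) + e * ramp ((x - (x0 + h)) / e)"
    by (simp add: second_diff_kernel_def algebra_simps)
  ultimately show ?thesis
    using r(1)[of "x - (x0 - h)"] r(1)[of "x - x0"] r(1)[of "x - (x0 + h)"] unfolding abs_le_iff by linarith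
qed

text \<open>\<open>v\<close> is tested with a smoothed tent along the first coordinate times a
  mollifier across the strip. Averaging across the strip turns the \<open>\<gamma>\<close> part into
  one constant, which cancels from the second difference; the error \<open>E\<close> enters with
  weights 1, 2, 1. The test function is at most 6 h times \<open>bump_max / (k / 4)\<close> and
  lives on a rectangle of area 4 h k. The strip is open on both long sides, so the line on which
  \<open>f\<close> is evaluated may touch the boundary of the domain.\<close>

lemma pure_difference_bound:
  assumes "open \<Omega>" "has_weak_deriv \<Omega> [dirvec s, dirvec s] v g" "g \<in> L2 \<Omega>" "h > 0" "k > 0" "t > 0"
    and sub: "\<And>z. \<bar>coord1 s z - x0\<bar> \<le> 2 * h \<Longrightarrow> y0 < coord2 s z \<Longrightarrow> coord2 s z < y0 + k \<Longrightarrow> z \<in> \<Omega>"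
    and close: "\<And>z. \<bar>coord1 s z - x0\<bar> \<le> 2 * h \<Longrightarrow> y0 < coord2 s z \<Longrightarrow> coord2 s z < y0 + k \<Longrightarrow>
       \<bar>v z - f (coord1 s z) - \<gamma> (coord2 s z)\<bar> \<le> E"
    and f: "continuous_on UNIV f" and \<gamma>: "continuous_on UNIV \<gamma>"
  shows "\<bar>f (x0 - h) - 2 * f x0 + f (x0 + h)\<bar>
    \<le> 4 * E + (t * (LINT z|lebesgue_on \<Omega>. (g z)\<^sup>2) + (24 * bump_max * h / k)\<^sup>2 * (4 * h * k) / t) / 2" (is "?D \<le> 4 * E + ?B")
proof (rule field_le_epsilon)
  fix r :: real assume "r > 0"
  define \<eta> where "\<eta> = r / 4"
  have "\<eta> > 0" using \<open>r > 0\<close> by (simp add: \<eta>_def)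
  have li: "locally_integrable \<Omega> v" "locally_integrable \<Omega> g" using assms(2) by (auto simp: has_weak_deriv_def)
  have "\<exists>d>0. \<forall>x. \<bar>x - c\<bar> < d \<longrightarrow> \<bar>f x - f c\<bar> < \<eta>" for c
    using f \<open>\<eta> > 0\<close> unfolding continuous_on_iff dist_real_def by blast
  then obtain d where d: "\<And>c. d c > 0" "\<And>c x. \<bar>x - c\<bar> < d c \<Longrightarrow> \<bar>f x - f c\<bar> < \<eta>" by metis
  define e where "e = Min {h, d (x0 - h), d x0, d (x0 + h)}"
  have e: "e > 0" "e \<le> h" "\<And>c. c \<in> {x0 - h, x0, x0 + h} \<Longrightarrow> e \<le> d c"
    using d(1) assms(4) by (auto simp: e_def)
  \<comment> \<open>Centred in the strip with radius k/4, so the support stays in its middle half,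
    away from the boundary.\<close>
  define \<beta> where "\<beta> = mollifier (k / 4) (y0 + k / 2)"
  define \<Psi> where "\<Psi> c = dtensor s (mollifier e c) \<beta>" for c
  have \<beta>0: "\<beta> y = 0" if "y \<notin> {y0 + k / 4..y0 + 3 * k / 4}" for y
    unfolding \<beta>_def using that assms(5) by (intro mollifier_eq_0) (auto simp: abs_if)
  have \<beta>nn: "\<beta> y \<ge> 0" for y unfolding \<beta>_def using assms(5) by (simp add: mollifier_nonneg)
  have \<beta>i: "integrable lborel \<beta>" "(LINT y|lborel. \<beta> y) = 1"
    unfolding \<beta>_def using assms(5) by (auto intro: mollifier_integral)
  have \<beta>c: "continuous_on S \<beta>" for S
    unfolding \<beta>_def using smooth_on_continuous_on[OF smooth_on_mollifier] continuous_on_subset by blast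
  have \<gamma>\<beta>: "integrable lborel (\<lambda>y. \<gamma> y * \<beta> y)"
  proof -
    have "(\<lambda>y. \<gamma> y * \<beta> y) = (\<lambda>y. indicator {y0..y0 + k} y *\<^sub>R (\<gamma> y * \<beta> y))"
    proof
      show "\<gamma> y * \<beta> y = indicator {y0..y0 + k} y *\<^sub>R (\<gamma> y * \<beta> y)" for y
        using \<beta>0[of y] assms(5) by (cases "y \<in> {y0..y0 + k}") auto
    qed
    moreover have "integrable lborel (\<lambda>y. indicator {y0..y0 + k} y *\<^sub>R (\<gamma> y * \<beta> y))"
      using \<gamma> \<beta>c by (intro borel_integrable_compact continuous_on_mult compact_Icc) (auto intro: continuous_on_subset)
    ultimately show ?thesis by simp
  qed
  define J where "J = (LINT y|lborel. \<gamma> y * \<beta> y)"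
  have \<Psi>_close: "\<Psi> c \<in> test_functions \<Omega> \<and> \<bar>(LINT z|lebesgue_on \<Omega>. v z * \<Psi> c z) - (f c + J)\<bar> \<le> E + \<eta>"
    if c: "c \<in> {x0 - h, x0, x0 + h}" for c
  proof (rule conjI)
    show t: "\<Psi> c \<in> test_functions \<Omega>" unfolding \<Psi>_def
    proof (rule test_functions_dtensor[OF smooth_on_mollifier _ _ \<beta>0])
      show "smooth_on UNIV \<beta>" unfolding \<beta>_def by (rule smooth_on_mollifier)
      show "mollifier e c x = 0" if "x \<notin> {c - e..c + e}" for x
        using that e(1) by (intro mollifier_eq_0) auto
      show "z \<in> \<Omega>" if "coord1 s z \<in> {c - e..c + e}" "coord2 s z \<in> {y0 + k / 4..y0 + 3 * k / 4}" for z
        using that c e(1,2) assms(5) by (intro sub) auto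
    qed
    have "\<bar>(LINT z|lebesgue_on \<Omega>. v z * \<Psi> c z) - (LINT z|lebesgue_on \<Omega>. (f c + \<gamma> (coord2 s z)) * \<Psi> c z)\<bar> \<le> E + \<eta>"
    proof (rule integral_test_close[OF \<open>open \<Omega>\<close> t])
      show "\<Psi> c z \<ge> 0" for z unfolding \<Psi>_def dtensor_apply using e \<beta>nn by (simp add: mollifier_nonneg)
      show "(LINT z|lborel. \<Psi> c z) = 1"
        unfolding \<Psi>_def using lborel_integral_dtensor[OF mollifier_integral(1) \<beta>i(1)] mollifier_integral(2) \<beta>i(2) e(1) by simp
      show "locally_integrable \<Omega> (\<lambda>z. f c + \<gamma> (coord2 s z))"
        unfolding coord2_def
        by (intro locally_integrable_continuous continuous_on_add continuous_on_const continuous_on_compose2[OF \<gamma>])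
          (cases s; auto intro!: continuous_intros)+
      fix z assume "\<Psi> c z \<noteq> 0"
      then have z: "\<bar>coord1 s z - c\<bar> < e" "coord2 s z \<in> {y0 + k / 4..y0 + 3 * k / 4}"
        using mollifier_eq_0[OF e(1)] \<beta>0 by (auto simp: \<Psi>_def dtensor_apply not_le[symmetric])
      have "\<bar>v z - f (coord1 s z) - \<gamma> (coord2 s z)\<bar> \<le> E"
        using z c e(1,2) assms(5) by (intro close) auto
      moreover have "\<bar>f (coord1 s z) - f c\<bar> < \<eta>" using d(2) z(1) e(3)[OF c] by fastforce
      ultimately show "\<bar>v z - (f c + \<gamma> (coord2 s z))\<bar> \<le> E + \<eta>" by linarith
    qed (rule li(1))
    moreover have "(LINT z|lebesgue_on \<Omega>. (f c + \<gamma> (coord2 s z)) * \<Psi> c z) = f c + J"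
    proof -
      have eq: "(f c + \<gamma> (coord2 s z)) * \<Psi> c z = f c * \<Psi> c z + dtensor s (mollifier e c) (\<lambda>y. \<gamma> y * \<beta> y) z" for z
        by (simp add: \<Psi>_def dtensor_apply algebra_simps)
      have i: "integrable (lebesgue_on \<Omega>) (\<lambda>z. (f c + \<gamma> (coord2 s z)) * \<Psi> c z)" "integrable (lebesgue_on \<Omega>) (\<lambda>z. f c * \<Psi> c z)"
      proof -
        show "integrable (lebesgue_on \<Omega>) (\<lambda>z. (f c + \<gamma> (coord2 s z)) * \<Psi> c z)"
          unfolding coord2_def
          by (intro integrable_locally_integrable_times_test[OF \<open>open \<Omega>\<close> _ t] locally_integrable_continuous continuous_on_add continuous_on_const continuous_on_compose2[OF \<gamma>])
            (cases s; auto intro!: continuous_intros)+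
        show "integrable (lebesgue_on \<Omega>) (\<lambda>z. f c * \<Psi> c z)"
          by (intro integrable_locally_integrable_times_test[OF \<open>open \<Omega>\<close> _ t] locally_integrable_continuous continuous_on_const)
      qed
      have m: "integrable lborel (dtensor s (mollifier e c) (\<lambda>y. \<gamma> y * \<beta> y))"
        unfolding dtensor_def using lborel_integral_tensor(1)[OF mollifier_integral(1)[OF e(1)] \<gamma>\<beta>]
          lborel_integral_tensor(1)[OF \<gamma>\<beta> mollifier_integral(1)[OF e(1)]] by auto
      have "dtensor s (mollifier e c) (\<lambda>y. \<gamma> y * \<beta> y) z = 0" if "z \<notin> \<Omega>" for z
        using test_functions_zero_outside[OF t that] by (auto simp: \<Psi>_def dtensor_apply)
      then have "(LINT z|lebesgue_on \<Omega>. dtensor s (mollifier e c) (\<lambda>y. \<gamma> y * \<beta> y) z) = (LINT z|lborel. dtensor s (mollifier e c) (\<lambda>y. \<gamma> y * \<beta> y) z)"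
        using borel_measurable_integrable[OF m] by (intro integral_lebesgue_on_eq_lborel[OF \<open>open \<Omega>\<close>]) auto
      also have "\<dots> = J"
        using lborel_integral_dtensor[OF mollifier_integral(1)[OF e(1)] \<gamma>\<beta>] mollifier_integral(2)[OF e(1)] by (simp add: J_def)
      finally have "(LINT z|lebesgue_on \<Omega>. (f c + \<gamma> (coord2 s z)) * \<Psi> c z - f c * \<Psi> c z) = J" by (simp add: eq)
      moreover have "(LINT z|lebesgue_on \<Omega>. f c * \<Psi> c z) = f c"
        using integral_lebesgue_on_test[OF \<open>open \<Omega>\<close> t] lborel_integral_dtensor[OF mollifier_integral(1)[OF e(1)] \<beta>i(1)]
          mollifier_integral(2)[OF e(1)] \<beta>i(2) by (simp add: \<Psi>_def)
      ultimately show ?thesis using Bochner_Integration.integral_diff[OF i] by linarith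
    qed
    ultimately show "\<bar>(LINT z|lebesgue_on \<Omega>. v z * \<Psi> c z) - (f c + J)\<bar> \<le> E + \<eta>" by (simp only:)
  qed
  define \<phi> where "\<phi> = dtensor s (second_diff_kernel e x0 h) \<beta>"
  have \<phi>_test: "\<phi> \<in> test_functions \<Omega>" unfolding \<phi>_def
  proof (rule test_functions_dtensor[OF smooth_on_second_diff_kernel _ _ \<beta>0])
    show "smooth_on UNIV \<beta>" unfolding \<beta>_def by (rule smooth_on_mollifier)
    show "second_diff_kernel e x0 h x = 0" if "x \<notin> {x0 - 2 * h..x0 + 2 * h}" for x
      using that e(1,2) by (intro second_diff_kernel_eq_0) auto
    show "z \<in> \<Omega>" if "coord1 s z \<in> {x0 - 2 * h..x0 + 2 * h}" "coord2 s z \<in> {y0 + k / 4..y0 + 3 * k / 4}" for z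
      using that assms(5) by (intro sub) auto
  qed
  have d\<phi>: "partial_derivs [dirvec s, dirvec s] \<phi> z = \<Psi> (x0 - h) z - 2 * \<Psi> x0 z + \<Psi> (x0 + h) z" for z
  proof -
    have sm: "smooth_on UNIV \<beta>" unfolding \<beta>_def by (rule smooth_on_mollifier)
    show ?thesis
      unfolding \<phi>_def partial_derivs_Cons partial_derivs_Nil
        partial_deriv_dtensor[OF second_diff_kernel_has_real_derivative(1)[OF e(1)] sm]
        partial_deriv_dtensor[OF second_diff_kernel_has_real_derivative(2)[OF e(1)] sm]
      by (simp add: \<Psi>_def dtensor_apply algebra_simps)
  qed
  have i: "integrable (lebesgue_on \<Omega>) (\<lambda>z. v z * \<Psi> c z)" if "c \<in> {x0 - h, x0, x0 + h}" for c
    using integrable_locally_integrable_times_test[OF \<open>open \<Omega>\<close> li(1)] \<Psi>_close[OF that] by blast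
  have "(LINT z|lebesgue_on \<Omega>. g z * \<phi> z) = (LINT z|lebesgue_on \<Omega>. v z * partial_derivs [dirvec s, dirvec s] \<phi> z)"
    using assms(2) \<phi>_test unfolding has_weak_deriv_def by simp
  also have "\<dots> = (LINT z|lebesgue_on \<Omega>. v z * \<Psi> (x0 - h) z - 2 * (v z * \<Psi> x0 z) + v z * \<Psi> (x0 + h) z)"
    unfolding d\<phi> by (simp add: algebra_simps)
  also have "\<dots> = (LINT z|lebesgue_on \<Omega>. v z * \<Psi> (x0 - h) z) - 2 * (LINT z|lebesgue_on \<Omega>. v z * \<Psi> x0 z)
      + (LINT z|lebesgue_on \<Omega>. v z * \<Psi> (x0 + h) z)"
    using i by simp
  finally have eq: "(LINT z|lebesgue_on \<Omega>. g z * \<phi> z) = \<dots>" .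
  have "\<bar>LINT z|lebesgue_on \<Omega>. g z * \<phi> z\<bar> \<le> ?B"
  proof (rule L2_pairing_bound[OF \<open>open \<Omega>\<close> assms(3) \<phi>_test \<open>t > 0\<close>])
    show "\<bar>\<phi> z\<bar> \<le> 24 * bump_max * h / k" for z
    proof -
      have "\<bar>\<phi> z\<bar> \<le> 6 * h * (bump_max / (k / 4))"
        unfolding \<phi>_def dtensor_apply abs_mult
      proof (rule mult_mono[OF second_diff_kernel_bound[OF e(1,2)]])
        show "\<bar>\<beta> (coord2 s z)\<bar> \<le> bump_max / (k / 4)"
          unfolding abs_of_nonneg[OF \<beta>nn] using assms(5) unfolding \<beta>_def mollifier_def by (intro divide_right_mono bump_max) auto
      qed (use assms(4) in auto)
      then show ?thesis by (simp add: field_simps)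
    qed
    define S where "S = (if s then {y0..y0 + k} \<times> {x0 - 2 * h..x0 + 2 * h} else {x0 - 2 * h..x0 + 2 * h} \<times> {y0..y0 + k})"
    show "\<phi> z = 0" if "z \<notin> S" for z
    proof -
      have "coord1 s z \<notin> {x0 - 2 * h..x0 + 2 * h} \<or> coord2 s z \<notin> {y0..y0 + k}"
        using that by (cases z) (auto simp: S_def coord1_def coord2_def split: if_splits)
      then show ?thesis unfolding \<phi>_def dtensor_apply
      proof
        assume "coord1 s z \<notin> {x0 - 2 * h..x0 + 2 * h}"
        then have "second_diff_kernel e x0 h (coord1 s z) = 0" using e(1,2) by (intro second_diff_kernel_eq_0) auto
        then show "second_diff_kernel e x0 h (coord1 s z) * \<beta> (coord2 s z) = 0" by simp
      next
        assume "coord2 s z \<notin> {y0..y0 + k}"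
        then have "\<beta> (coord2 s z) = 0" using assms(5) by (intro \<beta>0) auto
        then show "second_diff_kernel e x0 h (coord1 s z) * \<beta> (coord2 s z) = 0" by simp
      qed
    qed
    show "S \<in> lmeasurable" unfolding S_def by (simp add: measure_lebesgue_rectangle)
    show "measure lebesgue S \<le> 4 * h * k" unfolding S_def using assms(4,5) by (simp add: measure_lebesgue_rectangle)
  qed
  moreover have "\<bar>(LINT z|lebesgue_on \<Omega>. v z * \<Psi> (x0 - h) z) - (f (x0 - h) + J)\<bar> \<le> E + \<eta>"
    "\<bar>(LINT z|lebesgue_on \<Omega>. v z * \<Psi> x0 z) - (f x0 + J)\<bar> \<le> E + \<eta>"
    "\<bar>(LINT z|lebesgue_on \<Omega>. v z * \<Psi> (x0 + h) z) - (f (x0 + h) + J)\<bar> \<le> E + \<eta>"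
    using \<Psi>_close by auto
  ultimately show "?D \<le> 4 * E + ?B + r" unfolding eq \<eta>_def by linarith
qed


subsection \<open>Linear decay at the re-entrant corner\<close>

lemma closed_rectangle_subset_closure:
  fixes x1 x2 y1 y2 :: real
  assumes "x1 < x2" "y1 < y2" "{x1<..<x2} \<times> {y1<..<y2} \<subseteq> \<Omega>"
  shows "{x1..x2} \<times> {y1..y2} \<subseteq> closure \<Omega>"
proof -
  have "closure ({x1<..<x2} \<times> {y1<..<y2}) = {x1..x2} \<times> {y1..y2}"
    using assms by (simp add: closure_Times)
  then show ?thesis using closure_mono[OF assms(3)] by simp
qed

text \<open>On \<open>L_domain\<close> a function that vanishes on the boundary is, up to the mixed differences,
  the sum of its traces on the two half axes inside the domain.  The second differences of these
  traces across the origin are controlled as well, and the traces vanish beyond the origin.\<close>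

lemma L_domain_corner_bound:
  assumes cont: "continuous_on (closure L_domain) v" and H2: "v \<in> sobolev_H 2 L_domain"
    and zero: "\<And>z. z \<in> frontier L_domain \<Longrightarrow> v z = 0"
  obtains C where "C \<ge> 0"
    "\<And>z \<delta>. z \<in> L_domain \<Longrightarrow> \<delta> \<le> 1/4 \<Longrightarrow> \<bar>fst z\<bar> \<le> \<delta> \<Longrightarrow> \<bar>snd z\<bar> \<le> \<delta> \<Longrightarrow> \<bar>v z\<bar> \<le> C * \<delta>"
proof -
  have "\<exists>g\<in>L2 L_domain. has_weak_deriv L_domain bs v g" if "bs \<in> lists Basis" "length bs \<le> 2" for bs
    using H2 that unfolding sobolev_H_def by blast
  from this[of "[(1, 0), (0, 1)]"] this[of "[dirvec False, dirvec False]"] this[of "[dirvec True, dirvec True]"]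
  obtain g12 g11 g22 where g: "g12 \<in> L2 L_domain" "has_weak_deriv L_domain [(1, 0), (0, 1)] v g12"
    "g11 \<in> L2 L_domain" "has_weak_deriv L_domain [dirvec False, dirvec False] v g11"
    "g22 \<in> L2 L_domain" "has_weak_deriv L_domain [dirvec True, dirvec True] v g22"
    by (auto simp: Basis_prod_def dirvec_def)
  define G where "G = Max {LINT z|lebesgue_on L_domain. (g12 z)\<^sup>2, LINT z|lebesgue_on L_domain. (g11 z)\<^sup>2, LINT z|lebesgue_on L_domain. (g22 z)\<^sup>2}"
  have G: "(LINT z|lebesgue_on L_domain. (g12 z)\<^sup>2) \<le> G" "(LINT z|lebesgue_on L_domain. (g11 z)\<^sup>2) \<le> G"
    "(LINT z|lebesgue_on L_domain. (g22 z)\<^sup>2) \<le> G"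
    by (auto simp: G_def)
  have "0 \<le> (LINT z|lebesgue_on L_domain. (g12 z)\<^sup>2)" by (rule integral_nonneg_AE) auto
  then have "G \<ge> 0" using G(1) by linarith
  \<comment> \<open>Clamping extends both traces to continuous functions on the line. The corner
    value 0 is taken beyond the origin, and 1/2 suffices as outer limit because only arguments up to
    \<open>2 * \<delta>\<close> with \<open>\<delta> \<le> 1/4\<close> occur.\<close>
  define f where "f x = v (max (- 1 / 2) (min x 0), 0)" for x
  define \<gamma> where "\<gamma> y = v (0, max 0 (min y (1 / 2)))" for y
  have axes: "(x, 0) \<in> closure L_domain" if "-1/2 \<le> x" "x \<le> 0" for x
  proof (cases "x = 0")
    case True
    then show ?thesis using L_domain_frontier_axes(1)[of 0] by (simp add: frontier_def)
  next
    case False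
    then have "(x, 0) \<in> L_domain" using that by (auto simp: L_domain_def)
    then show ?thesis using closure_subset by blast
  qed
  have axes': "(0, y) \<in> closure L_domain" if "0 \<le> y" "y \<le> 1/2" for y
  proof (cases "y = 0")
    case True
    then show ?thesis using axes[of 0] by simp
  next
    case False
    then have "(0, y) \<in> L_domain" using that by (auto simp: L_domain_def)
    then show ?thesis using closure_subset by blast
  qed
  have f: "continuous_on UNIV f" unfolding f_def
  proof (rule continuous_on_compose2[OF cont])
    show "continuous_on UNIV (\<lambda>x::real. (max (- 1 / 2) (min x 0), 0::real))" by (intro continuous_intros)
  qed (auto intro!: axes simp: min_def max_def)
  have \<gamma>: "continuous_on UNIV \<gamma>" unfolding \<gamma>_def
  proof (rule continuous_on_compose2[OF cont])
    show "continuous_on UNIV (\<lambda>y::real. (0::real, max 0 (min y (1 / 2))))" by (intro continuous_intros)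
  qed (auto intro!: axes' simp: min_def max_def)
  have v0: "v (0, 0) = 0" using zero L_domain_frontier_axes(1)[of 0] by simp
  have f0: "f x = 0" if "x \<ge> 0" for x using that v0 by (simp add: f_def min_def)
  have \<gamma>0: "\<gamma> y = 0" if "y \<le> 0" for y using that v0 by (simp add: \<gamma>_def min_def max_def)
  have fv: "f x = v (x, 0)" if "-1/2 \<le> x" "x \<le> 0" for x using that by (simp add: f_def min_def max_def)
  have \<gamma>v: "\<gamma> y = v (0, y)" if "0 \<le> y" "y \<le> 1/2" for y using that by (simp add: \<gamma>_def min_def max_def)
  \<comment> \<open>The mixed difference bound with weight \<open>\<delta>\<close> on rectangles of
    area at most 4 \<open>\<delta>\<close>^2.\<close>
  define E where "E \<delta> = \<delta> * (G + 4) / 2" for \<delta> :: real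
  have mixed: "\<bar>v (x2, y2) - v (x1, y2) - v (x2, y1) + v (x1, y1)\<bar> \<le> E \<delta>"
    if "\<delta> > 0" "x1 < x2" "y1 < y2" "x2 - x1 \<le> 2 * \<delta>" "y2 - y1 \<le> 2 * \<delta>"
      "{x1<..<x2} \<times> {y1<..<y2} \<subseteq> L_domain" for x1 x2 y1 y2 \<delta>
  proof -
    have "\<bar>v (x2, y2) - v (x1, y2) - v (x2, y1) + v (x1, y1)\<bar>
      \<le> (\<delta> * (LINT z|lebesgue_on L_domain. (g12 z)\<^sup>2) + (x2 - x1) * (y2 - y1) / \<delta>) / 2"
      using that by (intro mixed_difference_bound[OF open_L_domain g(2,1)]
          continuous_on_subset[OF cont closed_rectangle_subset_closure])
    also have "(x2 - x1) * (y2 - y1) \<le> (2 * \<delta>) * (2 * \<delta>)" using that by (intro mult_mono) auto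
    then have "(\<delta> * (LINT z|lebesgue_on L_domain. (g12 z)\<^sup>2) + (x2 - x1) * (y2 - y1) / \<delta>) / 2
       \<le> (\<delta> * G + (2 * \<delta>) * (2 * \<delta>) / \<delta>) / 2"
      using G(1) that(1) by (intro divide_right_mono add_mono mult_left_mono) auto
    also have "\<dots> = E \<delta>" using that(1) by (simp add: E_def field_simps)
    finally show ?thesis .
  qed
  have E0: "E \<delta> \<ge> 0" if "\<delta> > 0" for \<delta> using that \<open>G \<ge> 0\<close> by (simp add: E_def)
  have decomp: "\<bar>v (x, y) - f x - \<gamma> y\<bar> \<le> E \<delta>"
    if "\<delta> > 0" "\<delta> \<le> 1/4" "\<bar>x\<bar> \<le> 2 * \<delta>" "\<bar>y\<bar> \<le> 2 * \<delta>" "(x, y) \<in> L_domain" for x y \<delta>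
  proof -
    have b: "-1/2 \<le> x" "x \<le> 1/2" "-1/2 \<le> y" "y \<le> 1/2" using that unfolding abs_le_iff by linarith+
    have "x < 0 \<or> y > 0" using that(5) by (auto simp: L_domain_def)
    \<comment> \<open>In each open quadrant met by the domain, the rectangle between the origin and
      (x, y) lies in the domain, and its mixed difference is v (x, y) - f x - \<gamma> y: the value
      at the origin is zero, and a corner on an edge of the domain has value zero, as has the trace
      there. On the half axes the splitting is exact.\<close>
    then consider "x > 0" "y > 0" | "x = 0" "y > 0" | "x < 0" "y > 0" | "x < 0" "y = 0" | "x < 0" "y < 0"
      by (cases x "0::real" rule: linorder_cases; cases y "0::real" rule: linorder_cases) auto
    then show ?thesis
    proof cases
      case 1
      have "{0<..<x} \<times> {0<..<y} \<subseteq> L_domain" using b by (auto simp: L_domain_def)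
      moreover have "v (x, 0) = 0" using 1 b by (intro zero L_domain_frontier_axes) auto
      ultimately show ?thesis using mixed[of \<delta> 0 x 0 y] 1 that b v0 f0[of x] \<gamma>v[of y] by (simp add: abs_le_iff)
    next
      case 2 then show ?thesis using f0[of 0] \<gamma>v[of y] E0[OF that(1)] b by simp
    next
      case 3
      have "{x<..<0} \<times> {0<..<y} \<subseteq> L_domain" using b by (auto simp: L_domain_def)
      then show ?thesis using mixed[of \<delta> x 0 0 y] 3 that b v0 fv[of x] \<gamma>v[of y] by (simp add: abs_le_iff)
    next
      case 4 then show ?thesis using \<gamma>0[of 0] fv[of x] E0[OF that(1)] b by simp
    next
      case 5
      have "{x<..<0} \<times> {y<..<0} \<subseteq> L_domain" using b by (auto simp: L_domain_def)
      moreover have "v (0, y) = 0" using zero L_domain_frontier_axes(2)[of "-y"] 5 b by auto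
      ultimately show ?thesis using mixed[of \<delta> x 0 y 0] 5 that b v0 fv[of x] \<gamma>0[of y] by (simp add: abs_le_iff)
    qed
  qed
  \<comment> \<open>The pure difference bound with h, k and t all equal to
    \<open>\<delta>\<close>.\<close>
  define C1 where "C1 = 2 * (G + 4) + (G + (24 * bump_max)\<^sup>2 * 4) / 2"
  have C1: "C1 \<ge> 0" using \<open>G \<ge> 0\<close> by (simp add: C1_def)
  have bound: "4 * E \<delta> + (\<delta> * G' + (24 * bump_max * \<delta> / \<delta>)\<^sup>2 * (4 * \<delta> * \<delta>) / \<delta>) / 2 \<le> C1 * \<delta>"
    if "\<delta> > 0" "G' \<le> G" for \<delta> G'
  proof -
    have "4 * E \<delta> + (\<delta> * G' + (24 * bump_max * \<delta> / \<delta>)\<^sup>2 * (4 * \<delta> * \<delta>) / \<delta>) / 2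
        = 2 * (\<delta> * (G + 4)) + (\<delta> * G' + (24 * bump_max)\<^sup>2 * 4 * \<delta>) / 2"
      using that(1) by (simp add: E_def)
    also have "\<dots> \<le> 2 * (\<delta> * (G + 4)) + (\<delta> * G + (24 * bump_max)\<^sup>2 * 4 * \<delta>) / 2"
      using that by (intro add_left_mono divide_right_mono add_right_mono mult_left_mono) auto
    also have "\<dots> = C1 * \<delta>" by (simp add: C1_def algebra_simps)
    finally show ?thesis .
  qed
  have f_bound: "\<bar>f (- \<delta>)\<bar> \<le> C1 * \<delta>" and \<gamma>_bound: "\<bar>\<gamma> \<delta>\<bar> \<le> C1 * \<delta>" if \<delta>: "\<delta> > 0" "\<delta> \<le> 1/4" for \<delta>
  proof -
    \<comment> \<open>The strip just above the x axis lies in the domain on both sides of the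
      origin. Since \<open>f\<close> is zero at 0 and at \<open>\<delta>\<close>, the second
      difference across the corner is the single value f (-\<delta>). The strip to the left of the y
      axis does the same for \<open>\<gamma>\<close>.\<close>
    have "\<bar>f (0 - \<delta>) - 2 * f 0 + f (0 + \<delta>)\<bar> \<le> 4 * E \<delta> + (\<delta> * (LINT z|lebesgue_on L_domain. (g11 z)\<^sup>2) + (24 * bump_max * \<delta> / \<delta>)\<^sup>2 * (4 * \<delta> * \<delta>) / \<delta>) / 2"
    proof (rule pure_difference_bound[OF open_L_domain g(4,3) \<delta>(1) \<delta>(1) \<delta>(1), where \<gamma> = \<gamma> and ?y0.0 = 0])
      fix z assume z: "\<bar>coord1 False z - 0\<bar> \<le> 2 * \<delta>" "0 < coord2 False z" "coord2 False z < 0 + \<delta>"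
      show zL: "z \<in> L_domain" using z \<delta> by (cases z) (auto simp: coord1_def coord2_def L_domain_def)
      show "\<bar>v z - f (coord1 False z) - \<gamma> (coord2 False z)\<bar> \<le> E \<delta>"
        using decomp[OF \<delta>, of "fst z" "snd z"] z zL by (simp add: coord1_def coord2_def)
    qed (rule f \<gamma>)+
    with bound[OF \<delta>(1) G(2)] f0[of 0] f0[of \<delta>] \<delta> show "\<bar>f (- \<delta>)\<bar> \<le> C1 * \<delta>" by simp
    have "\<bar>\<gamma> (0 - \<delta>) - 2 * \<gamma> 0 + \<gamma> (0 + \<delta>)\<bar> \<le> 4 * E \<delta> + (\<delta> * (LINT z|lebesgue_on L_domain. (g22 z)\<^sup>2) + (24 * bump_max * \<delta> / \<delta>)\<^sup>2 * (4 * \<delta> * \<delta>) / \<delta>) / 2"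
    proof (rule pure_difference_bound[OF open_L_domain g(6,5) \<delta>(1) \<delta>(1) \<delta>(1), where \<gamma> = f and ?y0.0 = "- \<delta>"])
      fix z assume z: "\<bar>coord1 True z - 0\<bar> \<le> 2 * \<delta>" "- \<delta> < coord2 True z" "coord2 True z < - \<delta> + \<delta>"
      show zL: "z \<in> L_domain" using z \<delta> by (cases z) (auto simp: coord1_def coord2_def L_domain_def)
      show "\<bar>v z - \<gamma> (coord1 True z) - f (coord2 True z)\<bar> \<le> E \<delta>"
        using decomp[OF \<delta>, of "fst z" "snd z"] z zL by (simp add: coord1_def coord2_def algebra_simps)
    qed (rule f \<gamma>)+
    with bound[OF \<delta>(1) G(3)] \<gamma>0[of 0] \<gamma>0[of "- \<delta>"] \<delta> show "\<bar>\<gamma> \<delta>\<bar> \<le> C1 * \<delta>" by simp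
  qed
  show ?thesis
  proof (rule that[of "(G + 4) / 2 + 2 * C1"])
    show "(G + 4) / 2 + 2 * C1 \<ge> 0" using C1 \<open>G \<ge> 0\<close> by simp
    fix z and \<delta> :: real assume z: "z \<in> L_domain" "\<delta> \<le> 1/4" "\<bar>fst z\<bar> \<le> \<delta>" "\<bar>snd z\<bar> \<le> \<delta>"
    have "z \<noteq> (0, 0)" using z(1) by (auto simp: L_domain_def)
    then have "\<delta> > 0" using z(3,4) by (cases z) auto
    have "\<bar>f (fst z)\<bar> \<le> C1 * \<delta>"
    proof (cases "fst z < 0")
      case True
      then have "\<bar>f (fst z)\<bar> \<le> C1 * (- fst z)" using f_bound[of "- fst z"] z by simp
      also have "\<dots> \<le> C1 * \<delta>" using C1 z by (intro mult_left_mono) auto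
      finally show ?thesis .
    qed (use f0 C1 \<open>\<delta> > 0\<close> in auto)
    moreover have "\<bar>\<gamma> (snd z)\<bar> \<le> C1 * \<delta>"
    proof (cases "snd z > 0")
      case True
      then have "\<bar>\<gamma> (snd z)\<bar> \<le> C1 * snd z" using \<gamma>_bound[of "snd z"] z by simp
      also have "\<dots> \<le> C1 * \<delta>" using C1 z by (intro mult_left_mono) auto
      finally show ?thesis .
    qed (use \<gamma>0 C1 \<open>\<delta> > 0\<close> in auto)
    moreover have "\<bar>v z - f (fst z) - \<gamma> (snd z)\<bar> \<le> E \<delta>"
      using decomp[OF \<open>\<delta> > 0\<close> z(2), of "fst z" "snd z"] z \<open>\<delta> > 0\<close> by simp
    ultimately have "\<bar>v z\<bar> \<le> E \<delta> + C1 * \<delta> + C1 * \<delta>" by linarith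
    then show "\<bar>v z\<bar> \<le> ((G + 4) / 2 + 2 * C1) * \<delta>" by (simp add: E_def algebra_simps)
  qed
qed


subsection \<open>The harmonic function of the sector\<close>

definition laplacian :: "(real \<times> real \<Rightarrow> real) \<Rightarrow> real \<times> real \<Rightarrow> real" where
  "laplacian f z = partial_derivs [(1, 0), (1, 0)] f z + partial_derivs [(0, 1), (0, 1)] f z"

lemma smooth_on_has_derivative:
  "smooth_on U f \<Longrightarrow> x \<in> U \<Longrightarrow> (f has_derivative (\<lambda>b. partial_deriv b f x)) (at x)"
  using smooth_on_differentiable[of U f x] by (simp add: partial_deriv_def frechet_derivative_works)

lemma partial_deriv_mult_on:
  assumes "smooth_on U f" "smooth_on U g" "x \<in> U"
  shows "partial_deriv b (\<lambda>x. f x * g x) x = f x * partial_deriv b g x + partial_deriv b f x * g x"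
  by (rule partial_deriv_eqI[OF has_derivative_mult[OF smooth_on_has_derivative[OF assms(1,3)] smooth_on_has_derivative[OF assms(2,3)]]])

lemma partial_deriv_add_on:
  assumes "smooth_on U f" "smooth_on U g" "x \<in> U"
  shows "partial_deriv b (\<lambda>x. f x + g x) x = partial_deriv b f x + partial_deriv b g x"
  by (rule partial_deriv_eqI[OF has_derivative_add[OF smooth_on_has_derivative[OF assms(1,3)] smooth_on_has_derivative[OF assms(2,3)]]])

lemma second_partial_deriv_mult:
  assumes "open U" "smooth_on U f" "smooth_on U g" "x \<in> U" "b \<in> Basis"
  shows "partial_derivs [b, b] (\<lambda>x. f x * g x) x =
    f x * partial_derivs [b, b] g x + 2 * (partial_deriv b f x * partial_deriv b g x) + partial_derivs [b, b] f x * g x"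
proof -
  note s = smooth_on_partial_deriv[OF assms(2,5)] smooth_on_partial_deriv[OF assms(3,5)]
  have "partial_deriv b (partial_deriv b (\<lambda>x. f x * g x)) x
      = partial_deriv b (\<lambda>x. f x * partial_deriv b g x + partial_deriv b f x * g x) x"
    by (rule partial_deriv_cong_open[OF assms(1,4)]) (rule partial_deriv_mult_on[OF assms(2,3)])
  also have "\<dots> = partial_deriv b (\<lambda>x. f x * partial_deriv b g x) x + partial_deriv b (\<lambda>x. partial_deriv b f x * g x) x"
    using assms s by (intro partial_deriv_add_on[OF _ _ assms(4)] smooth_on_mult)
  finally show ?thesis
    using partial_deriv_mult_on[OF assms(2) s(2) assms(4)] partial_deriv_mult_on[OF s(1) assms(3,4)]
    by (simp add: algebra_simps)
qed

lemma partial_deriv_compose: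
  assumes "(h has_real_derivative h') (at (f x))" "(f has_derivative (\<lambda>b. partial_deriv b f x)) (at x)"
  shows "partial_deriv b (\<lambda>x. h (f x)) x = h' * partial_deriv b f x"
  using diff_chain_at[OF assms(2) assms(1)[unfolded has_field_derivative_def]] partial_deriv_eqI[of "h \<circ> f"]
  by (simp add: o_def)

lemma second_partial_deriv_compose:
  fixes h h1 h2 :: "real \<Rightarrow> real"
  assumes "open U" "smooth_on U f" "x \<in> U" "b \<in> Basis" "f ` U \<subseteq> V" "smooth_on V h1"
    and "\<And>s. s \<in> V \<Longrightarrow> (h has_real_derivative h1 s) (at s)" "\<And>s. s \<in> V \<Longrightarrow> (h1 has_real_derivative h2 s) (at s)"
  shows "partial_derivs [b, b] (\<lambda>x. h (f x)) x = h2 (f x) * (partial_deriv b f x)\<^sup>2 + h1 (f x) * partial_derivs [b, b] f x"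
proof -
  have 1: "partial_deriv b (\<lambda>x. h (f x)) y = h1 (f y) * partial_deriv b f y" if "y \<in> U" for y
    using assms(5,7) that by (intro partial_deriv_compose smooth_on_has_derivative[OF assms(2)]) auto
  have "partial_deriv b (partial_deriv b (\<lambda>x. h (f x))) x = partial_deriv b (\<lambda>y. h1 (f y) * partial_deriv b f y) x"
    by (rule partial_deriv_cong_open[OF assms(1,3) 1])
  also have "\<dots> = h1 (f x) * partial_deriv b (partial_deriv b f) x + partial_deriv b (\<lambda>y. h1 (f y)) x * partial_deriv b f x"
    by (intro partial_deriv_mult_on[OF smooth_on_compose[OF assms(1,6,2,5)] smooth_on_partial_deriv[OF assms(2,4)] assms(3)])
  also have "partial_deriv b (\<lambda>y. h1 (f y)) x = h2 (f x) * partial_deriv b f x"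
    using assms(3,5,8) by (intro partial_deriv_compose smooth_on_has_derivative[OF assms(2)]) auto
  finally show ?thesis by (simp add: power2_eq_square algebra_simps)
qed

lemma Basis_real_prod: "(1, 0) \<in> (Basis :: (real \<times> real) set)" "(0, 1) \<in> (Basis :: (real \<times> real) set)"
  by (auto simp: Basis_prod_def)

lemma laplacian_mult:
  assumes "open U" "smooth_on U f" "smooth_on U g" "z \<in> U"
  shows "laplacian (\<lambda>x. f x * g x) z = f z * laplacian g z + laplacian f z * g z
    + 2 * (partial_deriv (1, 0) f z * partial_deriv (1, 0) g z + partial_deriv (0, 1) f z * partial_deriv (0, 1) g z)"
  unfolding laplacian_def second_partial_deriv_mult[OF assms Basis_real_prod(1)]
    second_partial_deriv_mult[OF assms Basis_real_prod(2)] by (simp only: algebra_simps)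

lemma laplacian_compose:
  fixes h h1 h2 :: "real \<Rightarrow> real"
  assumes "open U" "smooth_on U f" "z \<in> U" "f ` U \<subseteq> V" "smooth_on V h1"
    and "\<And>s. s \<in> V \<Longrightarrow> (h has_real_derivative h1 s) (at s)" "\<And>s. s \<in> V \<Longrightarrow> (h1 has_real_derivative h2 s) (at s)"
  shows "laplacian (\<lambda>x. h (f x)) z = h2 (f z) * ((partial_deriv (1, 0) f z)\<^sup>2 + (partial_deriv (0, 1) f z)\<^sup>2) + h1 (f z) * laplacian f z"
proof -
  have "partial_derivs [b, b] (\<lambda>x. h (f x)) z = h2 (f z) * (partial_deriv b f z)\<^sup>2 + h1 (f z) * partial_derivs [b, b] f z"
    if "b \<in> Basis" for b
    by (rule second_partial_deriv_compose[OF assms(1-3) that assms(4-7)])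
  from this[OF Basis_real_prod(1)] this[OF Basis_real_prod(2)] show ?thesis
    unfolding laplacian_def by (simp only: algebra_simps)
qed

section \<open>The three-quarter plane and its harmonic function\<close>

definition sector :: "(real \<times> real) set" where "sector = {z. fst z < 0 \<or> snd z > 0}"

lemma open_sector: "open sector"
proof -
  have "sector = {z. fst z < 0} \<union> {z. snd z > 0}" by (auto simp: sector_def)
  moreover have "open ({z::real \<times> real. fst z < 0} \<union> {z. snd z > 0})"
    by (intro open_Un open_Collect_less continuous_intros)
  ultimately show ?thesis by simp
qed

definition tau :: "real \<times> real \<Rightarrow> real" where "tau z = (fst z)\<^sup>2 + (snd z)\<^sup>2"

lemma tau_pos: "z \<noteq> (0, 0) \<Longrightarrow> tau z > 0"
  by (cases z) (auto simp: tau_def sum_power2_gt_zero_iff)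

lemma tau_pos_sector: "z \<in> sector \<Longrightarrow> tau z > 0"
  by (rule tau_pos) (auto simp: sector_def)

lemma L_domain_subset_sector: "L_domain \<subseteq> sector"
  by (auto simp: L_domain_def sector_def)

lemma sector_disc_subset_L_domain:
  assumes "z \<in> sector" "tau z < 1" shows "z \<in> L_domain"
proof -
  have "(fst z)\<^sup>2 < 1" "(snd z)\<^sup>2 < 1"
    using assms(2) zero_le_power2[of "fst z"] zero_le_power2[of "snd z"] unfolding tau_def by linarith+
  then have "\<bar>fst z\<bar> < 1" "\<bar>snd z\<bar> < 1" by (auto simp: abs_square_less_1)
  then show ?thesis using assms(1) by (cases z) (auto simp: L_domain_def sector_def)
qed

text \<open>\<open>sector_map w\<close> is \<open>w\<^bsup>2/3\<^esup>\<close> on the sector, rotated so that the cut runs inside the removed quadrant and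
  the sector is mapped to the right half plane.\<close>

definition sector_map :: "complex \<Rightarrow> complex" where
  "sector_map w = exp (of_real (2/3) * Ln (w * cis (- 3 * pi / 4)))"

definition to_complex :: "real \<times> real \<Rightarrow> complex" where "to_complex z = Complex (fst z) (snd z)"

definition pot :: "real \<times> real \<Rightarrow> real" where "pot z = Re (sector_map (to_complex z))"

definition slit :: "complex set" where "slit = {w. w * cis (- 3 * pi / 4) \<notin> \<real>\<^sub>\<le>\<^sub>0}"

lemma open_slit: "open slit"
proof -
  have "slit = (\<lambda>w. w * cis (- 3 * pi / 4)) -` (- \<real>\<^sub>\<le>\<^sub>0)" by (auto simp: slit_def)
  moreover have "open ((\<lambda>w. w * cis (- 3 * pi / 4)) -` (- \<real>\<^sub>\<le>\<^sub>0))"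
    by (intro open_vimage open_Compl closed_nonpos_Reals_complex continuous_intros)
  ultimately show ?thesis by simp
qed

lemma cmod_to_complex: "cmod (to_complex z) = sqrt (tau z)"
  by (simp add: to_complex_def tau_def cmod_def)

lemma to_complex_eq_0_iff: "to_complex z = 0 \<longleftrightarrow> z = (0, 0)"
  by (cases z) (auto simp: to_complex_def complex_eq_iff)

text \<open>\<open>\<alpha>\<close> is the polar angle measured from the bisector of the sector,
  whose direction is 3 pi / 4.\<close>

lemma to_complex_eq_Arg:
  assumes "z \<noteq> (0, 0)"
  defines "\<alpha> \<equiv> Im (Ln (to_complex z * cis (- 3 * pi / 4)))"
  shows "to_complex z = of_real (sqrt (tau z)) * cis (\<alpha> + 3 * pi / 4)" "- pi < \<alpha>" "\<alpha> \<le> pi"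
proof -
  let ?w = "to_complex z * cis (- 3 * pi / 4)"
  have nz: "?w \<noteq> 0" using assms to_complex_eq_0_iff by simp
  have "?w = exp (Ln ?w)" using nz by simp
  also have "\<dots> = of_real (exp (Re (Ln ?w))) * cis \<alpha>" unfolding \<alpha>_def by (simp add: exp_eq_polar)
  also have "exp (Re (Ln ?w)) = sqrt (tau z)" using nz tau_pos[OF assms(1)] by (simp add: norm_mult cmod_to_complex)
  finally have "?w * cis (3 * pi / 4) = of_real (sqrt (tau z)) * cis (\<alpha> + 3 * pi / 4)" by (simp add: cis_mult)
  then show "to_complex z = of_real (sqrt (tau z)) * cis (\<alpha> + 3 * pi / 4)" by (simp add: cis_mult mult.assoc)
  show "- pi < \<alpha>" "\<alpha> \<le> pi" unfolding \<alpha>_def using nz mpi_less_Im_Ln Im_Ln_le_pi by blast+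
qed

text \<open>Since \<open>tau\<close> is r^2 and the angle is theta - 3 pi / 4, this is r^(2/3) cos
  (2 theta / 3 - pi / 2) = r^(2/3) sin (2 theta / 3).\<close>

lemma pot_eq:
  assumes "z \<noteq> (0, 0)"
  shows "pot z = tau z powr (1/3) * cos (2/3 * Im (Ln (to_complex z * cis (- 3 * pi / 4))))"
proof -
  let ?w = "to_complex z * cis (- 3 * pi / 4)"
  have nz: "?w \<noteq> 0" using assms to_complex_eq_0_iff by simp
  have "Re (Ln ?w) = ln (sqrt (tau z))" using nz by (simp add: norm_mult cmod_to_complex)
  also have "\<dots> = ln (tau z) / 2" using tau_pos[OF assms] by (simp add: ln_sqrt)
  finally have "exp (2/3 * Re (Ln ?w)) = tau z powr (1/3)" using tau_pos[OF assms] by (simp add: powr_def)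
  then show ?thesis by (simp add: pot_def sector_map_def Re_exp)
qed

lemma pot_le: "z \<noteq> (0, 0) \<Longrightarrow> pot z \<le> tau z powr (1/3)"
  using pot_eq[of z] by (simp add: mult_left_le)

text \<open>An angle of at least 3 pi / 4 from the bisector would put the point into the closed
  fourth quadrant, which the sector omits.\<close>

lemma Im_Ln_sector:
  assumes "z \<in> sector" shows "\<bar>Im (Ln (to_complex z * cis (- 3 * pi / 4)))\<bar> < 3 * pi / 4"
proof (rule ccontr)
  define \<alpha> where "\<alpha> = Im (Ln (to_complex z * cis (- 3 * pi / 4)))"
  define \<beta> where "\<beta> = \<alpha> + 3 * pi / 4"
  have z: "z \<noteq> (0, 0)" using assms by (auto simp: sector_def)
  note to_complex = to_complex_eq_Arg[OF z, folded \<alpha>_def, folded \<beta>_def]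
  have xy: "fst z = sqrt (tau z) * cos \<beta>" "snd z = sqrt (tau z) * sin \<beta>"
    using arg_cong[OF to_complex(1), of Re] arg_cong[OF to_complex(1), of Im] by (simp_all add: to_complex_def)
  assume "\<not> \<bar>Im (Ln (to_complex z * cis (- 3 * pi / 4)))\<bar> < 3 * pi / 4"
  then consider "\<alpha> \<ge> 3 * pi / 4" | "\<alpha> \<le> - 3 * pi / 4" unfolding \<alpha>_def by linarith
  then have "cos \<beta> \<ge> 0 \<and> sin \<beta> \<le> 0"
  proof cases
    case 1
    then have "- pi / 2 \<le> \<beta> - 2 * pi" "\<beta> - 2 * pi \<le> 0" using to_complex(3) pi_gt_zero unfolding \<beta>_def by linarith+
    then have "cos (\<beta> - 2 * pi) \<ge> 0" "sin (2 * pi - \<beta>) \<ge> 0"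
      using pi_gt_zero by (auto intro!: cos_ge_zero sin_ge_zero simp: field_simps)
    then show ?thesis by (simp add: cos_diff sin_diff)
  next
    case 2
    then have "- pi / 2 \<le> \<beta>" "\<beta> \<le> 0" using to_complex(2) pi_gt_zero unfolding \<beta>_def by linarith+
    then have "cos \<beta> \<ge> 0" "sin (- \<beta>) \<ge> 0"
      using pi_gt_zero by (auto intro!: cos_ge_zero sin_ge_zero simp: field_simps simp del: sin_minus)
    then show ?thesis by simp
  qed
  then have "fst z \<ge> 0" "snd z \<le> 0" unfolding xy using tau_pos[OF z] by (auto intro: mult_nonneg_nonpos)
  then show False using assms by (auto simp: sector_def)
qed

lemma pot_pos: assumes "z \<in> sector" shows "pot z > 0"
proof -
  have "\<bar>2/3 * Im (Ln (to_complex z * cis (- 3 * pi / 4)))\<bar> < pi / 2" using Im_Ln_sector[OF assms] by (simp add: abs_mult)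
  then have "cos (2/3 * Im (Ln (to_complex z * cis (- 3 * pi / 4)))) > 0" by (intro cos_gt_zero_pi) auto
  moreover have "z \<noteq> (0, 0)" using assms by (auto simp: sector_def)
  ultimately show ?thesis using tau_pos[of z] by (simp add: pot_eq)
qed

text \<open>The edges make the angle 3 pi / 4 with the bisector, and two thirds of this is pi / 2, a
  zero of the cosine.\<close>

lemma pot_edges:
  "x > 0 \<Longrightarrow> pot (x, 0) = 0" "y > 0 \<Longrightarrow> pot (0, -y) = 0"
  "x > 0 \<Longrightarrow> to_complex (x, 0) \<in> slit" "y > 0 \<Longrightarrow> to_complex (0, -y) \<in> slit"
proof -
  have main: "cos (2/3 * Im (Ln w)) = 0 \<and> w \<notin> \<real>\<^sub>\<le>\<^sub>0" if "w = of_real r * cis a" "r > 0" "\<bar>a\<bar> = 3 * pi / 4" for w r a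
  proof -
    have "w = exp (of_real (ln r) + \<i> * of_real a)" using that by (simp add: exp_add exp_of_real cis_conv_exp)
    moreover have a: "a = 3 * pi / 4 \<or> a = - 3 * pi / 4" using that(3) by linarith
    then have "- pi < a" "a < pi" using pi_gt_zero by linarith+
    ultimately have "Im (Ln w) = a" using \<open>- pi < a\<close> \<open>a < pi\<close> by simp
    moreover have "w \<notin> \<real>\<^sub>\<le>\<^sub>0"
    proof
      assume "w \<in> \<real>\<^sub>\<le>\<^sub>0"
      moreover have "w \<noteq> 0" using that(1,2) by simp
      ultimately have "Im (Ln w) = pi" using Im_Ln_eq_pi[of w] by (auto simp: complex_nonpos_Reals_iff less_le complex_eq_iff)
      then show False using \<open>Im (Ln w) = a\<close> \<open>a < pi\<close> by simp
    qed
    moreover have "2/3 * a = pi / 2 \<or> 2/3 * a = - (pi / 2)" using a by auto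
    then have "cos (2/3 * a) = 0" by (metis cos_pi_half cos_minus)
    ultimately show ?thesis by simp
  qed
  {
    fix x :: real assume x: "x > 0"
    have "to_complex (x, 0) * cis (- 3 * pi / 4) = of_real x * cis (- 3 * pi / 4)" by (simp add: to_complex_def Complex_eq)
    from main[OF this x] show "pot (x, 0) = 0" "to_complex (x, 0) \<in> slit"
      using x pot_eq[of "(x, 0)"] by (auto simp: slit_def)
    have "to_complex (0, -x) = of_real x * cis (3/2 * pi)"
      unfolding to_complex_def cis.ctr cos_3over2_pi sin_3over2_pi by (simp add: complex_eq_iff)
    moreover have "3/2 * pi + - 3 * pi / 4 = 3 * pi / 4" by simp
    ultimately have "to_complex (0, -x) * cis (- 3 * pi / 4) = of_real x * cis (3 * pi / 4)"
      by (simp only: cis_mult mult.assoc)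
    from main[OF this x] show "pot (0, -x) = 0" "to_complex (0, -x) \<in> slit"
      using x pot_eq[of "(0, -x)"] by (auto simp: slit_def)
  }
qed

lemma to_complex_sector_slit: assumes "z \<in> sector" shows "to_complex z \<in> slit"
proof -
  let ?w = "to_complex z * cis (- 3 * pi / 4)"
  have "z \<noteq> (0, 0)" using assms by (auto simp: sector_def)
  then have "?w \<noteq> 0" using to_complex_eq_0_iff by simp
  moreover have "Im (Ln ?w) < pi" using Im_Ln_sector[OF assms] pi_gt_zero by linarith
  ultimately show ?thesis
    using Im_Ln_eq_pi[of ?w] by (auto simp: slit_def complex_nonpos_Reals_iff less_le complex_eq_iff)
qed

text \<open>The cut of the logarithm misses the closed sector except for its vertex, so
  \<open>pot\<close> is continuous up to the edges and vanishes there.\<close>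

lemma closed_sector_slit:
  assumes "fst z \<le> 0 \<or> snd z \<ge> 0" "z \<noteq> (0, 0)"
  shows "to_complex z \<in> slit" "z \<notin> sector \<Longrightarrow> pot z = 0"
proof -
  have "z \<in> sector \<or> (\<exists>x>0. z = (x, 0)) \<or> (\<exists>y>0. z = (0, -y))"
  proof (cases "z \<in> sector")
    case False
    then have "z = (fst z, 0) \<and> fst z > 0 \<or> z = (0, - (- snd z)) \<and> - snd z > 0"
      using assms by (cases z) (auto simp: sector_def)
    then show ?thesis by blast
  qed blast
  then show "to_complex z \<in> slit" "z \<notin> sector \<Longrightarrow> pot z = 0"
    using to_complex_sector_slit[of z] pot_edges(3,4) pot_edges(1,2) by blast+
qed

lemma sector_map_has_field_derivative:
  assumes "w \<in> slit" shows "(sector_map has_field_derivative (2/3 * sector_map w / w)) (at w)"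
proof -
  have "w \<noteq> 0" using assms by (auto simp: slit_def)
  then show ?thesis
    using assms unfolding sector_map_def[abs_def] slit_def
    by (auto intro!: derivative_eq_intros simp: field_simps)
qed

lemma sector_map_holomorphic: "sector_map holomorphic_on slit"
  using sector_map_has_field_derivative open_slit by (auto simp: holomorphic_on_open)

lemma smooth_on_pot: "smooth_on sector pot"
  unfolding pot_def[abs_def] to_complex_def
  by (rule smooth_on_Re_holomorphic(1)[OF open_sector open_slit sector_map_holomorphic])
    (use to_complex_sector_slit in \<open>simp add: to_complex_def\<close>)

lemma deriv_sector_map: "w \<in> slit \<Longrightarrow> deriv sector_map w = 2/3 * sector_map w / w"
  by (rule DERIV_imp_deriv[OF sector_map_has_field_derivative])

lemma partial_deriv_pot:
  assumes "z \<in> sector"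
  shows "partial_deriv (1, 0) pot z = Re (deriv sector_map (to_complex z))" "partial_deriv (0, 1) pot z = - Im (deriv sector_map (to_complex z))"
proof -
  have "(pot has_derivative (\<lambda>h. fst h * Re (deriv sector_map (to_complex z)) - snd h * Im (deriv sector_map (to_complex z)))) (at z)"
    unfolding pot_def[abs_def] to_complex_def
    by (rule smooth_on_Re_holomorphic(2)[OF open_sector open_slit sector_map_holomorphic _ assms])
      (use to_complex_sector_slit in \<open>simp add: to_complex_def\<close>)
  from partial_deriv_eqI[OF this]
  show "partial_deriv (1, 0) pot z = Re (deriv sector_map (to_complex z))" "partial_deriv (0, 1) pot z = - Im (deriv sector_map (to_complex z))" by auto
qed

lemma laplacian_pot: assumes "z \<in> sector" shows "laplacian pot z = 0"
proof -
  have h: "deriv sector_map holomorphic_on slit" by (rule holomorphic_deriv[OF sector_map_holomorphic open_slit])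
  then have h': "(\<lambda>w. \<i> * deriv sector_map w) holomorphic_on slit" by (rule holomorphic_on_mult[OF holomorphic_on_const])
  have s: "\<And>z. z \<in> sector \<Longrightarrow> Complex (fst z) (snd z) \<in> slit" using to_complex_sector_slit by (simp add: to_complex_def)
  have d: "deriv (\<lambda>w. \<i> * deriv sector_map w) (to_complex z) = \<i> * deriv (deriv sector_map) (to_complex z)"
    using h to_complex_sector_slit[OF assms] open_slit by (intro deriv_cmult) (auto simp: holomorphic_on_imp_differentiable_at)
  have "partial_deriv (1, 0) (partial_deriv (1, 0) pot) z = partial_deriv (1, 0) (\<lambda>z. Re (deriv sector_map (Complex (fst z) (snd z)))) z"
    by (rule partial_deriv_cong_open[OF open_sector assms]) (simp add: partial_deriv_pot to_complex_def)
  also have "\<dots> = Re (deriv (deriv sector_map) (to_complex z))"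
    using partial_deriv_eqI[OF smooth_on_Re_holomorphic(2)[OF open_sector open_slit h s assms], of "(1, 0)"] by (simp add: to_complex_def)
  finally have 1: "partial_deriv (1, 0) (partial_deriv (1, 0) pot) z = Re (deriv (deriv sector_map) (to_complex z))" .
  have "partial_deriv (0, 1) (partial_deriv (0, 1) pot) z = partial_deriv (0, 1) (\<lambda>z. Re (\<i> * deriv sector_map (Complex (fst z) (snd z)))) z"
    by (rule partial_deriv_cong_open[OF open_sector assms]) (simp add: partial_deriv_pot to_complex_def)
  also have "\<dots> = - Im (deriv (\<lambda>w. \<i> * deriv sector_map w) (to_complex z))"
    using partial_deriv_eqI[OF smooth_on_Re_holomorphic(2)[OF open_sector open_slit h' s assms], of "(0, 1)"] by (simp add: to_complex_def)
  finally show ?thesis using 1 by (simp add: laplacian_def d)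
qed

text \<open>Euler's relation for homogeneity of degree 2/3: the real part of w F'(w) = 2/3 F(w) for
  F = \<open>sector_map\<close>.\<close>

lemma euler_pot:
  assumes "z \<in> sector"
  shows "fst z * partial_deriv (1, 0) pot z + snd z * partial_deriv (0, 1) pot z = 2/3 * pot z"
proof -
  have "to_complex z \<noteq> 0" using assms to_complex_eq_0_iff[of z] by (auto simp: sector_def)
  then have "deriv sector_map (to_complex z) * to_complex z = 2/3 * sector_map (to_complex z)" using deriv_sector_map[OF to_complex_sector_slit[OF assms]] by simp
  then have "Re (deriv sector_map (to_complex z) * to_complex z) = Re (2/3 * sector_map (to_complex z))" by (rule arg_cong)
  moreover have "Re (2/3 * sector_map (to_complex z)) = 2/3 * pot z" by (simp add: pot_def)
  moreover have "Re (to_complex z) = fst z" "Im (to_complex z) = snd z" by (simp_all add: to_complex_def)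
  ultimately show ?thesis by (simp add: partial_deriv_pot[OF assms] algebra_simps)
qed

text \<open>This is r^(-4/3), the quotient of the singular function r^(-2/3) sin (2 theta / 3) by
  \<open>pot\<close>. Radial factors are written as functions of it.\<close>

definition rad :: "real \<times> real \<Rightarrow> real" where "rad z = tau z powr (- 2/3)"

lemma tau_has_derivative: "(tau has_derivative (\<lambda>h. 2 * fst z * fst h + 2 * snd z * snd h)) (at z)"
  unfolding tau_def[abs_def] by (auto intro!: derivative_eq_intros)

lemma partial_deriv_tau: "partial_deriv (1, 0) tau = (\<lambda>z. 2 * fst z)" "partial_deriv (0, 1) tau = (\<lambda>z. 2 * snd z)"
  using partial_deriv_eqI[OF tau_has_derivative] by auto

lemma smooth_on_tau: "open U \<Longrightarrow> smooth_on U tau"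
  unfolding tau_def[abs_def] power2_eq_square
  by (intro smooth_on_add smooth_on_mult smooth_on_subset[OF smooth_on_fst] smooth_on_subset[OF smooth_on_snd]) auto

lemma laplacian_tau: "laplacian tau z = 4"
proof -
  have "((\<lambda>z. 2 * fst z) has_derivative (\<lambda>h. 2 * fst h)) (at z)" "((\<lambda>z. 2 * snd z) has_derivative (\<lambda>h. 2 * snd h)) (at z)"
    by (auto intro!: derivative_eq_intros)
  from this[THEN partial_deriv_eqI] show ?thesis unfolding laplacian_def by (simp add: partial_deriv_tau)
qed

lemma smooth_on_rad: "smooth_on sector rad"
  unfolding rad_def[abs_def]
  by (rule smooth_on_compose[OF open_sector smooth_on_powr smooth_on_tau[OF open_sector]]) (auto simp: tau_pos_sector)

lemma partial_deriv_rad: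
  assumes "z \<in> sector"
  shows "partial_deriv (1, 0) rad z = - (4/3) * tau z powr (- 5/3) * fst z"
    "partial_deriv (0, 1) rad z = - (4/3) * tau z powr (- 5/3) * snd z"
proof -
  have D: "((\<lambda>t. t powr (- 2/3)) has_real_derivative (- 2/3 * tau z powr (- 2/3 - 1))) (at (tau z))"
    by (rule has_real_derivative_powr[OF tau_pos_sector[OF assms]])
  have "partial_deriv b rad z = - 2/3 * tau z powr (- 2/3 - 1) * partial_deriv b tau z" for b
    unfolding rad_def[abs_def]
    by (rule partial_deriv_compose[OF D smooth_on_has_derivative[OF smooth_on_tau[OF open_sector] assms]])
  then show "partial_deriv (1, 0) rad z = - (4/3) * tau z powr (- 5/3) * fst z"
    "partial_deriv (0, 1) rad z = - (4/3) * tau z powr (- 5/3) * snd z" by (simp_all add: partial_deriv_tau)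
qed

text \<open>In the plane the Laplacian of r^a is a^2 r^(a-2); with a = -4/3 this is where 16/9 comes
  from.\<close>

lemma laplacian_rad:
  assumes "z \<in> sector" shows "laplacian rad z = 16/9 * tau z powr (- 5/3)"
proof -
  have p: "tau z powr (- 8/3) * tau z = tau z powr (- 5/3)"
    using tau_pos_sector[OF assms] powr_mult_base[of "tau z" "- 8/3"] by (simp add: mult.commute)
  have "laplacian rad z = (10/9 * tau z powr (- 8/3)) * ((partial_deriv (1, 0) tau z)\<^sup>2 + (partial_deriv (0, 1) tau z)\<^sup>2)
      + (- (2/3) * tau z powr (- 5/3)) * laplacian tau z"
    unfolding rad_def[abs_def]
  proof (rule laplacian_compose[OF open_sector smooth_on_tau[OF open_sector] assms, where V = "{0<..}"])
    show "tau ` sector \<subseteq> {0<..}" using tau_pos_sector by auto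
    show "smooth_on {0<..} (\<lambda>s. - (2/3) * s powr (- 5/3))"
      by (intro smooth_on_mult smooth_on_const smooth_on_powr) auto
    fix s :: real assume "s \<in> {0<..}"
    then show "((\<lambda>t. t powr (- 2/3)) has_real_derivative - (2/3) * s powr (- 5/3)) (at s)"
      "((\<lambda>s. - (2/3) * s powr (- 5/3)) has_real_derivative 10/9 * s powr (- 8/3)) (at s)"
      using has_real_derivative_powr[of s "- 2/3"] DERIV_cmult[OF has_real_derivative_powr[of s "- 5/3"], of "- (2/3)"] by simp_all
  qed
  also have "(partial_deriv (1, 0) tau z)\<^sup>2 + (partial_deriv (0, 1) tau z)\<^sup>2 = 4 * tau z"
    by (simp add: partial_deriv_tau tau_def power_mult_distrib)
  also have "10/9 * tau z powr (- 8/3) * (4 * tau z) = 40/9 * (tau z powr (- 8/3) * tau z)" by simp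
  finally show ?thesis unfolding p laplacian_tau by simp
qed


subsection \<open>Green's identity up to the edges\<close>

lemma grad_rad_square:
  assumes "z \<in> sector"
  shows "(partial_deriv (1, 0) rad z)\<^sup>2 + (partial_deriv (0, 1) rad z)\<^sup>2 = 16/9 * tau z powr (- 7/3)"
proof -
  have t: "tau z > 0" by (rule tau_pos_sector[OF assms])
  have "(partial_deriv (1, 0) rad z)\<^sup>2 + (partial_deriv (0, 1) rad z)\<^sup>2 = 16/9 * ((tau z powr (- 5/3) * tau z powr (- 5/3)) * tau z)"
    unfolding partial_deriv_rad[OF assms] tau_def by (simp add: power2_eq_square algebra_simps)
  also have "tau z powr (- 5/3) * tau z powr (- 5/3) = tau z powr (- 10/3)" by (simp flip: powr_add)
  also have "\<dots> * tau z = tau z powr (- 7/3)" using powr_mult_base[of "tau z" "- 10/3"] t by (simp add: mult.commute)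
  finally show ?thesis .
qed

text \<open>The gradient of \<open>rad\<close> is radial, so only the radial derivative of
  \<open>pot\<close> enters, and Euler's relation gives it.\<close>

lemma grad_pot_rad:
  assumes "z \<in> sector"
  shows "partial_deriv (1, 0) pot z * partial_deriv (1, 0) rad z + partial_deriv (0, 1) pot z * partial_deriv (0, 1) rad z
    = - (8/9) * tau z powr (- 5/3) * pot z"
proof -
  have "partial_deriv (1, 0) pot z * partial_deriv (1, 0) rad z + partial_deriv (0, 1) pot z * partial_deriv (0, 1) rad z
    = - (4/3) * tau z powr (- 5/3) * (fst z * partial_deriv (1, 0) pot z + snd z * partial_deriv (0, 1) pot z)"
    unfolding partial_deriv_rad[OF assms] by (simp add: algebra_simps)
  then show ?thesis unfolding euler_pot[OF assms] by simp
qed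

text \<open>\<open>N\<close> cuts off at the edges and \<open>J\<close> at the corner and away from
  it. For \<open>N\<close> the identity, with \<open>N1 = 1\<close> and \<open>N2 = 0\<close>, the
  two \<open>J1\<close> terms cancel and only the \<open>J2\<close> term remains.\<close>

lemma laplacian_cut:
  fixes N N1 N2 J J1 J2 :: "real \<Rightarrow> real"
  assumes z: "z \<in> sector"
    and N: "smooth_on UNIV N" "smooth_on UNIV N1" "\<And>s. (N has_real_derivative N1 s) (at s)" "\<And>s. (N1 has_real_derivative N2 s) (at s)"
    and J: "smooth_on UNIV J" "smooth_on UNIV J1" "\<And>s. (J has_real_derivative J1 s) (at s)" "\<And>s. (J1 has_real_derivative J2 s) (at s)"
  shows "laplacian (\<lambda>z. N (pot z) * J (rad z)) z =
    N (pot z) * (J2 (rad z) * (16/9 * tau z powr (- 7/3)) + J1 (rad z) * (16/9 * tau z powr (- 5/3)))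
    + N1 (pot z) * (- (16/9) * J1 (rad z) * tau z powr (- 5/3) * pot z)
    + N2 (pot z) * ((partial_deriv (1, 0) pot z)\<^sup>2 + (partial_deriv (0, 1) pot z)\<^sup>2) * J (rad z)"
proof -
  have sN: "smooth_on sector (\<lambda>z. N (pot z))" and sJ: "smooth_on sector (\<lambda>z. J (rad z))"
    by (rule smooth_on_compose[OF open_sector N(1) smooth_on_pot], simp, rule smooth_on_compose[OF open_sector J(1) smooth_on_rad], simp)
  have lN: "laplacian (\<lambda>z. N (pot z)) z = N2 (pot z) * ((partial_deriv (1, 0) pot z)\<^sup>2 + (partial_deriv (0, 1) pot z)\<^sup>2) + N1 (pot z) * laplacian pot z"
    by (rule laplacian_compose[OF open_sector smooth_on_pot z _ N(2) N(3,4)]) simp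
  have lJ: "laplacian (\<lambda>z. J (rad z)) z = J2 (rad z) * ((partial_deriv (1, 0) rad z)\<^sup>2 + (partial_deriv (0, 1) rad z)\<^sup>2) + J1 (rad z) * laplacian rad z"
    by (rule laplacian_compose[OF open_sector smooth_on_rad z _ J(2) J(3,4)]) simp
  have dN: "partial_deriv b (\<lambda>z. N (pot z)) z = N1 (pot z) * partial_deriv b pot z" for b
    by (rule partial_deriv_compose[OF N(3) smooth_on_has_derivative[OF smooth_on_pot z]])
  have dJ: "partial_deriv b (\<lambda>z. J (rad z)) z = J1 (rad z) * partial_deriv b rad z" for b
    by (rule partial_deriv_compose[OF J(3) smooth_on_has_derivative[OF smooth_on_rad z]])
  have "2 * (partial_deriv (1, 0) (\<lambda>z. N (pot z)) z * partial_deriv (1, 0) (\<lambda>z. J (rad z)) z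
      + partial_deriv (0, 1) (\<lambda>z. N (pot z)) z * partial_deriv (0, 1) (\<lambda>z. J (rad z)) z)
    = 2 * (N1 (pot z) * J1 (rad z)) * (partial_deriv (1, 0) pot z * partial_deriv (1, 0) rad z + partial_deriv (0, 1) pot z * partial_deriv (0, 1) rad z)"
    unfolding dN dJ by (simp add: algebra_simps)
  also have "\<dots> = N1 (pot z) * (- (16/9) * J1 (rad z) * tau z powr (- 5/3) * pot z)"
    unfolding grad_pot_rad[OF z] by simp
  finally show ?thesis
    unfolding laplacian_mult[OF open_sector sN sJ z] lN lJ laplacian_pot[OF z] laplacian_rad[OF z] grad_rad_square[OF z]
    by (simp add: algebra_simps)
qed

lemma laplacian_cong_open:
  assumes "open U" "z \<in> U" "\<And>y. y \<in> U \<Longrightarrow> f y = g y"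
  shows "laplacian f z = laplacian g z"
proof -
  have "partial_derivs [b, b] f z = partial_derivs [b, b] g z" for b
    using partial_deriv_cong_open[OF assms(1,2), of "partial_deriv b f" "partial_deriv b g" b]
      partial_deriv_cong_open[OF assms(1) _ assms(3)] by simp
  then show ?thesis by (simp only: laplacian_def)
qed

lemma rad_powr_tau: "z \<in> sector \<Longrightarrow> rad z powr (- 3/2 * a) = tau z powr a"
  using tau_pos_sector[of z] by (simp add: rad_def powr_powr)

text \<open>Radial factors will be supported in \<open>rad > 2\<close>; this keeps them off the
  outer part of the boundary of \<open>L_domain\<close>.\<close>

lemma tau_less_of_rad:
  assumes "z \<in> sector" "rad z > 2" shows "tau z < 1/2"
proof (rule ccontr)
  assume "\<not> tau z < 1/2"
  then have "rad z \<le> (1/2) powr (- 2/3)" unfolding rad_def by (intro powr_mono2') auto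
  also have "\<dots> = 2 powr (2/3)" by (simp add: powr_minus_divide powr_divide)
  also have "\<dots> \<le> 2 powr 1" by (intro powr_mono) auto
  finally show False using assms by simp
qed

lemma tau_ge_of_rad:
  assumes "z \<in> sector" "rad z < s1" shows "s1 powr (- 3/2) \<le> tau z"
proof -
  have "tau z > 0" by (rule tau_pos_sector[OF assms(1)])
  then have "rad z > 0" by (simp add: rad_def)
  then have "s1 powr (- 3/2) \<le> rad z powr (- 3/2)" using assms(2) by (intro powr_mono2') auto
  also have "\<dots> = tau z" using rad_powr_tau[OF assms(1), of 1] \<open>tau z > 0\<close> by simp
  finally show ?thesis .
qed

text \<open>Both edges of the sector are included, which makes the set compact for every
  \<open>r\<close>, while for positive \<open>r\<close> the vertex is excluded.\<close>

definition annulus :: "real \<Rightarrow> (real \<times> real) set" where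
  "annulus r = {z. (fst z \<le> 0 \<or> snd z \<ge> 0) \<and> r \<le> tau z \<and> tau z \<le> 1/2}"

lemma compact_annulus: "compact (annulus r)"
proof -
  have eq: "annulus r = ({z. fst z \<le> 0} \<union> {z. snd z \<ge> 0}) \<inter> ({z. r \<le> tau z} \<inter> {z. tau z \<le> 1/2})"
    by (auto simp: annulus_def)
  have "closed (annulus r)" unfolding eq tau_def
    by (intro closed_Int closed_Un closed_Collect_le continuous_intros)
  moreover have "bounded (annulus r)"
  proof (rule boundedI)
    fix z assume "z \<in> annulus r"
    then have "tau z \<le> 1" by (simp add: annulus_def)
    then show "norm z \<le> 1" by (simp add: norm_prod_def tau_def)
  qed
  ultimately show ?thesis by (simp add: compact_eq_bounded_closed)
qed

lemma annulus_nonzero: "r > 0 \<Longrightarrow> z \<in> annulus r \<Longrightarrow> z \<noteq> (0, 0)"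
  by (auto simp: annulus_def tau_def)

lemma continuous_on_pot: "continuous_on {z. (fst z \<le> 0 \<or> snd z \<ge> 0) \<and> z \<noteq> (0, 0)} pot"
proof -
  have sector_map: "continuous_on slit sector_map" by (rule holomorphic_on_imp_continuous_on[OF sector_map_holomorphic])
  have "continuous_on A to_complex" for A unfolding to_complex_def[abs_def] Complex_eq by (intro continuous_intros)
  then show ?thesis
    unfolding pot_def[abs_def] using closed_sector_slit(1)
    by (intro continuous_on_Re continuous_on_compose2[OF sector_map]) auto
qed

lemma annulus_cases:
  assumes "r > 0" "z \<in> annulus r" "z \<notin> sector"
  shows "pot z = 0" "z \<in> frontier L_domain"
proof -
  have nz: "z \<noteq> (0, 0)" by (rule annulus_nonzero[OF assms(1,2)])
  show "pot z = 0" using assms nz by (intro closed_sector_slit(2)) (auto simp: annulus_def)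
  have t: "tau z < 1" using assms(2) by (simp add: annulus_def)
  have "z = (fst z, 0) \<and> fst z > 0 \<or> z = (0, - (- snd z)) \<and> - snd z > 0"
    using assms(2,3) nz by (cases z) (auto simp: sector_def annulus_def)
  then show "z \<in> frontier L_domain"
  proof
    assume a: "z = (fst z, 0) \<and> fst z > 0"
    then have "tau z = (fst z)\<^sup>2" by (metis add.right_neutral power_zero_numeral snd_conv tau_def)
    then have "fst z < 1" using t a by (simp add: power_less_one_iff)
    then show ?thesis using a L_domain_frontier_axes(1)[of "fst z"] by auto
  next
    assume a: "z = (0, - (- snd z)) \<and> - snd z > 0"
    then have "tau z = (- snd z)\<^sup>2" by (metis add.left_neutral fst_conv power2_minus power_zero_numeral tau_def)
    then have "- snd z < 1" using t a power_less_one_iff[of "- snd z" 2] by simp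
    then show ?thesis using a L_domain_frontier_axes(2)[of "- snd z"] by auto
  qed
qed

lemma annulus_subset_closure: "r > 0 \<Longrightarrow> annulus r \<subseteq> closure L_domain"
proof
  fix z assume r: "r > 0" and z: "z \<in> annulus r"
  show "z \<in> closure L_domain"
  proof (cases "z \<in> sector")
    case True
    then have "z \<in> L_domain" using z by (intro sector_disc_subset_L_domain) (auto simp: annulus_def)
    then show ?thesis using closure_subset by blast
  next
    case False
    then show ?thesis using annulus_cases(2)[OF r z] by (auto simp: frontier_def)
  qed
qed

lemma continuous_on_pot_annulus: "r > 0 \<Longrightarrow> continuous_on (annulus r) pot"
  by (rule continuous_on_subset[OF continuous_on_pot]) (auto simp: annulus_def tau_def)

definition cutoff :: "(real \<Rightarrow> real) \<Rightarrow> (real \<Rightarrow> real) \<Rightarrow> real \<times> real \<Rightarrow> real" where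
  "cutoff N J z = (if z \<in> sector then N (pot z) * J (rad z) else 0)"

text \<open>The support lies in the part of a compact annular piece of the closed sector where
  \<open>pot\<close> is at least \<open>e\<close>. As \<open>pot\<close> is continuous up to the
  edges and zero on them, this part is compact and stays away from the edges.\<close>

lemma cutoff_test:
  assumes N: "smooth_on UNIV N" "\<And>s. s \<le> e \<Longrightarrow> N s = 0" "e > 0"
    and J: "smooth_on UNIV J" "\<And>s. s \<le> 2 \<or> s1 \<le> s \<Longrightarrow> J s = 0" "s1 > 2"
  shows "cutoff N J \<in> test_functions L_domain"
proof -
  define r where "r = s1 powr (- 3/2)"
  have "r > 0" using J(3) by (simp add: r_def)
  define K where "K = {z \<in> annulus r. pot z \<ge> e}"
  have K: "compact K"
  proof -
    have "closedin (top_of_set (annulus r)) (annulus r \<inter> pot -` {e..})"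
      by (rule continuous_closedin_preimage[OF continuous_on_pot_annulus[OF \<open>r > 0\<close>] closed_atLeast])
    moreover have "annulus r \<inter> pot -` {e..} = K" by (auto simp: K_def)
    ultimately show ?thesis using closedin_compact[OF compact_annulus] by metis
  qed
  have KS: "K \<subseteq> sector" using annulus_cases(1)[OF \<open>r > 0\<close>] N(3) by (force simp: K_def)
  have KL: "K \<subseteq> L_domain"
    using KS by (auto simp: K_def annulus_def intro!: sector_disc_subset_L_domain)
  have zero: "N (pot z) * J (rad z) = 0" if "z \<in> sector" "z \<notin> K" for z
  proof (cases "2 < rad z \<and> rad z < s1")
    case True
    then have "z \<in> annulus r" using that(1) tau_less_of_rad[of z] tau_ge_of_rad[of z s1]
      by (auto simp: annulus_def r_def sector_def)
    then show ?thesis using that(2) N(2)[of "pot z"] by (auto simp: K_def)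
  qed (use J(2) in auto)
  have "smooth_on sector (\<lambda>z. N (pot z) * J (rad z))"
    by (intro smooth_on_mult open_sector smooth_on_compose[OF open_sector N(1) smooth_on_pot]
        smooth_on_compose[OF open_sector J(1) smooth_on_rad]) auto
  from C_infinity_extend_zero[OF open_sector this compact_imp_closed[OF K] KS zero]
  have "C_infinity (cutoff N J)" unfolding cutoff_def[abs_def] .
  from test_functionsI[OF this K KL] show ?thesis using zero by (auto simp: cutoff_def)
qed

text \<open>A power of \<open>tau\<close> is a power of \<open>rad\<close>, so the product is a
  function of \<open>rad\<close> alone, continuous with compact support in [2, s1].\<close>

lemma rad_tau_bounded:
  fixes H :: "real \<Rightarrow> real"
  assumes "continuous_on UNIV H" "\<And>s. s \<le> 2 \<or> s1 \<le> s \<Longrightarrow> H s = 0"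
  obtains B where "B \<ge> 0" "\<And>z. z \<in> sector \<Longrightarrow> \<bar>H (rad z) * tau z powr a\<bar> \<le> B"
proof -
  have "continuous_on {2..s1} (\<lambda>s. H s * s powr (- 3/2 * a))"
    by (intro continuous_on_mult continuous_on_powr continuous_on_const continuous_on_id continuous_on_subset[OF assms(1)]) auto
  from continuous_compact_support_bounded[of "{2..s1}" "\<lambda>s. H s * s powr (- 3/2 * a)", OF compact_Icc this]
  obtain B where "B \<ge> 0" "\<And>s. \<bar>H s * s powr (- 3/2 * a)\<bar> \<le> B" using assms(2) by (metis atLeastAtMost_iff le_cases mult_zero_left)
  then show ?thesis using that[of B] rad_powr_tau by metis
qed

lemma pot_le_1: "z \<in> sector \<Longrightarrow> rad z > 2 \<Longrightarrow> pot z \<le> 1"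
proof -
  assume z: "z \<in> sector" "rad z > 2"
  have "pot z \<le> tau z powr (1/3)" using z by (intro pot_le) (auto simp: sector_def)
  also have "\<dots> \<le> 1" using tau_less_of_rad[OF z] by (intro powr_le1) (auto simp: tau_def)
  finally show ?thesis .
qed

lemma pot_rad_tau_bounded:
  fixes H :: "real \<Rightarrow> real"
  assumes "smooth_on UNIV H" "\<And>s. s \<le> 2 \<or> s1 \<le> s \<Longrightarrow> H s = 0"
  obtains b where "b \<ge> 0" "\<And>z. z \<in> sector \<Longrightarrow> \<bar>pot z * H (rad z) * tau z powr a\<bar> \<le> b"
proof -
  obtain b where b: "b \<ge> 0" "\<And>z. z \<in> sector \<Longrightarrow> \<bar>H (rad z) * tau z powr a\<bar> \<le> b"
    using rad_tau_bounded[OF smooth_on_continuous_on[OF assms(1)] assms(2)] by blast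
  have "\<bar>pot z * H (rad z) * tau z powr a\<bar> \<le> b" if z: "z \<in> sector" for z
  proof (cases "rad z > 2")
    case True
    have "\<bar>pot z\<bar> * \<bar>H (rad z) * tau z powr a\<bar> \<le> 1 * b"
      using pot_le_1[OF z True] pot_pos[OF z] b(2)[OF z] by (intro mult_mono) auto
    then show ?thesis by (simp add: abs_mult mult.assoc)
  qed (use b(1) assms(2) in auto)
  with b(1) show ?thesis using that by blast
qed

lemma continuous_on_L_domain:
  "continuous_on L_domain pot" "continuous_on L_domain rad" "continuous_on L_domain (\<lambda>z. tau z powr a)"
  "smooth_on UNIV f \<Longrightarrow> continuous_on L_domain (\<lambda>z. f (rad z))"
  "smooth_on UNIV f \<Longrightarrow> continuous_on L_domain (\<lambda>z. f (pot z))"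
proof -
  have "continuous_on L_domain f" if "smooth_on sector f" for f
    using smooth_on_continuous_on[OF that] L_domain_subset_sector continuous_on_subset by blast
  note c = this[OF smooth_on_pot] this[OF smooth_on_rad] this[OF smooth_on_tau[OF open_sector]]
  then show "continuous_on L_domain pot" "continuous_on L_domain rad" by auto
  show "continuous_on L_domain (\<lambda>z. tau z powr a)"
    using c(3) tau_pos_sector L_domain_subset_sector by (intro continuous_intros) force+
  assume f: "smooth_on UNIV f"
  show "continuous_on L_domain (\<lambda>z. f (rad z))" "continuous_on L_domain (\<lambda>z. f (pot z))"
    by (rule continuous_on_compose2[OF smooth_on_continuous_on[OF f] c(2)], simp,
        rule continuous_on_compose2[OF smooth_on_continuous_on[OF f] c(1)], simp)
qed

text \<open>A smooth approximation of the identity on the positive axis: zero up to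
  \<open>e\<close>, of slope 1 from \<open>3 * e\<close> on. The offset -2 places the transition
  between these values.\<close>

definition ramp_scaled :: "real \<Rightarrow> real \<Rightarrow> real" where "ramp_scaled e s = e * ramp (s / e - 2)"

lemma smooth_on_ramp_scaled: "smooth_on UNIV (ramp_scaled e)"
  and smooth_on_step_scaled: "smooth_on UNIV (\<lambda>s. step (s / e - 2))"
  using smooth_on_mult[OF _ smooth_on_const[of _ e] smooth_on_affine_compose[OF smooth_on_ramp, of "1/e" "-2"]]
    smooth_on_affine_compose[OF smooth_on_step, of "1/e" "-2"]
  by (simp_all add: ramp_scaled_def[abs_def])

lemma ramp_scaled_has_real_derivative:
  "e > 0 \<Longrightarrow> (ramp_scaled e has_real_derivative step (s / e - 2)) (at s)"
  "e > 0 \<Longrightarrow> ((\<lambda>s. step (s / e - 2)) has_real_derivative bump (s / e - 2) / e) (at s)"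
proof -
  assume e: "e > 0"
  have "((\<lambda>s. s / e - 2) has_real_derivative 1 / e) (at s)" using e by (auto intro!: derivative_eq_intros)
  from DERIV_cmult[OF DERIV_chain2[OF ramp_has_real_derivative this], of e] DERIV_chain2[OF step_has_real_derivative this]
  show "(ramp_scaled e has_real_derivative step (s / e - 2)) (at s)"
    "((\<lambda>s. step (s / e - 2)) has_real_derivative bump (s / e - 2) / e) (at s)"
    using e by (simp_all add: ramp_scaled_def[abs_def])
qed

lemma ramp_scaled_eq_0: "e > 0 \<Longrightarrow> s \<le> e \<Longrightarrow> ramp_scaled e s = 0"
  by (simp add: ramp_scaled_def ramp_eq_0 field_simps)

lemma ramp_scaled_bounds:
  assumes "e > 0" "s \<ge> 0" shows "0 \<le> ramp_scaled e s" "ramp_scaled e s \<le> s"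
proof -
  show "0 \<le> ramp_scaled e s" using assms ramp_nonneg by (simp add: ramp_scaled_def)
  show "ramp_scaled e s \<le> s"
  proof (cases "s \<le> e")
    case True then show ?thesis using assms ramp_scaled_eq_0 by simp
  next
    case False
    then have "ramp_scaled e s \<le> e * (s / e - 2 + 1)"
      unfolding ramp_scaled_def using assms by (intro mult_left_mono ramp_le) (auto simp: field_simps)
    also have "\<dots> = s - e" using assms by (simp add: algebra_simps)
    finally show ?thesis using assms by simp
  qed
qed

lemma ramp_scaled_tendsto:
  assumes "s > 0"
  shows "(\<lambda>n. ramp_scaled (inverse (real (Suc n))) s) \<longlonglongrightarrow> s" "(\<lambda>n. step (s / inverse (real (Suc n)) - 2)) \<longlonglongrightarrow> 1"
proof -
  have "\<forall>\<^sub>F n in sequentially. inverse (real (Suc n)) < s / 3"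
    by (rule order_tendstoD[OF LIMSEQ_inverse_real_of_nat]) (use assms in auto)
  then have ev: "\<forall>\<^sub>F n in sequentially. s / inverse (real (Suc n)) - 2 \<ge> 1"
    by eventually_elim (simp add: field_simps)
  then show "(\<lambda>n. step (s / inverse (real (Suc n)) - 2)) \<longlonglongrightarrow> 1"
    by (intro tendsto_eventually) (auto elim: eventually_mono simp: step_eq_1)
  have "(\<lambda>n. s + inverse (real (Suc n)) * (ramp 1 - 3)) \<longlonglongrightarrow> s + 0 * (ramp 1 - 3)"
    by (intro tendsto_intros LIMSEQ_inverse_real_of_nat)
  moreover have "\<forall>\<^sub>F n in sequentially. s + inverse (real (Suc n)) * (ramp 1 - 3) = ramp_scaled (inverse (real (Suc n))) s"
    using ev
  proof eventually_elim
    case (elim n)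
    have "ramp_scaled (inverse (real (Suc n))) s = inverse (real (Suc n)) * (ramp 1 + (s / inverse (real (Suc n)) - 2 - 1))"
      unfolding ramp_scaled_def by (simp only: ramp_eq[OF elim])
    then show ?case by (simp add: field_simps)
  qed
  ultimately show "(\<lambda>n. ramp_scaled (inverse (real (Suc n))) s) \<longlonglongrightarrow> s"
    by (auto intro: Lim_transform_eventually)
qed

text \<open>The last term of the Laplacian of the cut-off function is nonnegative, so that its \<open>L\<^sup>1\<close> norm
  is minus the integral of the other two; it lives where \<open>pot\<close>, hence \<open>v\<close>, is small.\<close>

lemma edge_identity:
  fixes J J1 J2 :: "real \<Rightarrow> real"
  assumes J: "smooth_on UNIV J" "smooth_on UNIV J1" "smooth_on UNIV J2" "s1 > 2"
      "\<And>s. (J has_real_derivative J1 s) (at s)" "\<And>s. (J1 has_real_derivative J2 s) (at s)"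
    and J0: "\<And>s. s \<le> 2 \<or> s1 \<le> s \<Longrightarrow> J s = 0" "\<And>s. s \<le> 2 \<or> s1 \<le> s \<Longrightarrow> J1 s = 0" "\<And>s. s \<le> 2 \<or> s1 \<le> s \<Longrightarrow> J2 s = 0"
    and Jnn: "\<And>s. J s \<ge> 0"
    and cont: "continuous_on (closure L_domain) v" and zero: "\<And>z. z \<in> frontier L_domain \<Longrightarrow> v z = 0"
    and g: "g \<in> L2 L_domain"
    and weak: "\<And>\<phi>. \<phi> \<in> test_functions L_domain \<Longrightarrow>
      (LINT z|lebesgue_on L_domain. v z * laplacian \<phi> z) = (LINT z|lebesgue_on L_domain. g z * \<phi> z)"
  shows "(LINT z|lebesgue_on L_domain. v z * (pot z * J2 (rad z) * (16/9 * tau z powr (- 7/3))))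
    = (LINT z|lebesgue_on L_domain. g z * (pot z * J (rad z)))"
proof -
  let ?M = "lebesgue_on L_domain"
  interpret finite_measure ?M by (rule finite_measure_lebesgue_on[OF lmeasurable_L_domain])
  have sec: "z \<in> sector" if "z \<in> L_domain" for z using that L_domain_subset_sector by blast
  note contL = borel_measurable_L_domain
  note cP = continuous_on_L_domain(1) and ctp = continuous_on_L_domain(3) and cfP = continuous_on_L_domain(5)
  note cJ = continuous_on_L_domain(4)[OF J(1)] continuous_on_L_domain(4)[OF J(2)] continuous_on_L_domain(4)[OF J(3)]
  have cv: "continuous_on L_domain v" using cont continuous_on_subset closure_subset by blast
  obtain Mv where Mv: "Mv \<ge> 0" "\<And>z. z \<in> L_domain \<Longrightarrow> \<bar>v z\<bar> \<le> Mv"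
    using bounded_on_L_domain[OF cont] closure_subset by (metis subsetD)
  define e where "e n = inverse (real (Suc n))" for n
  have e: "e n > 0" for n by (simp add: e_def)
  define \<alpha> where "\<alpha> z = J2 (rad z) * (16/9 * tau z powr (- 7/3)) + J1 (rad z) * (16/9 * tau z powr (- 5/3))" for z
  define \<beta> where "\<beta> z = - (16/9) * J1 (rad z) * tau z powr (- 5/3) * pot z" for z
  define Q where "Q z = (partial_deriv (1, 0) pot z)\<^sup>2 + (partial_deriv (0, 1) pot z)\<^sup>2" for z
  define F where "F n z = ramp_scaled (e n) (pot z) * \<alpha> z + step (pot z / e n - 2) * \<beta> z" for n z
  define T where "T n z = bump (pot z / e n - 2) / e n * Q z * J (rad z)" for n z
  define \<psi> where "\<psi> n = cutoff (ramp_scaled (e n)) J" for n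
  have lap: "laplacian (\<psi> n) z = F n z + T n z" if "z \<in> L_domain" for n z
  proof -
    have "laplacian (\<psi> n) z = laplacian (\<lambda>z. ramp_scaled (e n) (pot z) * J (rad z)) z"
      by (rule laplacian_cong_open[OF open_sector sec[OF that]]) (simp add: \<psi>_def cutoff_def)
    also have "\<dots> = F n z + T n z"
      unfolding F_def T_def \<alpha>_def \<beta>_def Q_def
      by (rule laplacian_cut[OF sec[OF that] smooth_on_ramp_scaled smooth_on_step_scaled
            ramp_scaled_has_real_derivative[OF e] J(1,2,5,6)])
    finally show ?thesis .
  qed
  have \<psi>_test: "\<psi> n \<in> test_functions L_domain" for n
    unfolding \<psi>_def by (rule cutoff_test[OF smooth_on_ramp_scaled ramp_scaled_eq_0[OF e] e J(1) J0(1) J(4)])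
  obtain B2 where B2: "B2 \<ge> 0" "\<And>z. z \<in> sector \<Longrightarrow> \<bar>pot z * J2 (rad z) * tau z powr (- 7/3)\<bar> \<le> B2"
    using pot_rad_tau_bounded[OF J(3) J0(3)] by blast
  obtain B1 where B1: "B1 \<ge> 0" "\<And>z. z \<in> sector \<Longrightarrow> \<bar>pot z * J1 (rad z) * tau z powr (- 5/3)\<bar> \<le> B1"
    using pot_rad_tau_bounded[OF J(2) J0(2)] by blast
  obtain B0 where B0: "B0 \<ge> 0" "\<And>z. z \<in> sector \<Longrightarrow> \<bar>pot z * J (rad z) * tau z powr 0\<bar> \<le> B0"
    using pot_rad_tau_bounded[OF J(1) J0(1)] by blast
  define C where "C = 16/9 * B2 + 32/9 * B1"
  have "C \<ge> 0" using B1(1) B2(1) by (simp add: C_def)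
  have F_bound: "\<bar>F n z\<bar> \<le> C" if "z \<in> L_domain" for n z
  proof -
    note z = sec[OF that]
    have r: "0 \<le> ramp_scaled (e n) (pot z)" "ramp_scaled (e n) (pot z) \<le> pot z"
      using ramp_scaled_bounds[OF e, of "pot z"] pot_pos[OF z] by auto
    have "\<bar>ramp_scaled (e n) (pot z) * \<alpha> z\<bar> \<le> \<bar>pot z * \<alpha> z\<bar>"
      using r pot_pos[OF z] by (simp add: abs_mult mult_right_mono)
    moreover have "pot z * \<alpha> z = 16/9 * (pot z * J2 (rad z) * tau z powr (- 7/3)) + 16/9 * (pot z * J1 (rad z) * tau z powr (- 5/3))"
      by (simp add: \<alpha>_def algebra_simps)
    moreover have "\<bar>step (pot z / e n - 2) * \<beta> z\<bar> \<le> \<bar>\<beta> z\<bar>"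
      using step_bounds[of "pot z / e n - 2"] by (simp add: abs_mult mult_left_le_one_le)
    moreover have "\<beta> z = - (16/9) * (pot z * J1 (rad z) * tau z powr (- 5/3))" by (simp add: \<beta>_def)
    ultimately show ?thesis using B1(2)[OF z] B2(2)[OF z] unfolding F_def C_def by linarith
  qed
  have T_nonneg: "T n z \<ge> 0" for n z
    unfolding T_def Q_def using e[of n] Jnn bump_nonneg by (intro mult_nonneg_nonneg divide_nonneg_pos) auto
  have F_meas: "F n \<in> borel_measurable ?M" for n
    unfolding F_def[abs_def] \<alpha>_def[abs_def] \<beta>_def[abs_def]
    by (rule contL)
      (intro continuous_on_add continuous_on_mult continuous_on_const ctp cP cJ cfP[OF smooth_on_ramp_scaled]
        cfP[OF smooth_on_step_scaled])
  have F_int: "integrable ?M (F n)" for n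
    by (rule integrable_const_bound[of _ C]) (use F_meas F_bound in \<open>auto intro!: AE_I2\<close>)
  have vF_le: "AE z in ?M. norm (v z * F n z) \<le> Mv * C" for n
  proof (rule AE_I2)
    fix z assume "z \<in> space ?M"
    then have z: "z \<in> L_domain" by simp
    show "norm (v z * F n z) \<le> Mv * C"
      using Mv(2)[OF z] F_bound[OF z, of n] Mv(1) by (simp add: abs_mult mult_mono)
  qed
  have vF_int: "integrable ?M (\<lambda>z. v z * F n z)" for n
    by (rule integrable_const_bound[OF vF_le]) (intro borel_measurable_times contL cv F_meas)
  define \<Lambda> where "\<Lambda> n = laplacian (\<psi> n)" for n
  have d\<psi>: "partial_derivs [b, b] (\<psi> n) \<in> test_functions L_domain" if "b \<in> Basis" for b n
    by (rule test_functions_partial_derivs[OF \<psi>_test]) (use that in auto)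
  have lap_int: "integrable ?M (\<Lambda> n)" "integrable ?M (\<lambda>z. v z * \<Lambda> n z)" "(LINT z|?M. \<Lambda> n z) = 0" for n
  proof -
    have one: "integrable ?M (partial_derivs [b, b] (\<psi> n)) \<and> integrable ?M (\<lambda>z. v z * partial_derivs [b, b] (\<psi> n) z)
       \<and> (LINT z|?M. partial_derivs [b, b] (\<psi> n) z) = 0" if b: "b \<in> Basis" for b
    proof (intro conjI)
      show "integrable ?M (partial_derivs [b, b] (\<psi> n))"
        using integrable_locally_integrable_times_test[OF open_L_domain locally_integrable_continuous[OF continuous_on_const[of _ 1]] d\<psi>[OF b]] by simp
      show "integrable ?M (\<lambda>z. v z * partial_derivs [b, b] (\<psi> n) z)"
        by (rule integrable_locally_integrable_times_test[OF open_L_domain locally_integrable_continuous[OF cv] d\<psi>[OF b]])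
      show "(LINT z|?M. partial_derivs [b, b] (\<psi> n) z) = 0"
        using integral_lebesgue_on_test[OF open_L_domain d\<psi>[OF b]]
          integral_partial_deriv_test[OF test_functions_partial_deriv[OF \<psi>_test b] b] by simp
    qed
    show "integrable ?M (\<Lambda> n)" "integrable ?M (\<lambda>z. v z * \<Lambda> n z)" "(LINT z|?M. \<Lambda> n z) = 0"
      unfolding \<Lambda>_def laplacian_def distrib_left
      using one[OF Basis_real_prod(1)] one[OF Basis_real_prod(2)] by (auto simp del: partial_derivs_Cons)
  qed
  have T_eq: "T n z = \<Lambda> n z - F n z" if "z \<in> space ?M" for n z
    using lap[of z n] that by (simp add: \<Lambda>_def)
  have T_int: "integrable ?M (T n)" for n
    using Bochner_Integration.integrable_diff[OF lap_int(1) F_int, of n n] T_eq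
    by (subst Bochner_Integration.integrable_cong[OF refl T_eq]) auto
  have vT_int: "integrable ?M (\<lambda>z. v z * T n z)" for n
  proof -
    have "integrable ?M (\<lambda>z. v z * \<Lambda> n z - v z * F n z)"
      by (rule Bochner_Integration.integrable_diff[OF lap_int(2) vF_int])
    then show ?thesis
      by (rule Bochner_Integration.integrable_cong[OF refl, THEN iffD1, rotated]) (simp add: T_eq right_diff_distrib)
  qed
  have T_bound: "(LINT z|?M. T n z) \<le> C * measure ?M (space ?M)" for n
  proof -
    have "(LINT z|?M. T n z) = (LINT z|?M. \<Lambda> n z - F n z)" by (rule Bochner_Integration.integral_cong[OF refl T_eq])
    also have "\<dots> = - (LINT z|?M. F n z)" using lap_int(1,3) F_int by simp
    also have "\<dots> \<le> (LINT z|?M. \<bar>F n z\<bar>)" using integral_abs_bound[of ?M "F n"] by linarith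
    also have "\<dots> \<le> (LINT z|?M. C)" using F_int F_bound by (intro integral_mono) auto
    finally show ?thesis by (simp add: mult.commute)
  qed
  have vT_lim: "(\<lambda>n. LINT z|?M. v z * T n z) \<longlonglongrightarrow> 0"
  proof (rule LIMSEQ_I)
    fix r :: real assume "r > 0"
    define \<eta> where "\<eta> = r / (C * measure ?M (space ?M) + 1)"
    have C': "C * measure ?M (space ?M) \<ge> 0" using \<open>C \<ge> 0\<close> by simp
    then have \<eta>: "\<eta> > 0" using \<open>r > 0\<close> by (simp add: \<eta>_def)
    define \<rho> where "\<rho> = s1 powr (- 3/2)"
    have \<rho>: "\<rho> > 0" using J(4) by (simp add: \<rho>_def)
    \<comment> \<open>Where |v| is not small, one is away from the edges: this set is compact and
      inside the sector, so \<open>pot\<close> has a positive minimum on it.\<close>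
    define K where "K = {z \<in> annulus \<rho>. \<bar>v z\<bar> \<ge> \<eta>}"
    have cva: "continuous_on (annulus \<rho>) v" by (rule continuous_on_subset[OF cont annulus_subset_closure[OF \<rho>]])
    have "compact K"
    proof -
      have "closedin (top_of_set (annulus \<rho>)) (annulus \<rho> \<inter> (\<lambda>z. \<bar>v z\<bar>) -` {\<eta>..})"
        by (rule continuous_closedin_preimage[OF _ closed_atLeast]) (intro continuous_intros cva)
      moreover have "annulus \<rho> \<inter> (\<lambda>z. \<bar>v z\<bar>) -` {\<eta>..} = K" by (auto simp: K_def)
      ultimately show ?thesis using closedin_compact[OF compact_annulus] by metis
    qed
    moreover have KS: "K \<subseteq> sector"
    proof
      fix z assume z: "z \<in> K"
      then have "v z \<noteq> 0" using \<eta> by (auto simp: K_def)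
      then show "z \<in> sector" using annulus_cases(2)[OF \<rho>, of z] zero[of z] z by (auto simp: K_def)
    qed
    have "\<exists>p>0. \<forall>z\<in>K. p \<le> pot z"
    proof (cases "K = {}")
      case False
      have "continuous_on K pot" using continuous_on_subset[OF continuous_on_pot_annulus[OF \<rho>]] by (auto simp: K_def)
      from continuous_attains_inf[OF \<open>compact K\<close> False this] show ?thesis using KS pot_pos by blast
    qed (auto intro: exI[of _ 1])
    then obtain p where p: "p > 0" "\<And>z. z \<in> K \<Longrightarrow> p \<le> pot z" by blast
    have "\<forall>\<^sub>F n in sequentially. e n < p / 3"
      unfolding e_def by (rule order_tendstoD[OF LIMSEQ_inverse_real_of_nat]) (use p in auto)
    then obtain n0 where n0: "\<And>n. n \<ge> n0 \<Longrightarrow> e n < p / 3" unfolding eventually_sequentially by blast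
    have "norm ((LINT z|?M. v z * T n z) - 0) < r" if n: "n \<ge> n0" for n
    proof -
      have small: "\<bar>v z * T n z\<bar> \<le> \<eta> * T n z" if z: "z \<in> L_domain" for z
      proof (cases "T n z = 0")
        case False
        then have "bump (pot z / e n - 2) \<noteq> 0" "J (rad z) \<noteq> 0" by (auto simp: T_def)
        \<comment> \<open>The singular term lives where \<open>pot\<close> is below 3
          \<open>e n\<close>, hence below \<open>p\<close>, so it misses \<open>K\<close>.\<close>
        then have "pot z / e n - 2 < 1" "2 < rad z" "rad z < s1" using bump_zero[of "pot z / e n - 2"] J0(1)[of "rad z"] by force+
        then have "pot z < 3 * e n" "z \<in> annulus \<rho>"
          using e[of n] tau_less_of_rad[OF sec[OF z]] tau_ge_of_rad[OF sec[OF z], of s1] sec[OF z]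
          by (auto simp: field_simps annulus_def \<rho>_def sector_def)
        then have "z \<notin> K" using p(2)[of z] n0[OF n] by auto
        then have "\<bar>v z\<bar> \<le> \<eta>" using \<open>z \<in> annulus \<rho>\<close> by (simp add: K_def)
        then show ?thesis using T_nonneg[of n z] by (simp add: abs_mult mult_right_mono)
      qed simp
      have "\<bar>LINT z|?M. v z * T n z\<bar> \<le> (LINT z|?M. \<bar>v z * T n z\<bar>)" by (rule integral_abs_bound)
      also have "\<dots> \<le> (LINT z|?M. \<eta> * T n z)"
        using vT_int T_int small by (intro integral_mono) auto
      also have "\<dots> = \<eta> * (LINT z|?M. T n z)" by simp
      also have "\<dots> \<le> \<eta> * (C * measure ?M (space ?M))" using \<eta> T_bound by (intro mult_left_mono) auto
      also have "\<dots> < \<eta> * (C * measure ?M (space ?M) + 1)" using \<eta> by simp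
      also have "\<dots> = r" using C' by (simp add: \<eta>_def)
      finally show ?thesis by simp
    qed
    then show "\<exists>n0. \<forall>n\<ge>n0. norm ((LINT z|?M. v z * T n z) - 0) < r" by blast
  qed
  define Elim where "Elim z = pot z * J2 (rad z) * (16/9 * tau z powr (- 7/3))" for z
  have Elim_meas: "Elim \<in> borel_measurable ?M"
    unfolding Elim_def[abs_def] by (rule contL) (intro continuous_on_mult continuous_on_const cJ ctp cP)
  have "(\<lambda>n. LINT z|?M. v z * F n z) \<longlonglongrightarrow> (LINT z|?M. v z * Elim z)"
  proof (rule integral_dominated_convergence[where w = "\<lambda>_. Mv * C"])
    show "AE z in ?M. (\<lambda>n. v z * F n z) \<longlonglongrightarrow> v z * Elim z"
    proof (rule AE_I2)
      fix z assume "z \<in> space ?M"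
      then have z: "z \<in> sector" using sec by simp
      have "(\<lambda>n. F n z) \<longlonglongrightarrow> pot z * \<alpha> z + 1 * \<beta> z"
        unfolding F_def e_def by (intro tendsto_intros ramp_scaled_tendsto pot_pos[OF z])
      \<comment> \<open>Here the \<open>J1\<close> terms of \<open>\<alpha>\<close> and
        \<open>\<beta>\<close> cancel, because \<open>pot\<close> and \<open>pot * rad\<close> are
        both harmonic.\<close>
      also have "pot z * \<alpha> z + 1 * \<beta> z = Elim z" by (simp add: \<alpha>_def \<beta>_def Elim_def algebra_simps)
      finally show "(\<lambda>n. v z * F n z) \<longlonglongrightarrow> v z * Elim z" by (rule tendsto_mult_left)
    qed
    show "AE z in ?M. norm (v z * F n z) \<le> Mv * C" for n by (rule vF_le)
  qed (intro borel_measurable_times contL cv F_meas Elim_meas integrable_const)+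
  from tendsto_add[OF this vT_lim]
  have "(\<lambda>n. (LINT z|?M. v z * F n z) + (LINT z|?M. v z * T n z)) \<longlonglongrightarrow> (LINT z|?M. v z * Elim z)" by simp
  moreover have "(LINT z|?M. v z * F n z) + (LINT z|?M. v z * T n z) = (LINT z|?M. g z * \<psi> n z)" for n
  proof -
    have "(LINT z|?M. v z * F n z) + (LINT z|?M. v z * T n z) = (LINT z|?M. v z * F n z + v z * T n z)"
      using vF_int vT_int by simp
    also have "\<dots> = (LINT z|?M. v z * laplacian (\<psi> n) z)"
      by (rule Bochner_Integration.integral_cong[OF refl]) (simp add: lap distrib_left)
    finally show ?thesis using weak[OF \<psi>_test] by simp
  qed
  moreover have "(\<lambda>n. LINT z|?M. g z * \<psi> n z) \<longlonglongrightarrow> (LINT z|?M. g z * (pot z * J (rad z)))"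
  \<comment> \<open>On the bounded domain |g| <= 1 + g^2 provides an integrable majorant for the
    square integrable \<open>g\<close>.\<close>
  proof (rule integral_dominated_convergence[where w = "\<lambda>z. B0 * (1 + (g z)\<^sup>2)"])
    have gm: "g \<in> borel_measurable ?M" and g2: "integrable ?M (\<lambda>z. (g z)\<^sup>2)" using g by (auto simp: L2_def)
    show "integrable ?M (\<lambda>z. B0 * (1 + (g z)\<^sup>2))" using g2 by simp
    have \<psi>_eq: "\<psi> n z = ramp_scaled (e n) (pot z) * J (rad z)" if "z \<in> sector" for n z
      using that by (simp add: \<psi>_def cutoff_def)
    show "(\<lambda>z. g z * (pot z * J (rad z))) \<in> borel_measurable ?M"
      by (intro borel_measurable_times gm contL cP cJ)
    show "(\<lambda>z. g z * \<psi> n z) \<in> borel_measurable ?M" for n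
      by (intro borel_measurable_times gm contL C_infinity_continuous_on test_functions_C_infinity[OF \<psi>_test])
    show "AE z in ?M. (\<lambda>n. g z * \<psi> n z) \<longlonglongrightarrow> g z * (pot z * J (rad z))"
    proof (rule AE_I2)
      fix z assume "z \<in> space ?M"
      then have z: "z \<in> sector" using sec by simp
      show "(\<lambda>n. g z * \<psi> n z) \<longlonglongrightarrow> g z * (pot z * J (rad z))"
        unfolding \<psi>_eq[OF z] e_def by (intro tendsto_intros ramp_scaled_tendsto pot_pos[OF z])
    qed
    show "AE z in ?M. norm (g z * \<psi> n z) \<le> B0 * (1 + (g z)\<^sup>2)" for n
    proof (rule AE_I2)
      fix z assume "z \<in> space ?M"
      then have z: "z \<in> sector" using sec by simp
      have "\<bar>\<psi> n z\<bar> \<le> \<bar>pot z * J (rad z)\<bar>"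
        unfolding \<psi>_eq[OF z] abs_mult using ramp_scaled_bounds[OF e[of n], of "pot z"] pot_pos[OF z] by (intro mult_right_mono) auto
      also have "\<dots> \<le> B0" using B0(2)[OF z] tau_pos_sector[OF z] by simp
      finally have 1: "\<bar>\<psi> n z\<bar> \<le> B0" .
      have "0 \<le> (\<bar>g z\<bar> - 1)\<^sup>2" by simp
      then have "2 * \<bar>g z\<bar> \<le> 1 + (g z)\<^sup>2" unfolding power2_diff by simp
      then have "\<bar>g z\<bar> \<le> 1 + (g z)\<^sup>2" by linarith
      then have "\<bar>g z\<bar> * \<bar>\<psi> n z\<bar> \<le> (1 + (g z)\<^sup>2) * B0" using 1 by (intro mult_mono) auto
      then show "norm (g z * \<psi> n z) \<le> B0 * (1 + (g z)\<^sup>2)" by (simp add: abs_mult mult.commute)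
    qed
  qed
  ultimately have "(LINT z|?M. v z * Elim z) = (LINT z|?M. g z * (pot z * J (rad z)))"
    using LIMSEQ_unique by simp
  then show ?thesis by (simp only: Elim_def)
qed


subsection \<open>Green's identity up to the corner\<close>

lemma weak_laplacian_test:
  fixes \<Omega> :: "(real \<times> real) set"
  assumes "open \<Omega>" "v \<in> sobolev_H_loc 2 \<Omega>" "\<phi> \<in> test_functions \<Omega>"
  shows "(LINT z|lebesgue_on \<Omega>. v z * laplacian \<phi> z) = (LINT z|lebesgue_on \<Omega>. weak_laplacian \<Omega> v z * \<phi> z)"
proof -
  have one: "(LINT z|lebesgue_on \<Omega>. v z * partial_derivs [b, b] \<phi> z) = (LINT z|lebesgue_on \<Omega>. weak_deriv \<Omega> [b, b] v z * \<phi> z)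
    \<and> integrable (lebesgue_on \<Omega>) (\<lambda>z. v z * partial_derivs [b, b] \<phi> z)
    \<and> integrable (lebesgue_on \<Omega>) (\<lambda>z. weak_deriv \<Omega> [b, b] v z * \<phi> z)" if b: "b \<in> Basis" for b
  proof -
    have wd: "has_weak_deriv \<Omega> [b, b] v (weak_deriv \<Omega> [b, b] v)"
      by (rule has_weak_deriv_weak_deriv[OF assms(2)]) (use b in auto)
    then have li: "locally_integrable \<Omega> v" "locally_integrable \<Omega> (weak_deriv \<Omega> [b, b] v)"
      unfolding has_weak_deriv_def by auto
    have "partial_derivs [b, b] \<phi> \<in> test_functions \<Omega>"
      by (rule test_functions_partial_derivs[OF assms(3)]) (use b in auto)
    then show ?thesis
      using wd assms(3) li unfolding has_weak_deriv_def
      by (auto intro: integrable_locally_integrable_times_test[OF assms(1)] simp del: partial_derivs_Cons)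
  qed
  note o = one[OF Basis_real_prod(1)] one[OF Basis_real_prod(2)]
  show ?thesis
    unfolding laplacian_def weak_laplacian_real_prod distrib_left distrib_right
    using o by (simp del: partial_derivs_Cons)
qed

section \<open>Truncating the radial factor near the corner\<close>

definition dbump :: "real \<Rightarrow> real" where "dbump = partial_deriv 1 bump"

lemma bump_has_real_derivative: "(bump has_real_derivative dbump x) (at x)"
  unfolding dbump_def
  by (intro has_real_derivative_partial_deriv smooth_on_differentiable[OF smooth_on_bump]) simp

lemma smooth_on_dbump: "smooth_on UNIV dbump"
  unfolding dbump_def by (rule smooth_on_partial_deriv[OF smooth_on_bump]) simp

lemma dbump_eq_0: "1 < \<bar>x\<bar> \<Longrightarrow> dbump x = 0"
  unfolding dbump_def
  by (rule partial_deriv_zero_outside[of "{-1..1}"]) (auto intro: bump_zero)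

lemma dbump_bounded: obtains D where "D \<ge> 0" "\<And>x. \<bar>dbump x\<bar> \<le> D"
  using continuous_compact_support_bounded[of "{-1..1}" dbump, OF compact_Icc]
    continuous_on_subset[OF smooth_on_continuous_on[OF smooth_on_dbump]] dbump_eq_0
  by (metis abs_le_iff atLeastAtMost_iff minus_le_iff not_le subset_UNIV)

text \<open>As a function of \<open>s = r\<^bsup>-4/3\<^esup>\<close>, \<open>radcut \<Lambda>\<close> is convex apart from its truncation at \<open>s \<sim> \<Lambda>\<close>, that is, near the
  corner; \<open>radcut_err \<Lambda>\<close> is the part of the second derivative that comes from this truncation.\<close>

definition radcut :: "real \<Rightarrow> real \<Rightarrow> real" where
  "radcut \<Lambda> s = ramp (s - 4) * (1 - step (s / \<Lambda> - 3))"
definition radcut1 :: "real \<Rightarrow> real \<Rightarrow> real" where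
  "radcut1 \<Lambda> s = step (s - 4) * (1 - step (s / \<Lambda> - 3)) - ramp (s - 4) * bump (s / \<Lambda> - 3) / \<Lambda>"
definition radcut_err :: "real \<Rightarrow> real \<Rightarrow> real" where
  "radcut_err \<Lambda> s = - 2 * step (s - 4) * bump (s / \<Lambda> - 3) / \<Lambda> - ramp (s - 4) * dbump (s / \<Lambda> - 3) / \<Lambda>\<^sup>2"

lemma smooth_on_radcut: "smooth_on UNIV (radcut \<Lambda>)" "smooth_on UNIV (radcut1 \<Lambda>)" "smooth_on UNIV (\<lambda>s. bump (s - 4) + radcut_err \<Lambda> s)"
proof -
  have shift: "smooth_on UNIV (\<lambda>s. f (s - 4))" and scale: "smooth_on UNIV (\<lambda>s. f (s / \<Lambda> - 3))"
    if "smooth_on UNIV f" for f :: "real \<Rightarrow> real"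
    using smooth_on_affine_compose[OF that, of 1 "-4"] smooth_on_affine_compose[OF that, of "1/\<Lambda>" "-3"] by simp_all
  note s = shift[OF smooth_on_bump] shift[OF smooth_on_step] shift[OF smooth_on_ramp]
    scale[OF smooth_on_bump] scale[OF smooth_on_step] scale[OF smooth_on_dbump]
  show "smooth_on UNIV (radcut \<Lambda>)"
    unfolding radcut_def[abs_def] by (intro smooth_on_mult smooth_on_diff smooth_on_const s open_UNIV)
  have "smooth_on UNIV (\<lambda>s. step (s - 4) * (1 - step (s / \<Lambda> - 3)) - ramp (s - 4) * bump (s / \<Lambda> - 3) * (1 / \<Lambda>))"
    by (intro smooth_on_mult smooth_on_diff smooth_on_const s open_UNIV)
  then show "smooth_on UNIV (radcut1 \<Lambda>)" by (simp add: radcut1_def[abs_def])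
  have "smooth_on UNIV (\<lambda>s. bump (s - 4) + (- 2 * step (s - 4) * bump (s / \<Lambda> - 3) * (1 / \<Lambda>) - ramp (s - 4) * dbump (s / \<Lambda> - 3) * (1 / \<Lambda>\<^sup>2)))"
    by (intro smooth_on_mult smooth_on_diff smooth_on_add smooth_on_const s open_UNIV)
  then show "smooth_on UNIV (\<lambda>s. bump (s - 4) + radcut_err \<Lambda> s)" by (simp add: radcut_err_def[abs_def])
qed

lemma radcut_has_real_derivative:
  assumes "\<Lambda> \<ge> 5"
  shows "(radcut \<Lambda> has_real_derivative radcut1 \<Lambda> s) (at s)" "(radcut1 \<Lambda> has_real_derivative bump (s - 4) + radcut_err \<Lambda> s) (at s)"
proof -
  have sh: "((\<lambda>s. f (s - 4)) has_real_derivative f' (s - 4)) (at s)"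
    and sc: "((\<lambda>s. f (s / \<Lambda> - 3)) has_real_derivative f' (s / \<Lambda> - 3) * (1 / \<Lambda>)) (at s)"
    if "\<And>x. (f has_real_derivative f' x) (at x)" for f f' :: "real \<Rightarrow> real"
  proof -
    have "((\<lambda>s. s - 4) has_real_derivative 1) (at s)" "((\<lambda>s. s / \<Lambda> - 3) has_real_derivative 1 / \<Lambda>) (at s)"
      using assms by (auto intro!: derivative_eq_intros)
    from DERIV_chain2[OF that this(1)] DERIV_chain2[OF that this(2)]
    show "((\<lambda>s. f (s - 4)) has_real_derivative f' (s - 4)) (at s)"
      "((\<lambda>s. f (s / \<Lambda> - 3)) has_real_derivative f' (s / \<Lambda> - 3) * (1 / \<Lambda>)) (at s)" by simp_all
  qed
  note d = sh[OF ramp_has_real_derivative] sh[OF step_has_real_derivative] sc[OF step_has_real_derivative] sc[OF bump_has_real_derivative]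
  show "(radcut \<Lambda> has_real_derivative radcut1 \<Lambda> s) (at s)"
    unfolding radcut_def[abs_def] by (rule derivative_eq_intros d refl)+ (simp add: radcut1_def)
  \<comment> \<open>The bound \<open>\<Lambda> \<ge> 5\<close> separates the two transition layers:
    \<open>bump (s - 4)\<close> lives on s <= 5, the truncating step starts at
    \<open>2 * \<Lambda>\<close>. So the convex part of the second derivative is untouched by the
    truncation.\<close>
  have b: "bump (s - 4) * step (s / \<Lambda> - 3) = 0"
  proof (cases "s \<ge> 5")
    case True then show ?thesis by (simp add: bump_zero)
  next
    case False
    then have "s / \<Lambda> \<le> 1" using assms by (simp add: field_simps)
    then show ?thesis by (simp add: step_eq_0)
  qed
  have "(radcut1 \<Lambda> has_real_derivative
      bump (s - 4) * (1 - step (s / \<Lambda> - 3)) + (0 - bump (s / \<Lambda> - 3) * (1 / \<Lambda>)) * step (s - 4)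
      - (step (s - 4) * bump (s / \<Lambda> - 3) + dbump (s / \<Lambda> - 3) * (1 / \<Lambda>) * ramp (s - 4)) / \<Lambda>) (at s)"
    unfolding radcut1_def[abs_def]
    by (intro DERIV_diff DERIV_mult DERIV_const DERIV_cdivide d)
  then show "(radcut1 \<Lambda> has_real_derivative bump (s - 4) + radcut_err \<Lambda> s) (at s)"
    by (rule DERIV_cong) (use assms b in \<open>simp add: radcut_err_def field_simps power2_eq_square\<close>)
qed

lemma radcut_eq_0:
  assumes "\<Lambda> \<ge> 5" "s \<le> 2 \<or> 5 * \<Lambda> \<le> s"
  shows "radcut \<Lambda> s = 0" "radcut1 \<Lambda> s = 0" "bump (s - 4) + radcut_err \<Lambda> s = 0"
proof -
  consider "s \<le> 2" | "s / \<Lambda> - 3 \<ge> 2" "s \<ge> 5" using assms by (fastforce simp: field_simps)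
  then show "radcut \<Lambda> s = 0" "radcut1 \<Lambda> s = 0" "bump (s - 4) + radcut_err \<Lambda> s = 0"
    by (cases; simp add: radcut_def radcut1_def radcut_err_def ramp_eq_0 step_eq_0 step_eq_1 bump_zero dbump_eq_0)+
qed

lemma radcut_err_nonzero:
  assumes "\<Lambda> \<ge> 5" "radcut_err \<Lambda> s \<noteq> 0" shows "2 * \<Lambda> \<le> s" "s \<le> 4 * \<Lambda>"
proof -
  have "\<bar>s / \<Lambda> - 3\<bar> \<le> 1"
  proof (rule ccontr)
    assume "\<not> \<bar>s / \<Lambda> - 3\<bar> \<le> 1"
    then have "bump (s / \<Lambda> - 3) = 0" "dbump (s / \<Lambda> - 3) = 0" by (auto intro: bump_zero dbump_eq_0)
    then show False using assms(2) by (simp add: radcut_err_def)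
  qed
  then have "2 \<le> s / \<Lambda>" "s / \<Lambda> \<le> 4" by linarith+
  then show "2 * \<Lambda> \<le> s" "s \<le> 4 * \<Lambda>" using assms(1) by (simp_all add: field_simps)
qed

text \<open>On the truncation layer s is at most \<open>4 * \<Lambda>\<close>, so the ramp is of
  order \<open>\<Lambda>\<close> and compensates one of the two powers in the denominator.\<close>

lemma radcut_err_bound:
  obtains c where "c \<ge> 0" "\<And>\<Lambda> s. \<Lambda> \<ge> 5 \<Longrightarrow> \<bar>radcut_err \<Lambda> s\<bar> \<le> c / \<Lambda>"
proof -
  obtain D where D: "D \<ge> 0" "\<And>x. \<bar>dbump x\<bar> \<le> D" using dbump_bounded by blast
  show ?thesis
  proof (rule that[of "2 * bump_max + 4 * D"])
    show "2 * bump_max + 4 * D \<ge> 0" using bump_max(1) D(1) by simp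
    fix \<Lambda> s :: real assume L: "\<Lambda> \<ge> 5"
    show "\<bar>radcut_err \<Lambda> s\<bar> \<le> (2 * bump_max + 4 * D) / \<Lambda>"
    proof (cases "radcut_err \<Lambda> s = 0")
      case True then show ?thesis using bump_max(1) D(1) L by simp
    next
      case False
      have "\<bar>- 2 * step (s - 4) * bump (s / \<Lambda> - 3)\<bar> \<le> 2 * bump_max"
        using step_bounds[of "s - 4"] bump_nonneg[of "s / \<Lambda> - 3"] bump_max(2)[of "s / \<Lambda> - 3"]
          mult_mono[of "step (s - 4)" 1 "bump (s / \<Lambda> - 3)" bump_max] by (simp add: abs_mult)
      then have 1: "\<bar>- 2 * step (s - 4) * bump (s / \<Lambda> - 3) / \<Lambda>\<bar> \<le> 2 * bump_max / \<Lambda>"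
        using L unfolding abs_divide by (simp add: divide_right_mono)
      have s: "2 * \<Lambda> \<le> s" "s \<le> 4 * \<Lambda>" using radcut_err_nonzero[OF L False] by auto
      have "ramp (s - 4) \<le> s - 4 + 1" by (rule ramp_le) (use s L in linarith)
      then have "ramp (s - 4) \<le> 4 * \<Lambda>" using s by linarith
      then have "\<bar>ramp (s - 4) * dbump (s / \<Lambda> - 3)\<bar> \<le> 4 * \<Lambda> * D"
        unfolding abs_mult using ramp_nonneg D L by (intro mult_mono) auto
      then have "\<bar>ramp (s - 4) * dbump (s / \<Lambda> - 3) / \<Lambda>\<^sup>2\<bar> \<le> 4 * \<Lambda> * D / \<Lambda>\<^sup>2"
        using L unfolding abs_divide by (simp add: divide_right_mono)
      also have "\<dots> = 4 * D / \<Lambda>" using L by (simp add: power2_eq_square)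
      finally have 2: "\<bar>ramp (s - 4) * dbump (s / \<Lambda> - 3) / \<Lambda>\<^sup>2\<bar> \<le> 4 * D / \<Lambda>" .
      show ?thesis using 1 2 unfolding radcut_err_def add_divide_distrib by linarith
    qed
  qed
qed

lemma radcut_bounds: "0 \<le> radcut \<Lambda> s"
  "0 \<le> s \<Longrightarrow> \<Lambda>' \<ge> 5 \<Longrightarrow> \<Lambda> \<ge> \<Lambda>' \<Longrightarrow> radcut \<Lambda>' s \<le> radcut \<Lambda> s"
  "0 \<le> s \<Longrightarrow> \<Lambda>' \<ge> 5 \<Longrightarrow> \<Lambda> \<ge> \<Lambda>' \<Longrightarrow> \<bar>radcut \<Lambda> s - radcut \<Lambda>' s\<bar> \<le> (if 2 * \<Lambda>' \<le> s then s else 0)"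
proof -
  show nn: "0 \<le> radcut \<Lambda> s" for \<Lambda> unfolding radcut_def using ramp_nonneg step_bounds by (intro mult_nonneg_nonneg) auto
  assume s: "0 \<le> s" "\<Lambda>' \<ge> 5" "\<Lambda> \<ge> \<Lambda>'"
  then have "s / \<Lambda> \<le> s / \<Lambda>'" by (intro divide_left_mono) auto
  then show m: "radcut \<Lambda>' s \<le> radcut \<Lambda> s"
    unfolding radcut_def using ramp_nonneg by (intro mult_left_mono) (auto intro: step_mono)
  show "\<bar>radcut \<Lambda> s - radcut \<Lambda>' s\<bar> \<le> (if 2 * \<Lambda>' \<le> s then s else 0)"
  proof (cases "2 * \<Lambda>' \<le> s")
    case True
    then have "ramp (s - 4) \<le> s" using s ramp_le[of "s - 4"] by linarith
    moreover have "radcut \<Lambda> s \<le> ramp (s - 4)" unfolding radcut_def using ramp_nonneg step_bounds by (intro mult_left_le) auto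
    ultimately show ?thesis using True m nn[of \<Lambda>'] by simp
  next
    case False
    then have "s / \<Lambda>' \<le> 2" "s / \<Lambda> \<le> 2" using s by (auto simp: field_simps)
    then show ?thesis using False by (simp add: radcut_def step_eq_0)
  qed
qed

text \<open>The truncation layer is at distance r of order \<open>\<Lambda>\<close>^(-3/4). The
  weight on it is at most of order r^(2/3) r^(4/3) r^(-14/3) = r^(-8/3), on an area of order r^2;
  with |v| = O(r) the error is O(r^(1/3)).\<close>

lemma corner_error_tendsto_0:
  assumes "continuous_on (closure L_domain) v" "v \<in> sobolev_H 2 L_domain" "\<And>z. z \<in> frontier L_domain \<Longrightarrow> v z = 0"
  shows "(\<lambda>n. LINT z|lebesgue_on L_domain. v z * (pot z * radcut_err (real n + 5) (rad z) * (16/9 * tau z powr (- 7/3)))) \<longlonglongrightarrow> 0"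
proof -
  obtain C where C: "C \<ge> 0"
    "\<And>z \<delta>. z \<in> L_domain \<Longrightarrow> \<delta> \<le> 1/4 \<Longrightarrow> \<bar>fst z\<bar> \<le> \<delta> \<Longrightarrow> \<bar>snd z\<bar> \<le> \<delta> \<Longrightarrow> \<bar>v z\<bar> \<le> C * \<delta>"
    using L_domain_corner_bound[OF assms] by metis
  obtain c where c: "c \<ge> 0" "\<And>\<Lambda> s. \<Lambda> \<ge> 5 \<Longrightarrow> \<bar>radcut_err \<Lambda> s\<bar> \<le> c / \<Lambda>" using radcut_err_bound by metis
  define \<Lambda> where "\<Lambda> n = real n + 5" for n
  define \<delta> where "\<delta> n = (2 * \<Lambda> n) powr (- 3/4)" for n
  define b where "b n = C * \<delta> n * (c / \<Lambda> n * (16/9 * (4 * \<Lambda> n) ^ 3))" for n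
  define f where "f n z = v z * (pot z * radcut_err (\<Lambda> n) (rad z) * (16/9 * tau z powr (- 7/3)))" for n z
  have L: "\<Lambda> n \<ge> 5" for n by (simp add: \<Lambda>_def)
  have \<delta>: "0 < \<delta> n" "\<delta> n \<le> 1/4" for n
  proof -
    show "0 < \<delta> n" using L[of n] by (simp add: \<delta>_def)
    \<comment> \<open>\<open>2 * \<Lambda> n\<close> is at least 10; the number 8 is convenient
      because 8^(-2/3) is exactly 1/4, the range of the corner bound.\<close>
    have "\<delta> n \<le> 8 powr (- 3/4)" unfolding \<delta>_def using L[of n] by (intro powr_mono2') auto
    also have "\<dots> \<le> 8 powr (- 2/3)" by (intro powr_mono) auto
    also have "(8::real) powr (- 2/3) = (2 powr 3) powr (- 2/3)" by simp
    also have "\<dots> = (1/4 :: real)" unfolding powr_powr by (simp add: powr_minus)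
    finally show "\<delta> n \<le> 1/4" .
  qed
  have bn: "b n \<ge> 0" for n using C(1) c(1) \<delta>(1)[of n] L[of n] by (simp add: b_def)
  let ?S = "\<lambda>n. {- \<delta> n..\<delta> n} \<times> {- \<delta> n..\<delta> n}"
  have point: "\<bar>f n z\<bar> \<le> b n * indicat_real (?S n) z" if z: "z \<in> L_domain" for n z
  proof (cases "radcut_err (\<Lambda> n) (rad z) = 0")
    case True then show ?thesis using bn[of n] by (simp add: f_def)
  next
    case False
    have zs: "z \<in> sector" using z L_domain_subset_sector by blast
    have rad: "2 * \<Lambda> n \<le> rad z" "rad z \<le> 4 * \<Lambda> n" using radcut_err_nonzero[OF L False] by auto
    have "tau z = rad z powr (- 3/2)" using rad_powr_tau[OF zs, of 1] tau_pos_sector[OF zs] by simp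
    also have "\<dots> \<le> (2 * \<Lambda> n) powr (- 3/2)" using rad L[of n] by (intro powr_mono2') auto
    also have "\<dots> = (\<delta> n)\<^sup>2" unfolding \<delta>_def power2_eq_square by (simp flip: powr_add)
    finally have "tau z \<le> (\<delta> n)\<^sup>2" .
    then have "(fst z)\<^sup>2 \<le> (\<delta> n)\<^sup>2" "(snd z)\<^sup>2 \<le> (\<delta> n)\<^sup>2"
      using zero_le_power2[of "fst z"] zero_le_power2[of "snd z"] unfolding tau_def by linarith+
    then have xy: "\<bar>fst z\<bar> \<le> \<delta> n" "\<bar>snd z\<bar> \<le> \<delta> n" using \<delta>(1)[of n] by (auto simp: abs_le_square_iff[symmetric] simp flip: abs_le_square_iff)
    then have S: "z \<in> ?S n" by (cases z) (auto simp: abs_le_iff)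
    have v: "\<bar>v z\<bar> \<le> C * \<delta> n" by (rule C(2)[OF z \<delta>(2) xy])
    have "pot z * tau z powr (- 7/3) \<le> tau z powr (1/3) * tau z powr (- 7/3)"
      using zs by (intro mult_right_mono pot_le) (auto simp: sector_def)
    also have "\<dots> = tau z powr (- 2)" by (simp flip: powr_add)
    also have "\<dots> = rad z powr 3" using rad_powr_tau[OF zs, of "-2"] by simp
    also have "\<dots> \<le> (4 * \<Lambda> n) powr 3" using rad L[of n] by (intro powr_mono2) auto
    also have "\<dots> = (4 * \<Lambda> n) ^ 3" using L[of n] by (simp add: powr_realpow[of _ 3, simplified])
    finally have Pt: "pot z * tau z powr (- 7/3) \<le> (4 * \<Lambda> n) ^ 3" .
    have "\<bar>f n z\<bar> = \<bar>v z\<bar> * (\<bar>radcut_err (\<Lambda> n) (rad z)\<bar> * (16/9 * (pot z * tau z powr (- 7/3))))"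
      using pot_pos[OF zs] by (simp add: f_def abs_mult)
    also have "\<dots> \<le> (C * \<delta> n) * (c / \<Lambda> n * (16/9 * (4 * \<Lambda> n) ^ 3))"
      using v c(2)[OF L, of n "rad z"] Pt pot_pos[OF zs] C(1) c(1) \<delta>(1)[of n] L[of n]
      by (intro mult_mono mult_left_mono mult_nonneg_nonneg) auto
    finally show ?thesis using S by (simp add: b_def)
  qed
  have int: "\<bar>LINT z|lebesgue_on L_domain. f n z\<bar> \<le> b n * (4 * (\<delta> n)\<^sup>2)" for n
  proof -
    have I: "integrable (lebesgue_on L_domain) (\<lambda>z. b n * indicat_real (?S n) z)"
      using integral_indicator_lebesgue_on(1)[OF open_L_domain measure_lebesgue_rectangle(2)] by simp
    have "\<bar>LINT z|lebesgue_on L_domain. f n z\<bar> \<le> (LINT z|lebesgue_on L_domain. b n * indicat_real (?S n) z)"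
    proof (cases "integrable (lebesgue_on L_domain) (f n)")
      case True
      have "\<bar>LINT z|lebesgue_on L_domain. f n z\<bar> \<le> (LINT z|lebesgue_on L_domain. \<bar>f n z\<bar>)" by (rule integral_abs_bound)
      also have "\<dots> \<le> (LINT z|lebesgue_on L_domain. b n * indicat_real (?S n) z)"
        using True I point by (intro integral_mono) auto
      finally show ?thesis .
    next
      \<comment> \<open>The integral of a non-integrable function is 0 by convention, so the bound
        holds here as well.\<close>
      case False
      then have "(LINT z|lebesgue_on L_domain. f n z) = 0" by (rule not_integrable_integral_eq)
      moreover have "0 \<le> (LINT z|lebesgue_on L_domain. b n * indicat_real (?S n) z)"
        using bn[of n] by (intro integral_nonneg_AE) auto
      ultimately show ?thesis by simp
    qed
    also have "\<dots> = b n * (LINT z|lebesgue_on L_domain. indicat_real (?S n) z)" by simp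
    also have "\<dots> \<le> b n * measure lebesgue (?S n)"
      by (intro mult_left_mono integral_indicator_lebesgue_on(2)[OF open_L_domain measure_lebesgue_rectangle(2)] bn)
    also have "measure lebesgue (?S n) = 4 * (\<delta> n)\<^sup>2"
      using \<delta>(1)[of n] by (simp add: measure_lebesgue_rectangle power2_eq_square)
    finally show ?thesis .
  qed
  have "(\<lambda>n. (2 * (real n + 5)) powr (- 3/4) * (1 / (real n + 5) * (16/9 * (4 * (real n + 5)) ^ 3)) * (4 * ((2 * (real n + 5)) powr (- 3/4))\<^sup>2)) \<longlonglongrightarrow> 0"
    by real_asymp
  from tendsto_mult[OF tendsto_const[of "C * c"] this]
  have "(\<lambda>n. b n * (4 * (\<delta> n)\<^sup>2)) \<longlonglongrightarrow> 0"
    by (simp add: b_def \<delta>_def \<Lambda>_def mult_ac)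
  then have "(\<lambda>n. LINT z|lebesgue_on L_domain. f n z) \<longlonglongrightarrow> 0"
    by (rule Lim_null_comparison[rotated]) (use int in auto)
  then show ?thesis by (simp only: f_def \<Lambda>_def)
qed

section \<open>Square integrability of the singular function\<close>

lemma integrable_powr_unit_interval:
  "integrable lborel (\<lambda>x::real. indicator {0..1} x * x powr (- 2/3))"
proof -
  have "(\<lambda>x::real. x powr (- 2/3)) integrable_on {0..1}" by (rule integrable_on_powr_from_0) auto
  then have "set_integrable lebesgue {0..1} (\<lambda>x::real. x powr (- 2/3))"
    by (rule nonnegative_absolutely_integrable_1) auto
  then have "integrable lebesgue (\<lambda>x::real. indicator {0..1} x * x powr (- 2/3))"
    by (simp add: set_integrable_def)
  then show ?thesis by (subst (asm) integrable_completion) auto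
qed

text \<open>Since x^2 + y^2 >= |x| |y|, off the axes \<open>rad\<close> is at most |x|^(-2/3)
  |y|^(-2/3), a product of two integrable functions of one variable.\<close>

lemma rad_integrable: "integrable (lebesgue_on L_domain) rad"
proof -
  define h where "h x = indicator {0..1} x * x powr (- 2/3)" for x :: real
  define a where "a x = h x + h (- x)" for x
  have "integrable lborel h" unfolding h_def by (rule integrable_powr_unit_interval)
  moreover from lborel_integrable_real_affine[OF this, of "-1" 0] have "integrable lborel (\<lambda>x. h (- x))" by simp
  ultimately have "integrable lborel a" unfolding a_def by simp
  then have ia: "integrable lborel (tensor a a)" by (intro lborel_integral_tensor(1))
  then have "integrable lebesgue (tensor a a)" by (subst integrable_completion) (auto dest: borel_measurable_integrable)
  then have "integrable lebesgue (\<lambda>z. indicator L_domain z *\<^sub>R tensor a a z)"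
    using open_L_domain by (intro integrable_mult_indicator) auto
  then have iL: "integrable (lebesgue_on L_domain) (tensor a a)"
    using open_L_domain by (subst integrable_restrict_space) auto
  show ?thesis
  proof (rule Bochner_Integration.integrable_bound[OF iL])
    show "rad \<in> borel_measurable (lebesgue_on L_domain)"
      using open_L_domain continuous_on_subset[OF smooth_on_continuous_on[OF smooth_on_rad] L_domain_subset_sector]
      by (intro continuous_imp_measurable_on_sets_lebesgue) auto
    \<comment> \<open>On the axes the majorant is 0 because \<open>0 powr x = 0\<close>, so there
      the comparison fails and the axes are removed as null sets.\<close>
    have "negligible {z. z \<bullet> ((1, 0) :: real \<times> real) = 0}" "negligible {z. z \<bullet> ((0, 1) :: real \<times> real) = 0}"
      by (rule negligible_standard_hyperplane[OF Basis_real_prod(1)], rule negligible_standard_hyperplane[OF Basis_real_prod(2)])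
    then have "{z. z \<bullet> ((1, 0) :: real \<times> real) = 0} \<in> null_sets lebesgue" "{z. z \<bullet> ((0, 1) :: real \<times> real) = 0} \<in> null_sets lebesgue"
      by (simp_all add: negligible_iff_null_sets)
    from AE_not_in[OF this(1)] AE_not_in[OF this(2)]
    have "AE z in lebesgue. z \<in> L_domain \<longrightarrow> norm (rad z) \<le> norm (tensor a a z)"
    proof eventually_elim
      case (elim z)
      obtain x y where z: "z = (x, y)" by (cases z)
      have xy: "x \<noteq> 0" "y \<noteq> 0" using elim by (auto simp: z)
      show ?case
      proof
        assume "z \<in> L_domain"
        then have "\<bar>x\<bar> \<le> 1" "\<bar>y\<bar> \<le> 1" by (auto simp: z L_domain_def)
        have ah: "a t = \<bar>t\<bar> powr (- 2/3)" if "\<bar>t\<bar> \<le> 1" "t \<noteq> 0" for t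
          using that by (cases "t > 0") (auto simp: a_def h_def abs_if)
        have "\<bar>x\<bar> * \<bar>y\<bar> \<le> 2 * \<bar>x\<bar> * \<bar>y\<bar>" by simp
        also have "\<dots> \<le> tau z" using sum_squares_bound[of "\<bar>x\<bar>" "\<bar>y\<bar>"] by (simp add: tau_def z)
        finally have "rad z \<le> (\<bar>x\<bar> * \<bar>y\<bar>) powr (- 2/3)" unfolding rad_def using xy by (intro powr_mono2') auto
        also have "\<dots> = tensor a a z"
          using ah \<open>\<bar>x\<bar> \<le> 1\<close> \<open>\<bar>y\<bar> \<le> 1\<close> xy by (simp add: tensor_def z powr_mult)
        finally show "norm (rad z) \<le> norm (tensor a a z)" by (simp add: rad_def)
      qed
    qed
    then show "AE z in lebesgue_on L_domain. norm (rad z) \<le> norm (tensor a a z)"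
      using open_L_domain by (subst AE_restrict_space_iff) auto
  qed
qed

text \<open>The square of the singular function is at most r^(-4/3), which is \<open>rad\<close> and
  integrable.\<close>

lemma pot_rad_square_le: assumes "z \<in> sector" shows "(pot z * rad z)\<^sup>2 \<le> rad z"
proof -
  have t: "tau z > 0" by (rule tau_pos_sector[OF assms])
  have "pot z * rad z \<le> tau z powr (1/3) * tau z powr (- 2/3)"
    unfolding rad_def using assms by (intro mult_right_mono pot_le) (auto simp: sector_def)
  also have "\<dots> = tau z powr (- 1/3)" by (simp flip: powr_add)
  finally have "(pot z * rad z)\<^sup>2 \<le> (tau z powr (- 1/3))\<^sup>2"
    using pot_pos[OF assms] by (intro power_mono) (auto simp: rad_def)
  also have "\<dots> = rad z" by (simp add: rad_def power2_eq_square flip: powr_add)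
  finally show ?thesis .
qed

text \<open>Three limits are taken in a fixed order. For fixed \<open>j\<close> the truncation is
  removed, the error at the corner vanishing at a rate that depends on \<open>uj j\<close>. The
  bound on the Laplacians compares this with a truncation at a fixed level \<open>m\<close>,
  uniformly in \<open>j\<close>. Then \<open>j\<close> tends to infinity at level \<open>m\<close>,
  and finally \<open>m\<close> is chosen so large that the comparison error is below the integral of
  the test function.\<close>

lemma no_bounded_approximation:
  fixes u :: "real \<times> real \<Rightarrow> real" and uj :: "nat \<Rightarrow> real \<times> real \<Rightarrow> real"
  assumes ABP: "ABP_constant L_domain C"
    and sol: "poisson_strong_solution L_domain (\<lambda>_. 1) (\<lambda>_. 0) u"
    and V: "\<And>j. uj j \<in> V_space L_domain" and bound: "\<And>j. V_norm C L_domain (uj j) \<le> B"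
    and H2: "\<And>j. uj j \<in> sobolev_H 2 L_domain" and zero: "\<And>j z. z \<in> frontier L_domain \<Longrightarrow> uj j z = 0"
    and lim: "uniform_limit L_domain uj u sequentially"
  shows False
proof -
  let ?M = "lebesgue_on L_domain"
  interpret finite_measure ?M by (rule finite_measure_lebesgue_on[OF lmeasurable_L_domain])
  have sec: "z \<in> sector" if "z \<in> L_domain" for z using that L_domain_subset_sector by blast
  note contL = borel_measurable_L_domain
  note cP = continuous_on_L_domain(1) and ctp = continuous_on_L_domain(3) and cc = continuous_on_L_domain(4)
  define g where "g j = weak_laplacian L_domain (uj j)" for j
  have g: "g j \<in> L2 L_domain" and cuj: "continuous_on (closure L_domain) (uj j)" and Hj: "uj j \<in> sobolev_H_loc 2 L_domain" for j
    using V[of j] by (auto simp: V_space_def g_def)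
  obtain G where G: "\<And>j. (LINT z|?M. (g j z)\<^sup>2) \<le> G" "G \<ge> 0"
  proof -
    have C: "C > 0" using ABP by (simp add: ABP_constant_def)
    have ne: "frontier L_domain \<noteq> {}" using L_domain_frontier_axes(1)[of 0] by auto
    have "sup_norm_on (frontier L_domain) (uj j) = 0" for j
    proof -
      have "(\<lambda>z. \<bar>uj j z\<bar>) ` frontier L_domain = {0}" using zero[of _ j] ne by auto
      then show ?thesis by (simp add: sup_norm_on_def)
    qed
    then have "C * L2_norm L_domain (g j) \<le> B" for j using bound[of j] by (simp add: V_norm_def g_def)
    then have l: "L2_norm L_domain (g j) \<le> B / C" for j using C by (simp add: field_simps)
    have "(LINT z|?M. (g j z)\<^sup>2) \<le> (B / C)\<^sup>2" for j
    proof -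
      have nn: "0 \<le> (LINT z|?M. (g j z)\<^sup>2)" by (rule integral_nonneg_AE) auto
      then have "(LINT z|?M. (g j z)\<^sup>2) = (L2_norm L_domain (g j))\<^sup>2" by (simp add: L2_norm_def)
      also have "\<dots> \<le> (B / C)\<^sup>2" using l nn by (intro power_mono) (auto simp: L2_norm_def)
      finally show ?thesis .
    qed
    then show ?thesis using that[of "(B / C)\<^sup>2"] by simp
  qed
  have u: "continuous_on (closure L_domain) u" "u \<in> sobolev_H_loc 2 L_domain"
    "AE z in ?M. - weak_laplacian L_domain u z = 1" "\<And>z. z \<in> frontier L_domain \<Longrightarrow> u z = 0"
    using sol unfolding poisson_strong_solution_def by auto
  have u_nonneg: "0 \<le> u z" if "z \<in> L_domain" for z by (rule strong_solution_nonneg[OF ABP sol that])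
  have weak_u: "(LINT z|?M. u z * laplacian \<phi> z) = (LINT z|?M. - 1 * \<phi> z)" if t: "\<phi> \<in> test_functions L_domain" for \<phi>
  proof -
    have "(LINT z|?M. u z * laplacian \<phi> z) = (LINT z|?M. weak_laplacian L_domain u z * \<phi> z)"
      by (rule weak_laplacian_test[OF open_L_domain u(2) t])
    also have "\<dots> = (LINT z|?M. - 1 * \<phi> z)"
    proof (rule integral_cong_AE)
      \<comment> \<open>The equation for \<open>u\<close> holds only almost everywhere;
        measurability of the product comes from local integrability of the chosen weak
        derivatives.\<close>
      have "locally_integrable L_domain (weak_deriv L_domain [b, b] u)" if "b \<in> Basis" for b
        using has_weak_deriv_weak_deriv[OF u(2), of "[b, b]"] that by (simp add: has_weak_deriv_def)
      from this[OF Basis_real_prod(1)] this[OF Basis_real_prod(2)]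
      have "integrable ?M (\<lambda>z. weak_deriv L_domain [(1, 0), (1, 0)] u z * \<phi> z + weak_deriv L_domain [(0, 1), (0, 1)] u z * \<phi> z)"
        by (intro Bochner_Integration.integrable_add integrable_locally_integrable_times_test[OF open_L_domain _ t])
      then show "(\<lambda>z. weak_laplacian L_domain u z * \<phi> z) \<in> borel_measurable ?M"
        by (simp add: weak_laplacian_real_prod distrib_right borel_measurable_integrable)
      show "(\<lambda>z. - 1 * \<phi> z) \<in> borel_measurable ?M"
        by (intro contL continuous_on_mult continuous_on_const C_infinity_continuous_on test_functions_C_infinity[OF t])
      show "AE z in ?M. weak_laplacian L_domain u z * \<phi> z = - 1 * \<phi> z"
        using u(3) by eventually_elim auto
    qed
    finally show ?thesis .
  qed
  have minus1: "(\<lambda>_. - 1) \<in> L2 L_domain" by (simp add: L2_def)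
  define \<Lambda> where "\<Lambda> n = real n + 5" for n
  have L5: "\<Lambda> n \<ge> 5" for n by (simp add: \<Lambda>_def)
  \<comment> \<open>\<open>E + R n\<close> is the Laplacian of \<open>\<Phi> n\<close>: the
    nonnegative part from convexity, fixed in n, and the part produced by the truncation.\<close>
  define \<Phi> where "\<Phi> n z = pot z * radcut (\<Lambda> n) (rad z)" for n z
  define E where "E z = pot z * bump (rad z - 4) * (16/9 * tau z powr (- 7/3))" for z
  define R where "R n z = pot z * radcut_err (\<Lambda> n) (rad z) * (16/9 * tau z powr (- 7/3))" for n z
  \<comment> \<open>At a fixed truncation level the identity holds for \<open>u\<close> and for
    every \<open>uj j\<close> alike; the decay that \<open>u\<close> may lack enters only when the
    truncation is removed.\<close>
  have id: "(LINT z|?M. v z * (E z + R n z)) = (LINT z|?M. h z * \<Phi> n z)"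
    if "continuous_on (closure L_domain) v" "\<And>z. z \<in> frontier L_domain \<Longrightarrow> v z = 0" "h \<in> L2 L_domain"
      "\<And>\<phi>. \<phi> \<in> test_functions L_domain \<Longrightarrow> (LINT z|?M. v z * laplacian \<phi> z) = (LINT z|?M. h z * \<phi> z)" for v h n
  proof -
    have eq: "E z + R n z = pot z * (bump (rad z - 4) + radcut_err (\<Lambda> n) (rad z)) * (16/9 * tau z powr (- 7/3))" for z
      by (simp only: E_def R_def distrib_left distrib_right)
    have "5 * \<Lambda> n > 2" using L5[of n] by simp
    show ?thesis
      unfolding eq \<Phi>_def
      by (rule edge_identity[OF smooth_on_radcut \<open>5 * \<Lambda> n > 2\<close> radcut_has_real_derivative[OF L5] radcut_eq_0[OF L5] radcut_bounds(1) that])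
  qed
  have id_u: "(LINT z|?M. u z * (E z + R n z)) = (LINT z|?M. - 1 * \<Phi> n z)" for n
    by (rule id[OF u(1,4) minus1 weak_u])
  have id_uj: "(LINT z|?M. uj j z * (E z + R n z)) = (LINT z|?M. g j z * \<Phi> n z)" for j n
    unfolding g_def by (rule id[OF cuj zero g[unfolded g_def] weak_laplacian_test[OF open_L_domain Hj]])
  obtain bE where bE: "\<And>z. z \<in> L_domain \<Longrightarrow> \<bar>E z\<bar> \<le> bE" and E_meas: "E \<in> borel_measurable ?M"
    and ER: "\<And>n. \<exists>b. (\<forall>z\<in>L_domain. \<bar>R n z\<bar> \<le> b)" and R_meas: "\<And>n. R n \<in> borel_measurable ?M"
  proof -
    have bnd: "\<exists>b. \<forall>z\<in>L_domain. \<bar>pot z * H (rad z) * (16/9 * tau z powr (- 7/3))\<bar> \<le> b"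
      if H: "smooth_on UNIV H" "\<And>s. s \<le> 2 \<or> s1 \<le> s \<Longrightarrow> H s = 0" for H s1
    proof -
      obtain b where b: "\<And>z. z \<in> sector \<Longrightarrow> \<bar>pot z * H (rad z) * tau z powr (- 7/3)\<bar> \<le> b"
        using pot_rad_tau_bounded[OF H] by blast
      have "\<bar>pot z * H (rad z) * (16/9 * tau z powr (- 7/3))\<bar> \<le> 16/9 * b" if "z \<in> L_domain" for z
        using b[OF sec[OF that]] by (simp add: abs_mult mult_ac)
      then show ?thesis by blast
    qed
    have sb: "smooth_on UNIV (\<lambda>s. bump (s - 4))" using smooth_on_affine_compose[OF smooth_on_bump, of 1 "-4"] by simp
    have sR: "smooth_on UNIV (radcut_err (\<Lambda> n))" for n
      using smooth_on_diff[OF open_UNIV smooth_on_radcut(3) sb, of "\<Lambda> n"] by simp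
    have zb: "bump (s - 4) = 0" if "s \<le> 2 \<or> 6 \<le> s" for s using that by (intro bump_zero) auto
    have zR: "radcut_err (\<Lambda> n) s = 0" if "s \<le> 2 \<or> 5 * \<Lambda> n \<le> s" for s n
      using radcut_eq_0(3)[OF L5 that] zb[of s] that L5[of n] by auto
    have "\<exists>b. \<forall>z\<in>L_domain. \<bar>E z\<bar> \<le> b" unfolding E_def by (rule bnd[OF sb zb])
    moreover have "\<exists>b. \<forall>z\<in>L_domain. \<bar>R n z\<bar> \<le> b" for n unfolding R_def by (rule bnd[OF sR zR])
    moreover have "E \<in> borel_measurable ?M" "R n \<in> borel_measurable ?M" for n
      unfolding E_def[abs_def] R_def[abs_def]
      by (rule contL, intro continuous_on_mult continuous_on_const cP ctp cc[OF sb],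
          rule contL, intro continuous_on_mult continuous_on_const cP ctp cc[OF sR])
    ultimately show ?thesis using that by blast
  qed
  have prod_int: "integrable ?M (\<lambda>z. v z * F z)"
    if v: "continuous_on (closure L_domain) v" and F: "F \<in> borel_measurable ?M" "\<exists>b. \<forall>z\<in>L_domain. \<bar>F z\<bar> \<le> b" for v F :: "real \<times> real \<Rightarrow> real"
  proof -
    obtain b where b: "\<And>z. z \<in> L_domain \<Longrightarrow> \<bar>F z\<bar> \<le> b" using F(2) by blast
    obtain c where c: "\<And>z. z \<in> L_domain \<Longrightarrow> \<bar>v z\<bar> \<le> c" using bounded_on_L_domain[OF v] closure_subset by (metis subsetD)
    have "v \<in> borel_measurable ?M" using v continuous_on_subset closure_subset by (intro contL) blast
    moreover have "AE z in ?M. norm (v z * F z) \<le> \<bar>c\<bar> * \<bar>b\<bar>"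
    proof (rule AE_I2)
      fix z assume "z \<in> space ?M"
      then have z: "z \<in> L_domain" by simp
      show "norm (v z * F z) \<le> \<bar>c\<bar> * \<bar>b\<bar>"
        unfolding real_norm_def abs_mult using b[OF z] c[OF z] by (intro mult_mono) auto
    qed
    ultimately show ?thesis using F(1) by (intro integrable_const_bound[where B = "\<bar>c\<bar> * \<bar>b\<bar>"] borel_measurable_times)
  qed
  have vE: "integrable ?M (\<lambda>z. v z * E z)" and vR: "integrable ?M (\<lambda>z. v z * R n z)"
    if "continuous_on (closure L_domain) v" for v n
    using prod_int[OF that E_meas] prod_int[OF that R_meas ER] bE by blast+
  have uniform_int: "(\<lambda>j. LINT z|?M. uj j z * F z) \<longlonglongrightarrow> (LINT z|?M. u z * F z)"
    if F: "F \<in> borel_measurable ?M" "\<exists>b. \<forall>z\<in>L_domain. \<bar>F z\<bar> \<le> b" for F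
  proof (rule LIMSEQ_I)
    fix r :: real assume "r > 0"
    obtain b where b: "\<And>z. z \<in> L_domain \<Longrightarrow> \<bar>F z\<bar> \<le> b" using F(2) by blast
    define m where "m = measure ?M (space ?M)"
    define \<eta> where "\<eta> = r / (\<bar>b\<bar> * m + 1)"
    have m: "\<bar>b\<bar> * m \<ge> 0" by (simp add: m_def)
    have \<eta>: "\<eta> > 0" using \<open>r > 0\<close> m by (simp add: \<eta>_def)
    obtain j0 where j0: "\<And>j z. j \<ge> j0 \<Longrightarrow> z \<in> L_domain \<Longrightarrow> \<bar>uj j z - u z\<bar> < \<eta>"
      using uniform_limitD[OF lim \<eta>] unfolding eventually_sequentially dist_real_def by blast
    have "norm ((LINT z|?M. uj j z * F z) - (LINT z|?M. u z * F z)) < r" if j: "j \<ge> j0" for j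
    proof -
      have i: "integrable ?M (\<lambda>z. uj j z * F z)" "integrable ?M (\<lambda>z. u z * F z)"
        using prod_int[OF cuj F] prod_int[OF u(1) F] by auto
      have "\<bar>(LINT z|?M. uj j z * F z) - (LINT z|?M. u z * F z)\<bar> = \<bar>LINT z|?M. uj j z * F z - u z * F z\<bar>" using i by simp
      also have "\<dots> \<le> (LINT z|?M. \<bar>uj j z * F z - u z * F z\<bar>)" by (rule integral_abs_bound)
      also have "\<dots> \<le> (LINT z|?M. \<eta> * \<bar>b\<bar>)"
      proof (rule integral_mono)
        fix z assume "z \<in> space ?M"
        then have z: "z \<in> L_domain" by simp
        have "\<bar>uj j z * F z - u z * F z\<bar> = \<bar>uj j z - u z\<bar> * \<bar>F z\<bar>" by (simp add: abs_mult flip: left_diff_distrib)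
        also have "\<dots> \<le> \<eta> * \<bar>b\<bar>" using j0[OF j z] b[OF z] \<eta> by (intro mult_mono) auto
        finally show "\<bar>uj j z * F z - u z * F z\<bar> \<le> \<eta> * \<bar>b\<bar>" .
      qed (use i in auto)
      also have "\<dots> = \<eta> * (\<bar>b\<bar> * m)" by (simp add: m_def mult_ac)
      also have "\<dots> < \<eta> * (\<bar>b\<bar> * m + 1)" using \<eta> by simp
      also have "\<dots> = r" using m by (simp add: \<eta>_def)
      finally show ?thesis by simp
    qed
    then show "\<exists>j0. \<forall>j\<ge>j0. norm ((LINT z|?M. uj j z * F z) - (LINT z|?M. u z * F z)) < r" by blast
  qed
  have sg0: "0 \<le> rad z" for z by (simp add: rad_def)
  \<comment> \<open>\<open>\<Phi> n\<close> and \<open>\<Phi> m\<close> agree where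
    \<open>rad\<close> is below \<open>2 * \<Lambda> m\<close>, and elsewhere the square of their
    difference is at most \<open>rad\<close>; so this majorises the square for all n >= m.\<close>
  define tail where "tail m z = (if 2 * \<Lambda> m \<le> rad z then rad z else 0)" for m z
  have rad_meas: "rad \<in> borel_measurable ?M" by (rule contL[OF continuous_on_L_domain(2)])
  have tail_meas: "tail m \<in> borel_measurable ?M" for m
    unfolding tail_def[abs_def] using rad_meas by measurable
  have tail_int: "integrable ?M (tail m)" for m
    by (rule Bochner_Integration.integrable_bound[OF rad_integrable tail_meas]) (auto simp: tail_def sg0)
  have tail_lim: "(\<lambda>m. LINT z|?M. tail m z) \<longlonglongrightarrow> 0"
  proof -
    have "(\<lambda>m. LINT z|?M. tail m z) \<longlonglongrightarrow> (LINT z|?M. 0)"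
    proof (rule integral_dominated_convergence[OF _ tail_meas rad_integrable])
      show "AE z in ?M. (\<lambda>m. tail m z) \<longlonglongrightarrow> 0"
      proof (rule AE_I2)
        fix z
        obtain k :: nat where "rad z < real k" using reals_Archimedean2 by blast
        then have "tail m z = 0" if "m \<ge> k" for m using that by (auto simp: tail_def \<Lambda>_def)
        then show "(\<lambda>m. tail m z) \<longlonglongrightarrow> 0"
          by (intro tendsto_eventually) (auto simp: eventually_sequentially)
      qed
      show "AE z in ?M. norm (tail m z) \<le> rad z" for m by (rule AE_I2) (simp add: tail_def sg0)
    qed simp
    then show ?thesis by simp
  qed
  have \<Phi>_meas: "\<Phi> n \<in> borel_measurable ?M" for n
    unfolding \<Phi>_def[abs_def] by (rule contL) (intro continuous_on_mult cP cc smooth_on_radcut)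
  have \<Phi>_diff: "(\<Phi> n z - \<Phi> m z)\<^sup>2 \<le> tail m z" if "n \<ge> m" "z \<in> L_domain" for n m z
  proof -
    note zs = sec[OF that(2)]
    have "\<bar>\<Phi> n z - \<Phi> m z\<bar> = pot z * \<bar>radcut (\<Lambda> n) (rad z) - radcut (\<Lambda> m) (rad z)\<bar>"
      using pot_pos[OF zs] by (simp add: \<Phi>_def abs_mult flip: right_diff_distrib)
    also have "\<dots> \<le> pot z * tail m z"
      unfolding tail_def using radcut_bounds(3)[OF sg0 L5[of m], of "\<Lambda> n" z] that(1) pot_pos[OF zs]
      by (intro mult_left_mono) (auto simp: \<Lambda>_def)
    finally have "(\<Phi> n z - \<Phi> m z)\<^sup>2 \<le> (pot z * tail m z)\<^sup>2"
      using power_mono[of "\<bar>\<Phi> n z - \<Phi> m z\<bar>" "pot z * tail m z" 2] by simp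
    also have "\<dots> \<le> tail m z" using pot_rad_square_le[OF zs] by (simp add: tail_def)
    finally show ?thesis .
  qed
  have \<Phi>_L2: "\<Phi> n \<in> L2 L_domain" for n
  proof -
    have "(\<Phi> n z)\<^sup>2 \<le> rad z" if "z \<in> L_domain" for z
    proof -
      note zs = sec[OF that]
      have "radcut (\<Lambda> n) (rad z) \<le> rad z"
      proof (cases "rad z \<le> 3")
        case True then show ?thesis using sg0[of z] by (simp add: radcut_def ramp_eq_0)
      next
        case False
        have "radcut (\<Lambda> n) (rad z) \<le> ramp (rad z - 4)" unfolding radcut_def using ramp_nonneg step_bounds by (intro mult_left_le) auto
        also have "\<dots> \<le> rad z" using ramp_le[of "rad z - 4"] False by linarith
        finally show ?thesis .
      qed
      then have "\<Phi> n z \<le> pot z * rad z" unfolding \<Phi>_def using pot_pos[OF zs] by (intro mult_left_mono) auto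
      moreover have "0 \<le> \<Phi> n z" unfolding \<Phi>_def using pot_pos[OF zs] radcut_bounds(1) by (intro mult_nonneg_nonneg) auto
      ultimately have "(\<Phi> n z)\<^sup>2 \<le> (pot z * rad z)\<^sup>2" by (intro power_mono)
      then show ?thesis using pot_rad_square_le[OF zs] by linarith
    qed
    then have "integrable ?M (\<lambda>z. (\<Phi> n z)\<^sup>2)"
      using \<Phi>_meas by (intro Bochner_Integration.integrable_bound[OF rad_integrable]) (auto intro!: AE_I2 simp: sg0)
    then show ?thesis using \<Phi>_meas by (simp add: L2_def)
  qed
  have diff_L2: "(\<lambda>z. \<Phi> n z - \<Phi> m z) \<in> L2 L_domain" for n m
  proof -
    have "(\<lambda>z. - \<Phi> m z) \<in> L2 L_domain" using \<Phi>_L2[of m] by (simp add: L2_def)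
    from L2_add[OF \<Phi>_L2[of n] this] show ?thesis by simp
  qed
  \<comment> \<open>The bound \<open>G\<close> on the Laplacians enters here and makes the error
    independent of \<open>j\<close> and \<open>n\<close>.\<close>
  have pair_tail: "(LINT z|?M. g j z * \<Phi> n z) \<le> (LINT z|?M. g j z * \<Phi> m z) + (t * G + (LINT z|?M. tail m z) / t) / 2"
    if "n \<ge> m" "t > 0" for j n m t
  proof -
    have i: "integrable ?M (\<lambda>z. g j z * \<Phi> n z)" "integrable ?M (\<lambda>z. g j z * \<Phi> m z)"
      using L2_pairing_le(1)[OF g \<Phi>_L2, of 1] by simp_all
    have "(LINT z|?M. g j z * \<Phi> n z) - (LINT z|?M. g j z * \<Phi> m z) = (LINT z|?M. g j z * (\<Phi> n z - \<Phi> m z))"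
      using i by (simp add: right_diff_distrib)
    also have "\<dots> \<le> (t * (LINT z|?M. (g j z)\<^sup>2) + (LINT z|?M. (\<Phi> n z - \<Phi> m z)\<^sup>2) / t) / 2"
      using L2_pairing_le(2)[OF g[of j] diff_L2[of n m] \<open>t > 0\<close>] by linarith
    also have "\<dots> \<le> (t * G + (LINT z|?M. tail m z) / t) / 2"
    proof (intro divide_right_mono add_mono mult_left_mono)
      have "integrable ?M (\<lambda>z. (\<Phi> n z - \<Phi> m z)\<^sup>2)" using diff_L2[of n m] by (simp add: L2_def)
      then show "(LINT z|?M. (\<Phi> n z - \<Phi> m z)\<^sup>2) \<le> (LINT z|?M. tail m z)"
        using tail_int \<Phi>_diff[OF \<open>n \<ge> m\<close>] by (intro integral_mono) auto
    qed (use G that(2) in auto)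
    finally show ?thesis by linarith
  qed
  \<comment> \<open>With \<open>j\<close> fixed, n tends to infinity: the \<open>R n\<close> term
    vanishes by linear decay of \<open>uj j\<close> at the corner, and the right side is
    unaffected.\<close>
  have corner: "(LINT z|?M. uj j z * E z) \<le> (LINT z|?M. g j z * \<Phi> m z) + (t * G + (LINT z|?M. tail m z) / t) / 2"
    if "t > 0" for j m t
  proof (rule LIMSEQ_le_const2)
    have "(\<lambda>n. LINT z|?M. uj j z * R n z) \<longlonglongrightarrow> 0"
      using corner_error_tendsto_0[OF cuj H2 zero] by (simp add: R_def \<Lambda>_def)
    from tendsto_add[OF tendsto_const[of "LINT z|?M. uj j z * E z"] this]
    have "(\<lambda>n. (LINT z|?M. uj j z * E z) + (LINT z|?M. uj j z * R n z)) \<longlonglongrightarrow> (LINT z|?M. uj j z * E z)" by simp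
    moreover have "(LINT z|?M. uj j z * E z) + (LINT z|?M. uj j z * R n z) = (LINT z|?M. g j z * \<Phi> n z)" for n
      using id_uj[of j n] vE[OF cuj] vR[OF cuj] by (simp add: distrib_left)
    ultimately show "(\<lambda>n. LINT z|?M. g j z * \<Phi> n z) \<longlonglongrightarrow> (LINT z|?M. uj j z * E z)" by simp
    show "\<exists>N. \<forall>n\<ge>N. (LINT z|?M. g j z * \<Phi> n z) \<le> (LINT z|?M. g j z * \<Phi> m z) + (t * G + (LINT z|?M. tail m z) / t) / 2"
      using pair_tail[OF _ that] by blast
  qed
  have main: "(LINT z|?M. u z * E z) \<le> (LINT z|?M. - 1 * \<Phi> m z) + (t * G + (LINT z|?M. tail m z) / t) / 2"
    if "t > 0" for m t
  proof (rule LIMSEQ_le)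
    show "(\<lambda>j. LINT z|?M. uj j z * E z) \<longlonglongrightarrow> (LINT z|?M. u z * E z)"
      by (rule uniform_int[OF E_meas]) (use bE in blast)
    \<comment> \<open>Only uniform convergence of the functions is at hand. The limit of the
      pairings of \<open>g j\<close> with \<open>\<Phi> m\<close> is obtained by rewriting them as
      integrals of \<open>uj j\<close> against the Laplacian of \<open>\<Phi> m\<close> and reading
      the identity backwards for \<open>u\<close>.\<close>
    have "(\<lambda>j. LINT z|?M. uj j z * (E z + R m z)) \<longlonglongrightarrow> (LINT z|?M. u z * (E z + R m z))"
    proof (rule uniform_int)
      show "(\<lambda>z. E z + R m z) \<in> borel_measurable ?M" using E_meas R_meas by (rule borel_measurable_add)
      obtain b where "\<forall>z\<in>L_domain. \<bar>R m z\<bar> \<le> b" using ER by blast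
      then have "\<bar>E z + R m z\<bar> \<le> bE + b" if "z \<in> L_domain" for z using bE[OF that] that by (meson abs_triangle_ineq add_mono order_trans)
      then show "\<exists>b. \<forall>z\<in>L_domain. \<bar>E z + R m z\<bar> \<le> b" by blast
    qed
    then show "(\<lambda>j. (LINT z|?M. g j z * \<Phi> m z) + (t * G + (LINT z|?M. tail m z) / t) / 2)
        \<longlonglongrightarrow> (LINT z|?M. - 1 * \<Phi> m z) + (t * G + (LINT z|?M. tail m z) / t) / 2"
      unfolding id_uj id_u by (intro tendsto_add tendsto_const)
    show "\<exists>N. \<forall>j\<ge>N. (LINT z|?M. uj j z * E z) \<le> (LINT z|?M. g j z * \<Phi> m z) + (t * G + (LINT z|?M. tail m z) / t) / 2"
      using corner[OF that] by blast
  qed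
  have E_nonneg: "0 \<le> (LINT z|?M. u z * E z)"
  proof (rule integral_nonneg_AE, rule AE_I2)
    fix z assume "z \<in> space ?M"
    then have z: "z \<in> L_domain" by simp
    show "0 \<le> u z * E z"
      unfolding E_def using u_nonneg[OF z] pot_pos[OF sec[OF z]] bump_nonneg by (intro mult_nonneg_nonneg) auto
  qed
  have \<Phi>_int: "integrable ?M (\<Phi> n)" for n
    using L2_pairing_le(1)[OF minus1 \<Phi>_L2, of 1 n] by simp
  have \<Phi>_nonneg: "0 \<le> \<Phi> n z" if "z \<in> L_domain" for n z
    unfolding \<Phi>_def using pot_pos[OF sec[OF that]] radcut_bounds(1) by (intro mult_nonneg_nonneg) auto
  define p where "p = (LINT z|?M. \<Phi> 0 z)"
  have p_pos: "p > 0"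
  proof -
    have p_nn: "p \<ge> 0" unfolding p_def using \<Phi>_nonneg by (intro integral_nonneg_AE AE_I2) auto
    have "p \<noteq> 0"
    proof
      assume "p = 0"
      then have "AE z in ?M. \<Phi> 0 z = 0"
        unfolding p_def using \<Phi>_nonneg by (subst (asm) integral_nonneg_eq_0_iff_AE[OF \<Phi>_int]) (auto intro!: AE_I2)
      then have "AE z in lebesgue. z \<in> L_domain \<longrightarrow> \<Phi> 0 z = 0"
        using open_L_domain by (subst (asm) AE_restrict_space_iff) auto
      then obtain N where N: "N \<in> null_sets lebesgue" "{z. \<not> (z \<in> L_domain \<longrightarrow> \<Phi> 0 z = 0)} \<subseteq> N"
        unfolding eventually_ae_filter by auto
      define S where "S = L_domain \<inter> \<Phi> 0 -` {0<..}"
      have "continuous_on L_domain (\<Phi> 0)" unfolding \<Phi>_def[abs_def] by (intro continuous_on_mult cP cc smooth_on_radcut)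
      then have "open S" unfolding S_def by (intro continuous_open_preimage open_L_domain) auto
      have "S \<subseteq> N" using N(2) by (auto simp: S_def)
      then have "negligible S" using N(1) negligible_iff_null_sets negligible_subset by blast
      \<comment> \<open>The value 1/27 of \<open>tau\<close> makes \<open>rad\<close> equal to 9,
        between the end 5 of the lower layer and the start 10 of the truncation at level 0, so the
        radial factor is positive there.\<close>
      moreover have "(- sqrt (1/27), 0) \<in> S"
      proof -
        let ?z = "(- sqrt (1/27), 0) :: real \<times> real"
        have t: "tau ?z = 1/27" by (simp add: tau_def)
        have "(1/27 :: real) = 3 powr (- 3)" by (simp add: powr_minus)
        then have "(1/27 :: real) powr (- 2/3) = (3 powr (- 3)) powr (- 2/3)" by (rule arg_cong)
        also have "\<dots> = 9" unfolding powr_powr by simp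
        finally have sg9: "rad ?z = 9" unfolding rad_def t .
        have zs: "?z \<in> sector" by (simp add: sector_def)
        have zL: "?z \<in> L_domain" by (rule sector_disc_subset_L_domain[OF zs]) (simp add: t)
        have "ramp 5 \<ge> 4" using ramp_eq[of 5] ramp_nonneg[of 1] by simp
        moreover have "step (9 / 5 - 3) = 0" by (rule step_eq_0) simp
        ultimately have "radcut (\<Lambda> 0) (rad ?z) > 0" by (simp add: radcut_def \<Lambda>_def sg9)
        then show ?thesis using zL pot_pos[OF zs] by (simp add: S_def \<Phi>_def)
      qed
      ultimately show False using open_not_negligible[OF \<open>open S\<close>] by blast
    qed
    then show ?thesis using p_nn by simp
  qed
  have p_le: "p \<le> (LINT z|?M. \<Phi> m z)" for m
    unfolding p_def
  proof (rule integral_mono[OF \<Phi>_int \<Phi>_int])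
    fix z assume "z \<in> space ?M"
    then have z: "z \<in> L_domain" by simp
    show "\<Phi> 0 z \<le> \<Phi> m z"
      unfolding \<Phi>_def using pot_pos[OF sec[OF z]] radcut_bounds(2)[OF sg0 L5[of 0], of "\<Lambda> m" z]
      by (intro mult_left_mono) (auto simp: \<Lambda>_def)
  qed
  \<comment> \<open>This \<open>t\<close> keeps t G at most p, and a tail integral below p t then
    makes the second term smaller than p; half the sum stays below p, which bounds every integral of
    \<open>\<Phi> m\<close> from below.\<close>
  define t where "t = p / (G + 1)"
  have t: "t > 0" using p_pos G(2) by (simp add: t_def)
  have tG: "t * G \<le> p" using p_pos G(2) by (simp add: t_def field_simps)
  have "\<forall>\<^sub>F m in sequentially. (LINT z|?M. tail m z) < p * t"
    by (rule order_tendstoD[OF tail_lim]) (use p_pos t in simp)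
  then obtain m where "(LINT z|?M. tail m z) < p * t" unfolding eventually_sequentially by blast
  then have "(LINT z|?M. tail m z) / t < p" using t by (simp add: field_simps)
  then have "(t * G + (LINT z|?M. tail m z) / t) / 2 < (p + p) / 2"
    using tG by (intro divide_strict_right_mono add_le_less_mono) auto
  then have "(t * G + (LINT z|?M. tail m z) / t) / 2 < (LINT z|?M. \<Phi> m z)" using p_le[of m] by simp
  then have "(LINT z|?M. u z * E z) < (LINT z|?M. - 1 * \<Phi> m z) + (LINT z|?M. \<Phi> m z)"
    by (intro le_less_trans[OF main[OF t, of m]] add_strict_left_mono)
  then have "(LINT z|?M. u z * E z) < 0" by simp
  then show False using E_nonneg by simp
qed

theorem proposition2p8:
  fixes C_ABP :: real and u :: "real \<times> real \<Rightarrow> real"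
  assumes "ABP_constant L_domain C_ABP"
    and "poisson_strong_solution L_domain (\<lambda>_. 1) (\<lambda>_. 0) u"
  shows "\<not> (\<exists>u\<^sub>j :: nat \<Rightarrow> real \<times> real \<Rightarrow> real.
            (\<forall>j. u\<^sub>j j \<in> V_space L_domain) \<and>
            (\<exists>B. \<forall>j. V_norm C_ABP L_domain (u\<^sub>j j) \<le> B) \<and>
            (\<forall>j. u\<^sub>j j \<in> sobolev_H 2 L_domain) \<and>
            (\<forall>j. \<forall>x\<in>frontier L_domain. u\<^sub>j j x = 0) \<and>
            uniform_limit L_domain u\<^sub>j u sequentially)"
proof
  assume "\<exists>u\<^sub>j :: nat \<Rightarrow> real \<times> real \<Rightarrow> real.
            (\<forall>j. u\<^sub>j j \<in> V_space L_domain) \<and>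
            (\<exists>B. \<forall>j. V_norm C_ABP L_domain (u\<^sub>j j) \<le> B) \<and>
            (\<forall>j. u\<^sub>j j \<in> sobolev_H 2 L_domain) \<and>
            (\<forall>j. \<forall>x\<in>frontier L_domain. u\<^sub>j j x = 0) \<and>
            uniform_limit L_domain u\<^sub>j u sequentially"
  then obtain u\<^sub>j B where "\<And>j. u\<^sub>j j \<in> V_space L_domain" "\<And>j. V_norm C_ABP L_domain (u\<^sub>j j) \<le> B"
    "\<And>j. u\<^sub>j j \<in> sobolev_H 2 L_domain" "\<And>j z. z \<in> frontier L_domain \<Longrightarrow> u\<^sub>j j z = 0"
    "uniform_limit L_domain u\<^sub>j u sequentially" by blast
  from no_bounded_approximation[OF assms this] show False .
qed

end
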